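(* Let $L$ be an algebra that is free of finite rank as an abelian group. Then the sequence $\{\widehat{T}_L(n)\}_{n\ge1}$ in $\widehat{R}_L$ is multiplicative, and the Euler product formula $$\widehat{D}_L(s)=\prod_p P_{L_p}(p^{-s})$$ holds, where $p$ runs through all prime numbers.
   Context: **Hecke rings.** Let $G$ be a group, $\Delta\subset G$ a submonoid, $\Gamma\subset\Delta$ a subgroup such that $\Gamma\backslash\Gamma A\Gamma$ and $\Gamma A\Gamma/\Gamma$ are finite for all $A\in\Delta$. The Hecke ring $R(\Gamma,\Delta)$ is the free abelian group on $\Gamma\backslash\Delta/\Gamma$ with product $(\Gamma A\Gamma)(\Gamma B\Gamma)=\sum_{\Gamma C\Gamma}\#\{\Gamma\beta\in\Gamma\backslash\Gamma B\Gamma : C\beta^{-1}\in\Gamma A\Gamma\}\cdot\Gamma C\Gamma$. **Hecke rings of an algebra.** An algebra is an abelian group with a bi-additive product. For $L$ as in the claim, $L_p=L\otimes\mathbb{Z}_p$ and $\widehat L=L\otimes\widehat{\mathbb{Z}}=\prod_pL_p$. Algebra endomorphisms act on the right; the image of $L$ under $\alpha$ is $L^\alpha$. For each prime $p$ put $G_{L_p}=\mathrm{Aut}^{alg}_{\mathbb{Q}_p}(L\otimes\mathbb{Q}_p)$, $\Delta_{L_p}=\mathrm{End}^{alg}_{\mathbb{Z}_p}(L_p)\cap G_{L_p}$, $\Gamma_{L_p}=\mathrm{Aut}^{alg}_{\mathbb{Z}_p}(L_p)$. Let $\widehat G_L$ be the restricted direct product of the $G_{L_p}$ relative to the $\Gamma_{L_p}$,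 $\widehat\Delta_L=\widehat G_L\cap\prod_p\Delta_{L_p}$, $\widehat\Gamma_L=\prod_p\Gamma_{L_p}$ (elements of $\widehat\Delta_L$ act componentwise on $\widehat L$). $R_{L_p}$ and $\widehat R_L$ are the Hecke rings of $(\Gamma_{L_p},\Delta_{L_p})$ and $(\widehat\Gamma_L,\widehat\Delta_L)$; double cosets of $\alpha$ are denoted $T_{L_p}(\alpha)$, $\widehat T_L(\alpha)$. $R_{L_p}$ is regarded as a subring of $\widehat R_L$ via the inclusion $\Delta_{L_p}\subset\widehat\Delta_L$ (components $1$ away from $p$); $R_{L_p}$ and $R_{L_q}$ commute in $\widehat R_L$ for $p\ne q$ (known). **Series.** $T_{L_p}(p^k)=\sum T_{L_p}(\alpha)$ over representatives $\alpha$ of $\Gamma_{L_p}\backslash\{\alpha\in\Delta_{L_p}:[L_p:L_p^\alpha]=p^k\}/\Gamma_{L_p}$, and $P_{L_p}(X)=\sum_{k\ge0}T_{L_p}(p^k)X^k$. $\widehat T_L(n)=\sum\widehat T_L(\widehat\alpha)$ over representatives of $\widehat\Gamma_L\backslash\{\widehat\alpha\in\widehat\Delta_L:[\widehat L:\widehat L^{\widehat\alpha}]=n\}/\widehat\Gamma_L$, and $\widehat D_L(s)=\sum_{n>0}\widehat T_L(n)n^{-s}$, a formal Dirichlet series. Multiplicative means $\widehat T_L(1)=1$ and $\widehat T_L(mn)=\widehat T_L(m)\widehat T_L(n)$ for coprime $m,n$. The infinite product is the formal one: its $n^{-s}$-coefficient is $\prod_pT_{L_p}(p^{v_p(n)})$,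 $v_p$ being the $p$-adic valuation (almost all factors are $1$ and the factors commute). *)

theory Defs
  imports
    Complex_Main
    "HOL-Algebra.QuotRing"
    "HOL-Algebra.Module"
    "HOL-Algebra.FiniteProduct"
    "HOL-Algebra.Generated_Groups"
    "HOL-Algebra.Product_Groups"
    "HOL-Algebra.Free_Abelian_Groups"
    "HOL-Computational_Algebra.Primes"
begin

section \<open>Hecke rings\<close>

definition double_coset :: "('g, 'm) monoid_scheme \<Rightarrow> 'g set \<Rightarrow> 'g \<Rightarrow> 'g set" where
  "double_coset G \<Gamma> a = (\<Gamma> #>\<^bsub>G\<^esub> a) <#>\<^bsub>G\<^esub> \<Gamma>"

definition double_cosets :: "('g, 'm) monoid_scheme \<Rightarrow> 'g set \<Rightarrow> 'g set \<Rightarrow> 'g set set" where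
  "double_cosets G \<Gamma> \<Delta> = double_coset G \<Gamma> ` \<Delta>"

text \<open>The structure constant of two double cosets \<open>X\<close>, \<open>Y\<close> at a double coset \<open>Z\<close>, that is
  the number of cosets \<open>\<Gamma>\<beta>\<close> contained in \<open>Y\<close> with \<open>C \<beta>\<inverse> \<in> X\<close>. It does not depend on the representative \<open>C\<close> of \<open>Z\<close>.\<close>

definition hecke_coeff ::
    "('g, 'm) monoid_scheme \<Rightarrow> 'g set \<Rightarrow> 'g set \<Rightarrow> 'g set \<Rightarrow> 'g set \<Rightarrow> nat" where
  "hecke_coeff G \<Gamma> X Y Z =
     (let C = (SOME c. c \<in> Z)
      in card {\<Gamma> #>\<^bsub>G\<^esub> \<beta> | \<beta>. \<beta> \<in> Y \<and> C \<otimes>\<^bsub>G\<^esub> inv\<^bsub>G\<^esub> \<beta> \<in> X})"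

definition hecke_prod ::
    "('g, 'm) monoid_scheme \<Rightarrow> 'g set \<Rightarrow> 'g set \<Rightarrow> 'g set \<Rightarrow> 'g set \<Rightarrow> ('g set \<Rightarrow>\<^sub>0 int)" where
  "hecke_prod G \<Gamma> \<Delta> X Y =
     (\<Sum>Z \<in> {Z \<in> double_cosets G \<Gamma> \<Delta>. hecke_coeff G \<Gamma> X Y Z \<noteq> 0}.
        frag_cmul (int (hecke_coeff G \<Gamma> X Y Z)) (frag_of Z))"

definition hecke_ring ::
    "('g, 'm) monoid_scheme \<Rightarrow> 'g set \<Rightarrow> 'g set \<Rightarrow> ('g set \<Rightarrow>\<^sub>0 int) ring" where
  "hecke_ring G \<Gamma> \<Delta> =
     \<lparr>carrier = carrier (free_Abelian_group (double_cosets G \<Gamma> \<Delta>)),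
      monoid.mult = (\<lambda>f g. frag_extend (\<lambda>X. frag_extend (\<lambda>Y. hecke_prod G \<Gamma> \<Delta> X Y) g) f),
      one = frag_of (double_coset G \<Gamma> \<one>\<^bsub>G\<^esub>),
      ring.zero = 0,
      ring.add = (+)\<rparr>"


section \<open>The p-adic numbers\<close>

definition padic_abs :: "nat \<Rightarrow> rat \<Rightarrow> real" where
  "padic_abs p x =
     (if x = 0 then 0
      else real p powi (int (multiplicity (int p) (snd (quotient_of x)))
                        - int (multiplicity (int p) (fst (quotient_of x)))))"

definition padic_cauchy :: "nat \<Rightarrow> (nat \<Rightarrow> rat) \<Rightarrow> bool" where
  "padic_cauchy p x \<longleftrightarrow> (\<forall>e>0. \<exists>N. \<forall>m\<ge>N. \<forall>n\<ge>N. padic_abs p (x m - x n) < e)"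

definition padic_cauchy_ring :: "nat \<Rightarrow> (nat \<Rightarrow> rat) ring" where
  "padic_cauchy_ring p =
     \<lparr>carrier = {x. padic_cauchy p x},
      monoid.mult = (\<lambda>x y n. x n * y n),
      one = (\<lambda>n. 1),
      ring.zero = (\<lambda>n. 0),
      ring.add = (\<lambda>x y n. x n + y n)\<rparr>"

type_synonym padic = "(nat \<Rightarrow> rat) set"

text \<open>The field of p-adic numbers is the completion of the rationals: Cauchy sequences
  modulo null sequences.\<close>

definition Qp :: "nat \<Rightarrow> padic ring" where
  "Qp p = padic_cauchy_ring p Quot {x. (\<lambda>n. padic_abs p (x n)) \<longlonglongrightarrow> 0}"

definition Zp :: "nat \<Rightarrow> padic ring" where
  "Zp p = (Qp p)\<lparr>carrier := {X \<in> carrier (Qp p). \<exists>x\<in>X. \<forall>n. padic_abs p (x n) \<le> 1}\<rparr>"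


section \<open>Algebras and their scalar extensions\<close>

text \<open>An algebra is an abelian group with a bi-additive product; the product need not be
  associative or commutative, and no unit is required (the field \<open>one\<close> of the record is
  never used).\<close>

locale biadditive_algebra = abelian_group L for L (structure) +
  assumes mult_closed: "\<lbrakk>x \<in> carrier L; y \<in> carrier L\<rbrakk> \<Longrightarrow> x \<otimes> y \<in> carrier L"
    and mult_l_distr: "\<lbrakk>x \<in> carrier L; y \<in> carrier L; z \<in> carrier L\<rbrakk>
          \<Longrightarrow> (x \<oplus> y) \<otimes> z = x \<otimes> z \<oplus> y \<otimes> z"
    and mult_r_distr: "\<lbrakk>x \<in> carrier L; y \<in> carrier L; z \<in> carrier L\<rbrakk>
          \<Longrightarrow> z \<otimes> (x \<oplus> y) = z \<otimes> x \<oplus> z \<otimes> y"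

definition free_of_finite_rank :: "('a, 'm) ring_scheme \<Rightarrow> bool" where
  "free_of_finite_rank L \<longleftrightarrow> (\<exists>r::nat. add_monoid L \<cong> free_Abelian_group {..<r})"

text \<open>The tensor product over the integers of (the additive groups of) \<open>L\<close> and \<open>A\<close>: the free
  abelian group on pairs modulo the subgroup generated by the bi-additivity relations.\<close>

definition tensor_free ::
    "('a, 'm) ring_scheme \<Rightarrow> ('b, 'n) ring_scheme \<Rightarrow> ('a \<times> 'b \<Rightarrow>\<^sub>0 int) monoid" where
  "tensor_free L A = free_Abelian_group (carrier L \<times> carrier A)"

definition tensor_rel ::
    "('a, 'm) ring_scheme \<Rightarrow> ('b, 'n) ring_scheme \<Rightarrow> ('a \<times> 'b \<Rightarrow>\<^sub>0 int) set" where
  "tensor_rel L A = generate (tensor_free L A)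
     ({frag_of (x \<oplus>\<^bsub>L\<^esub> y, a) - frag_of (x, a) - frag_of (y, a) | x y a.
         x \<in> carrier L \<and> y \<in> carrier L \<and> a \<in> carrier A} \<union>
      {frag_of (x, a \<oplus>\<^bsub>A\<^esub> b) - frag_of (x, a) - frag_of (x, b) | x a b.
         x \<in> carrier L \<and> a \<in> carrier A \<and> b \<in> carrier A})"

definition tensor_class ::
    "('a, 'm) ring_scheme \<Rightarrow> ('b, 'n) ring_scheme \<Rightarrow> ('a \<times> 'b \<Rightarrow>\<^sub>0 int) \<Rightarrow> ('a \<times> 'b \<Rightarrow>\<^sub>0 int) set" where
  "tensor_class L A f = tensor_rel L A #>\<^bsub>tensor_free L A\<^esub> f"

text \<open>The tensor product as an \<open>A\<close>-algebra: the product is the bi-additive extension of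
  \<open>(x \<otimes> a)(y \<otimes> b) = xy \<otimes> ab\<close>, scalars act by \<open>c(x \<otimes> a) = x \<otimes> ca\<close>. Both are computed on
  representatives, in the style of \<^const>\<open>rcoset_mult\<close>.\<close>

definition tensor_algebra ::
    "('a, 'm) ring_scheme \<Rightarrow> ('b, 'n) ring_scheme \<Rightarrow> ('b, ('a \<times> 'b \<Rightarrow>\<^sub>0 int) set) module" where
  "tensor_algebra L A =
     \<lparr>carrier = carrier (tensor_free L A Mod tensor_rel L A),
      monoid.mult = (\<lambda>X Y. \<Union>f\<in>X. \<Union>g\<in>Y. tensor_class L A
                (frag_extend (\<lambda>(x, a). frag_extend (\<lambda>(y, b). frag_of (x \<otimes>\<^bsub>L\<^esub> y, a \<otimes>\<^bsub>A\<^esub> b)) g) f)),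
      one = undefined,
      ring.zero = one (tensor_free L A Mod tensor_rel L A),
      ring.add = monoid.mult (tensor_free L A Mod tensor_rel L A),
      smult = (\<lambda>c X. \<Union>f\<in>X. tensor_class L A
                (frag_extend (\<lambda>(x, a). frag_of (x, c \<otimes>\<^bsub>A\<^esub> a)) f))\<rparr>"

definition alg_End ::
    "('b, 'n) ring_scheme \<Rightarrow> ('b, 'v, 'k) module_scheme \<Rightarrow> ('v \<Rightarrow> 'v) set" where
  "alg_End A M =
     {f \<in> carrier M \<rightarrow>\<^sub>E carrier M.
        (\<forall>x\<in>carrier M. \<forall>y\<in>carrier M. f (x \<oplus>\<^bsub>M\<^esub> y) = f x \<oplus>\<^bsub>M\<^esub> f y) \<and>
        (\<forall>x\<in>carrier M. \<forall>y\<in>carrier M. f (x \<otimes>\<^bsub>M\<^esub> y) = f x \<otimes>\<^bsub>M\<^esub> f y) \<and>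
        (\<forall>c\<in>carrier A. \<forall>x\<in>carrier M. f (c \<odot>\<^bsub>M\<^esub> x) = c \<odot>\<^bsub>M\<^esub> f x)}"

definition alg_Aut ::
    "('b, 'n) ring_scheme \<Rightarrow> ('b, 'v, 'k) module_scheme \<Rightarrow> ('v \<Rightarrow> 'v) set" where
  "alg_Aut A M = {f \<in> alg_End A M. bij_betw f (carrier M) (carrier M)}"

text \<open>Endomorphisms act on the right: the product of \<open>\<alpha>\<close> and \<open>\<beta>\<close> is first \<open>\<alpha>\<close>, then \<open>\<beta>\<close>.\<close>

definition alg_Aut_group ::
    "('b, 'n) ring_scheme \<Rightarrow> ('b, 'v, 'k) module_scheme \<Rightarrow> ('v \<Rightarrow> 'v) monoid" where
  "alg_Aut_group A M =
     \<lparr>carrier = alg_Aut A M,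
      monoid.mult = (\<lambda>\<alpha> \<beta>. compose (carrier M) \<beta> \<alpha>),
      one = (\<lambda>x\<in>carrier M. x)\<rparr>"


section \<open>The local Hecke rings\<close>

type_synonym 'a ptensor = "('a \<times> padic \<Rightarrow>\<^sub>0 int) set"

definition L_Qp :: "('a, 'm) ring_scheme \<Rightarrow> nat \<Rightarrow> (padic, 'a ptensor) module" where
  "L_Qp L p = tensor_algebra L (Qp p)"

text \<open>The tensor product of \<open>L\<close> with the p-adic integers is identified with its image in that
  of \<open>L\<close> with the p-adic numbers, the subgroup generated by the \<open>x \<otimes> a\<close> with \<open>a\<close> a p-adic integer
  (\<open>L\<close> is free, hence flat). The intersection of \<open>End(L\<^sub>p)\<close> with \<open>Aut(L \<otimes> \<rat>\<^sub>p)\<close> is formed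
  under this identification: it consists of the automorphisms whose restriction to \<open>L\<^sub>p\<close> is an
  endomorphism of \<open>L\<^sub>p\<close>.\<close>

definition L_Zp :: "('a, 'm) ring_scheme \<Rightarrow> nat \<Rightarrow> (padic, 'a ptensor) module" where
  "L_Zp L p = (L_Qp L p)\<lparr>carrier := generate (add_monoid (L_Qp L p))
     {tensor_class L (Qp p) (frag_of (x, a)) | x a. x \<in> carrier L \<and> a \<in> carrier (Zp p)}\<rparr>"

definition G_loc :: "('a, 'm) ring_scheme \<Rightarrow> nat \<Rightarrow> ('a ptensor \<Rightarrow> 'a ptensor) monoid" where
  "G_loc L p = alg_Aut_group (Qp p) (L_Qp L p)"

definition Delta_loc :: "('a, 'm) ring_scheme \<Rightarrow> nat \<Rightarrow> ('a ptensor \<Rightarrow> 'a ptensor) set" where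
  "Delta_loc L p =
     {\<alpha> \<in> carrier (G_loc L p). restrict \<alpha> (carrier (L_Zp L p)) \<in> alg_End (Zp p) (L_Zp L p)}"

definition Gamma_loc :: "('a, 'm) ring_scheme \<Rightarrow> nat \<Rightarrow> ('a ptensor \<Rightarrow> 'a ptensor) set" where
  "Gamma_loc L p =
     {\<alpha> \<in> carrier (G_loc L p). restrict \<alpha> (carrier (L_Zp L p)) \<in> alg_Aut (Zp p) (L_Zp L p)}"

definition R_loc ::
    "('a, 'm) ring_scheme \<Rightarrow> nat \<Rightarrow> (('a ptensor \<Rightarrow> 'a ptensor) set \<Rightarrow>\<^sub>0 int) ring" where
  "R_loc L p = hecke_ring (G_loc L p) (Gamma_loc L p) (Delta_loc L p)"

text \<open>As \<^const>\<open>card\<close> is 0 on infinite sets, an infinite index is recorded as 0.\<close>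

definition index_loc ::
    "('a, 'm) ring_scheme \<Rightarrow> nat \<Rightarrow> ('a ptensor \<Rightarrow> 'a ptensor) \<Rightarrow> nat" where
  "index_loc L p \<alpha> = card (a_rcosets\<^bsub>L_Zp L p\<^esub> (\<alpha> ` carrier (L_Zp L p)))"

text \<open>\<open>T_loc L p m\<close> is used only for powers \<open>m\<close> of \<open>p\<close>. The sum over representatives of double
  cosets is a sum over the (finitely many) double cosets themselves.\<close>

definition T_loc ::
    "('a, 'm) ring_scheme \<Rightarrow> nat \<Rightarrow> nat \<Rightarrow> (('a ptensor \<Rightarrow> 'a ptensor) set \<Rightarrow>\<^sub>0 int)" where
  "T_loc L p m =
     (\<Sum>X \<in> double_coset (G_loc L p) (Gamma_loc L p) ` {\<alpha> \<in> Delta_loc L p. index_loc L p \<alpha> = m}.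
        frag_of X)"

text \<open>Formal power series over a ring given as a record are coefficient sequences.\<close>

definition P_loc ::
    "('a, 'm) ring_scheme \<Rightarrow> nat \<Rightarrow> nat \<Rightarrow> (('a ptensor \<Rightarrow> 'a ptensor) set \<Rightarrow>\<^sub>0 int)" where
  "P_loc L p = (\<lambda>k. T_loc L p (p ^ k))"


section \<open>The global Hecke ring\<close>

abbreviation primes :: "nat set" where
  "primes \<equiv> {p. prime p}"

type_synonym 'a adelic = "nat \<Rightarrow> 'a ptensor \<Rightarrow> 'a ptensor"

definition G_hat :: "('a, 'm) ring_scheme \<Rightarrow> 'a adelic monoid" where
  "G_hat L = (product_group primes (G_loc L))
     \<lparr>carrier := {\<alpha> \<in> carrier (product_group primes (G_loc L)).
                    finite {p \<in> primes. \<alpha> p \<notin> Gamma_loc L p}}\<rparr>"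

definition Delta_hat :: "('a, 'm) ring_scheme \<Rightarrow> 'a adelic set" where
  "Delta_hat L = carrier (G_hat L) \<inter> (\<Pi>\<^sub>E p\<in>primes. Delta_loc L p)"

definition Gamma_hat :: "('a, 'm) ring_scheme \<Rightarrow> 'a adelic set" where
  "Gamma_hat L = (\<Pi>\<^sub>E p\<in>primes. Gamma_loc L p)"

definition R_hat :: "('a, 'm) ring_scheme \<Rightarrow> ('a adelic set \<Rightarrow>\<^sub>0 int) ring" where
  "R_hat L = hecke_ring (G_hat L) (Gamma_hat L) (Delta_hat L)"

definition L_hat :: "('a, 'm) ring_scheme \<Rightarrow> (nat \<Rightarrow> 'a ptensor) monoid" where
  "L_hat L = product_group primes (\<lambda>p. add_monoid (L_Zp L p))"

definition index_hat :: "('a, 'm) ring_scheme \<Rightarrow> 'a adelic \<Rightarrow> nat" where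
  "index_hat L \<alpha> =
     card (rcosets\<^bsub>L_hat L\<^esub> ((\<lambda>x. \<lambda>p\<in>primes. \<alpha> p (x p)) ` carrier (L_hat L)))"

definition T_hat :: "('a, 'm) ring_scheme \<Rightarrow> nat \<Rightarrow> ('a adelic set \<Rightarrow>\<^sub>0 int)" where
  "T_hat L n =
     (\<Sum>X \<in> double_coset (G_hat L) (Gamma_hat L) ` {\<alpha> \<in> Delta_hat L. index_hat L \<alpha> = n}.
        frag_of X)"

definition incl_hat ::
    "('a, 'm) ring_scheme \<Rightarrow> nat \<Rightarrow> ('a ptensor \<Rightarrow> 'a ptensor) \<Rightarrow> 'a adelic" where
  "incl_hat L p \<alpha> = (\<lambda>q\<in>primes. if q = p then \<alpha> else \<one>\<^bsub>G_loc L q\<^esub>)"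

text \<open>The embedding of \<^term>\<open>R_loc L p\<close> as a subring of \<^term>\<open>R_hat L\<close>; it sends the double coset of \<open>\<alpha>\<close> to
  that of \<open>incl_hat L p \<alpha>\<close>.\<close>

definition embed_hat ::
    "('a, 'm) ring_scheme \<Rightarrow> nat \<Rightarrow> (('a ptensor \<Rightarrow> 'a ptensor) set \<Rightarrow>\<^sub>0 int)
      \<Rightarrow> ('a adelic set \<Rightarrow>\<^sub>0 int)" where
  "embed_hat L p =
     frag_extend (\<lambda>X. frag_of
       ((Gamma_hat L <#>\<^bsub>G_hat L\<^esub> (incl_hat L p ` X)) <#>\<^bsub>G_hat L\<^esub> Gamma_hat L))"


section \<open>Multiplicative sequences, formal Dirichlet series and Euler products\<close>

definition multiplicative_seq :: "('r, 'm) ring_scheme \<Rightarrow> (nat \<Rightarrow> 'r) \<Rightarrow> bool" where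
  "multiplicative_seq R f \<longleftrightarrow>
     f 1 = \<one>\<^bsub>R\<^esub> \<and> (\<forall>m>0. \<forall>n>0. coprime m n \<longrightarrow> f (m * n) = f m \<otimes>\<^bsub>R\<^esub> f n)"

text \<open>A formal Dirichlet series over \<open>R\<close> is the sequence of its coefficients; the meaningless
  coefficient at 0 is set to zero.\<close>

definition dirichlet_series :: "('r, 'm) ring_scheme \<Rightarrow> (nat \<Rightarrow> 'r) \<Rightarrow> nat \<Rightarrow> 'r" where
  "dirichlet_series R a n = (if n = 0 then \<zero>\<^bsub>R\<^esub> else a n)"

text \<open>The Dirichlet series obtained by substituting the inverse of \<open>p\<^sup>s\<close> for the variable of a
  power series.\<close>

definition subst_prime :: "('r, 'm) ring_scheme \<Rightarrow> nat \<Rightarrow> (nat \<Rightarrow> 'r) \<Rightarrow> nat \<Rightarrow> 'r" where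
  "subst_prime R p P =
     dirichlet_series R (\<lambda>n. if n \<in> range (\<lambda>k. p ^ k) then P (multiplicity p n) else \<zero>\<^bsub>R\<^esub>)"

text \<open>The formal product over all primes \<open>p\<close> of Dirichlet series \<open>F p\<close> supported on the powers
  of \<open>p\<close>. Almost all factors of a coefficient are 1, and they commute; \<^const>\<open>finprod\<close> is defined
  in any monoid and only needs the factors to commute with each other.\<close>

definition prime_product :: "('r, 'm) ring_scheme \<Rightarrow> (nat \<Rightarrow> nat \<Rightarrow> 'r) \<Rightarrow> nat \<Rightarrow> 'r" where
  "prime_product R F =
     dirichlet_series R (\<lambda>n. finprod R (\<lambda>p. F p (p ^ multiplicity p n))
                               {p \<in> primes. F p (p ^ multiplicity p n) \<noteq> \<one>\<^bsub>R\<^esub>})"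

definition D_hat :: "('a, 'm) ring_scheme \<Rightarrow> nat \<Rightarrow> ('a adelic set \<Rightarrow>\<^sub>0 int)" where
  "D_hat L = dirichlet_series (R_hat L) (T_hat L)"

end

theory Submission
  imports
    Defs
    "HOL-Algebra.Sylow"
    "HOL-Algebra.Multiplicative_Group"
begin

text \<open>Everything is decided prime by prime. The group \<open>G_hat L\<close> is a restricted product, and a double
coset of \<open>Gamma_hat L\<close> in it is the product of its local components
(lemma \<open>double_coset_Ghat\<close>). Call two adelic elements disjoint if at every prime one of them lies in
\<open>Gamma_loc L p\<close>. For disjoint \<open>\<alpha>\<close>, \<open>\<beta>\<close> each local factor of the product of their double cosets
is a product with the trivial double coset, so the global product is the single double coset of
\<open>\<alpha>\<beta>\<close> with coefficient 1 (lemma \<open>hecke_prod_coprime\<close>).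

For a family \<open>D\<close> of locally bi-invariant sets, almost all equal to \<open>Gamma_loc L p\<close>, let
\<open>hecke_sum D\<close> be the sum of the double cosets contained in \<open>\<Prod> D p\<close>. By the previous remark
these sums are multiplicative for families that are non-trivial at disjoint sets of primes
(lemma \<open>hecke_sum_mult\<close>), and a family concentrated at one prime is the image of a local sum
(lemma \<open>hecke_sum_single\<close>).

It remains to see that \<open>T_hat L n\<close> is such a sum, and this is where the lattice enters. The index of
\<open>\<alpha>\<close> is the product of its local indices. The local index is a power of \<open>p\<close> if it is finite,
because multiplication by a prime \<open>q \<noteq> p\<close> is surjective on \<open>L\<^sub>p\<close>, hence bijective on any finite
quotient of it; and it is 1 exactly on \<open>Gamma_loc L p\<close>. Hence the index of \<open>\<alpha>\<close> is \<open>n\<close> if and only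
if for every \<open>p\<close> the local index is the exact power of \<open>p\<close> dividing \<open>n\<close>
(lemma \<open>index_hat_eq_iff\<close>), so that \<open>T_hat L n\<close> is \<open>hecke_sum D\<close> for the family of the local
sets with these indices. For coprime \<open>m\<close> and \<open>n\<close> the two families are non-trivial at disjoint sets
of primes. The Euler product is then the multiplicativity of \<open>T_hat L\<close> applied to the prime
factorization of \<open>n\<close>.

To speak of indices, \<open>L \<otimes> \<rat>\<^sub>p\<close> must be an algebra on which automorphisms form a group, and \<open>L\<^sub>p\<close>
a subalgebra of it. This needs the ring structure of \<open>\<rat>\<^sub>p\<close> and the well-definedness of the
operations of the tensor product.\<close>
section \<open>Double cosets\<close>

lemma mem_double_coset_iff:
  "x \<in> double_coset G H a \<longleftrightarrow> (\<exists>h\<in>H. \<exists>k\<in>H. x = h \<otimes>\<^bsub>G\<^esub> a \<otimes>\<^bsub>G\<^esub> k)"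
  by (auto simp: double_coset_def r_coset_def set_mult_def)

context group
begin

lemma double_coset_self:
  assumes "subgroup H G" "a \<in> carrier G"
  shows "a \<in> double_coset G H a"
  using assms subgroup.one_closed[OF assms(1)] unfolding mem_double_coset_iff
  by (intro bexI[of _ \<one>]) auto

lemma double_coset_subset:
  assumes "subgroup H G" "a \<in> carrier G"
  shows "double_coset G H a \<subseteq> carrier G"
  using assms subgroup.mem_carrier[OF assms(1)] by (auto simp: mem_double_coset_iff)

lemma double_coset_eq:
  assumes H: "subgroup H G" and a: "a \<in> carrier G" and b: "b \<in> double_coset G H a"
  shows "double_coset G H b = double_coset G H a"
proof -
  interpret H: subgroup H G by fact
  have sub: "double_coset G H (h \<otimes> c \<otimes> k) \<subseteq> double_coset G H c"
    if "h \<in> H" "k \<in> H" "c \<in> carrier G" for h k c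
  proof
    fix x assume "x \<in> double_coset G H (h \<otimes> c \<otimes> k)"
    then obtain h' k' where *: "h' \<in> H" "k' \<in> H" "x = h' \<otimes> (h \<otimes> c \<otimes> k) \<otimes> k'"
      by (auto simp: mem_double_coset_iff)
    then have "x = (h' \<otimes> h) \<otimes> c \<otimes> (k \<otimes> k')"
      using that by (simp add: m_assoc)
    then show "x \<in> double_coset G H c"
      unfolding mem_double_coset_iff using * that by blast
  qed
  obtain h k where hk: "h \<in> H" "k \<in> H" "b = h \<otimes> a \<otimes> k"
    using b by (auto simp: mem_double_coset_iff)
  have "inv h \<otimes> b \<otimes> inv k = (inv h \<otimes> h) \<otimes> a \<otimes> (k \<otimes> inv k)"
    unfolding hk(3) using hk(1,2) a by (simp only: m_assoc m_closed inv_closed H.mem_carrier)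
  then have "a = inv h \<otimes> b \<otimes> inv k"
    using hk(1,2) a by simp
  then show ?thesis
    using sub[of h k a] sub[of "inv h" "inv k" b] hk a by (metis H.m_inv_closed H.mem_carrier m_closed subset_antisym)
qed

lemma double_coset_of_mem:
  assumes H: "subgroup H G" and a: "a \<in> H"
  shows "double_coset G H a = H"
proof -
  interpret H: subgroup H G by fact
  have "x \<in> double_coset G H a" if "x \<in> H" for x
    unfolding mem_double_coset_iff
    by (rule bexI[of _ "x \<otimes> inv a"], rule bexI[of _ \<one>]) (use that a in \<open>auto simp: m_assoc\<close>)
  moreover have "double_coset G H a \<subseteq> H"
    using a by (auto simp: mem_double_coset_iff)
  ultimately show ?thesis
    by blast
qed

lemma double_coset_mult_left:
  assumes "subgroup H G" "h \<in> H" "a \<in> carrier G"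
  shows "double_coset G H (h \<otimes> a) = double_coset G H a"
proof (rule double_coset_eq[OF assms(1,3)])
  interpret H: subgroup H G by fact
  show "h \<otimes> a \<in> double_coset G H a"
    unfolding mem_double_coset_iff using assms by (intro bexI[of _ h] bexI[of _ \<one>]) auto
qed

lemma double_coset_mult_right:
  assumes "subgroup H G" "h \<in> H" "a \<in> carrier G"
  shows "double_coset G H (a \<otimes> h) = double_coset G H a"
proof (rule double_coset_eq[OF assms(1,3)])
  interpret H: subgroup H G by fact
  show "a \<otimes> h \<in> double_coset G H a"
    unfolding mem_double_coset_iff using assms by (intro bexI[of _ \<one>] bexI[of _ h]) auto
qed

text \<open>If one of \<open>a\<close>, \<open>b\<close> lies in \<open>H\<close>, then its double coset is \<open>H\<close>, and the other double coset absorbs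
it.\<close>

lemma mult_mem_double_coset_trivial_factor:
  assumes H: "subgroup H G" and c: "a \<in> carrier G" "b \<in> carrier G" and ab: "a \<in> H \<or> b \<in> H"
  and xy: "x \<in> double_coset G H a" "y \<in> double_coset G H b"
  shows "x \<otimes> y \<in> double_coset G H (a \<otimes> b)"
proof -
  interpret H: subgroup H G by fact
  note carr = subsetD[OF double_coset_subset[OF H c(1)] xy(1)]
    subsetD[OF double_coset_subset[OF H c(2)] xy(2)]
  note self = double_coset_self[OF H] 
  show ?thesis using ab
  proof
    assume a: "a \<in> H"
    then have "x \<in> H" using xy double_coset_of_mem[OF H] by auto
    then have "double_coset G H (x \<otimes> y) = double_coset G H (a \<otimes> b)"
      using a carr c double_coset_eq[OF H c(2) xy(2)] by (simp add: double_coset_mult_left[OF H])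
    then show ?thesis using self[of "x \<otimes> y"] carr by auto
  next
    assume b: "b \<in> H"
    then have "y \<in> H" using xy double_coset_of_mem[OF H] by auto
    then have "double_coset G H (x \<otimes> y) = double_coset G H (a \<otimes> b)"
      using b carr c double_coset_eq[OF H c(1) xy(1)] by (simp add: double_coset_mult_right[OF H])
    then show ?thesis using self[of "x \<otimes> y"] carr by auto
  qed
qed

lemma double_coset_mult_subset:
  assumes H: "subgroup H G" and c: "a \<in> carrier G" "b \<in> carrier G"
  shows "double_coset G H (a \<otimes> b) \<subseteq> double_coset G H a <#> double_coset G H b"
proof
  interpret H: subgroup H G by fact
  fix x assume "x \<in> double_coset G H (a \<otimes> b)"
  then obtain h k where hk: "h \<in> H" "k \<in> H" "x = h \<otimes> (a \<otimes> b) \<otimes> k"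
    by (auto simp: mem_double_coset_iff)
  then have x: "x = (h \<otimes> a) \<otimes> (b \<otimes> k)" using c by (simp add: m_assoc)
  have "h \<otimes> a \<in> double_coset G H a" "b \<otimes> k \<in> double_coset G H b"
    using double_coset_self[OF H, of "h \<otimes> a"] double_coset_self[OF H, of "b \<otimes> k"] c hk
    by (simp_all add: double_coset_mult_left[OF H] double_coset_mult_right[OF H])
  then show "x \<in> double_coset G H a <#> double_coset G H b"
    unfolding x set_mult_def by blast
qed

text \<open>This determines the cosets \<open>H\<beta>\<close> that \<^const>\<open>hecke_coeff\<close> counts at \<open>c\<close>, for the double cosets of
\<open>a\<close> and \<open>b\<close>, when one of these is \<open>H\<close>. If \<open>b \<in> H\<close>, then \<open>\<beta>\<close> must lie in \<open>H\<close>; otherwise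
\<open>a \<in> H\<close> and the condition \<open>c\<beta>\<inverse> \<in> H\<close> forces \<open>H\<beta> = Hc\<close>. So there is exactly one coset if \<open>c\<close> is
in the double coset of \<open>ab\<close>, and none otherwise. Stating it for elements \<open>\<beta>\<close> makes it possible to
quantify over the components of a product.\<close>

lemma hecke_condition_trivial_factor:
  assumes H: "subgroup H G" and c: "a \<in> carrier G" "b \<in> carrier G" "c \<in> carrier G" "\<beta> \<in> carrier G"
    and ab: "a \<in> H \<or> b \<in> H"
  shows "\<beta> \<in> double_coset G H b \<and> c \<otimes> inv \<beta> \<in> double_coset G H a \<longleftrightarrow>
    c \<in> double_coset G H (a \<otimes> b) \<and> \<beta> \<in> H #> (if b \<in> H then \<one> else c)"
    (is "?L \<longleftrightarrow> ?R")
proof -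
  interpret H: subgroup H G by fact
  note eq = double_coset_eq[OF H] and self = double_coset_self[OF H]
  show ?thesis
  proof (cases "b \<in> H")
    case True
    have "double_coset G H (c \<otimes> inv \<beta>) = double_coset G H c" if "\<beta> \<in> H"
      using that c by (simp add: double_coset_mult_right[OF H])
    then have "c \<otimes> inv \<beta> \<in> double_coset G H a \<longleftrightarrow> c \<in> double_coset G H a" if "\<beta> \<in> H"
      using that c eq self by (metis inv_closed m_closed)
    then show ?thesis
      using True c by (auto simp: double_coset_of_mem[OF H] double_coset_mult_right[OF H] coset_mult_one[OF H.subset])
  next
    case False
    then have a: "a \<in> H" using ab by simp
    have 1: "c \<otimes> inv \<beta> \<in> H \<longleftrightarrow> \<beta> \<in> H #> c"
      using c H.rcos_module[of \<beta> c] H.rcos_module[of c \<beta>] repr_independence[OF _ _ H] 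
      by (metis is_group rcos_self H)
    have 2: "\<beta> \<in> double_coset G H b \<longleftrightarrow> c \<in> double_coset G H b" if \<beta>: "\<beta> \<in> H #> c"
    proof -
      obtain h where "h \<in> H" "\<beta> = h \<otimes> c" using \<beta> unfolding r_coset_def by blast
      then have "double_coset G H \<beta> = double_coset G H c"
        using c by (simp add: double_coset_mult_left[OF H])
      then show ?thesis using c eq self by metis
    qed
    show ?thesis
      using False a c 1 2 by (auto simp: double_coset_of_mem[OF H] double_coset_mult_left[OF H])
  qed
qed

end

section \<open>Hecke rings of restricted products\<close>

text \<open>With the groups \<^term>\<open>G_loc L p\<close> and the subgroups \<^term>\<open>Gamma_loc L p\<close> this is \<^term>\<open>G_hat L\<close>.\<close>

definition restricted_product ::
  "'i set \<Rightarrow> ('i \<Rightarrow> ('g, 'm) monoid_scheme) \<Rightarrow> ('i \<Rightarrow> 'g set) \<Rightarrow> ('i \<Rightarrow> 'g) monoid" where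
  "restricted_product I G \<Gamma> = (product_group I G)
     \<lparr>carrier := {\<alpha> \<in> carrier (product_group I G). finite {i \<in> I. \<alpha> i \<notin> \<Gamma> i}}\<rparr>"

locale hecke_family =
  fixes I :: "'i set" and G :: "'i \<Rightarrow> ('g, 'm) monoid_scheme" and \<Gamma> \<Delta> :: "'i \<Rightarrow> 'g set"
  assumes group_G: "i \<in> I \<Longrightarrow> group (G i)"
    and subgroup_\<Gamma>: "i \<in> I \<Longrightarrow> subgroup (\<Gamma> i) (G i)"
    and \<Delta>_carrier: "i \<in> I \<Longrightarrow> \<Delta> i \<subseteq> carrier (G i)"
begin

lemma G_closed [simp]:
  assumes "i \<in> I" "x \<in> carrier (G i)" "y \<in> carrier (G i)"
  shows "x \<otimes>\<^bsub>G i\<^esub> y \<in> carrier (G i)" "inv\<^bsub>G i\<^esub> x \<in> carrier (G i)"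
  using group_G[OF assms(1)] assms by (auto intro: monoid.m_closed group.inv_closed dest: group.is_monoid)

lemma G_one_closed [simp]: "i \<in> I \<Longrightarrow> \<one>\<^bsub>G i\<^esub> \<in> carrier (G i)"
  using group_G group.is_monoid monoid.one_closed by blast

abbreviation "Ghat \<equiv> restricted_product I G \<Gamma>"
abbreviation "\<Gamma>hat \<equiv> PiE I \<Gamma>"
abbreviation "\<Delta>hat \<equiv> carrier Ghat \<inter> PiE I \<Delta>"

lemma \<Gamma>_carrier: "i \<in> I \<Longrightarrow> \<Gamma> i \<subseteq> carrier (G i)"
  using subgroup.subset[OF subgroup_\<Gamma>] .

lemma mem_carrier_iff:
  "\<alpha> \<in> carrier Ghat \<longleftrightarrow> \<alpha> \<in> (\<Pi>\<^sub>E i\<in>I. carrier (G i)) \<and> finite {i \<in> I. \<alpha> i \<notin> \<Gamma> i}"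
  by (simp add: restricted_product_def)

lemma mult_Ghat: "\<alpha> \<otimes>\<^bsub>Ghat\<^esub> \<beta> = (\<lambda>i\<in>I. \<alpha> i \<otimes>\<^bsub>G i\<^esub> \<beta> i)"
  by (simp add: restricted_product_def)

lemma subgroup_carrier_Ghat: "subgroup (carrier Ghat) (product_group I G)"
proof (rule group.subgroupI)
  show "group (product_group I G)" using group_G by simp
  show "carrier Ghat \<subseteq> carrier (product_group I G)" by (auto simp: restricted_product_def)
  have "\<one>\<^bsub>product_group I G\<^esub> \<in> carrier Ghat"
    using subgroup.one_closed[OF subgroup_\<Gamma>] by (simp add: mem_carrier_iff cong: conj_cong)
  then show "carrier Ghat \<noteq> {}" by blast
next
  fix \<alpha> assume \<alpha>: "\<alpha> \<in> carrier Ghat"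
  have "{i \<in> I. inv\<^bsub>G i\<^esub> (\<alpha> i) \<notin> \<Gamma> i} \<subseteq> {i \<in> I. \<alpha> i \<notin> \<Gamma> i}"
    using subgroup.m_inv_closed[OF subgroup_\<Gamma>] by auto
  then show "inv\<^bsub>product_group I G\<^esub> \<alpha> \<in> carrier Ghat"
    using \<alpha> group_G by (auto simp: mem_carrier_iff PiE_iff cong: conj_cong intro: finite_subset)
next
  fix \<alpha> \<beta> assume \<alpha>: "\<alpha> \<in> carrier Ghat" and \<beta>: "\<beta> \<in> carrier Ghat"
  have "{i \<in> I. \<alpha> i \<otimes>\<^bsub>G i\<^esub> \<beta> i \<notin> \<Gamma> i} \<subseteq> {i \<in> I. \<alpha> i \<notin> \<Gamma> i} \<union> {i \<in> I. \<beta> i \<notin> \<Gamma> i}"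
    using subgroup.m_closed[OF subgroup_\<Gamma>] by auto
  then have "finite {i \<in> I. \<alpha> i \<otimes>\<^bsub>G i\<^esub> \<beta> i \<notin> \<Gamma> i}"
    using \<alpha> \<beta> by (auto simp: mem_carrier_iff intro: finite_subset)
  then show "\<alpha> \<otimes>\<^bsub>product_group I G\<^esub> \<beta> \<in> carrier Ghat"
    using \<alpha> \<beta> by (auto simp: mem_carrier_iff PiE_iff cong: conj_cong)
qed

lemma Ghat_eq: "Ghat = (product_group I G)\<lparr>carrier := carrier Ghat\<rparr>"
  by (simp add: restricted_product_def)

lemma group_Ghat: "group Ghat"
  using group.subgroup_imp_group[OF _ subgroup_carrier_Ghat] group_G Ghat_eq by simp

lemma inv_Ghat:
  assumes "\<alpha> \<in> carrier Ghat"
  shows "inv\<^bsub>Ghat\<^esub> \<alpha> = (\<lambda>i\<in>I. inv\<^bsub>G i\<^esub> (\<alpha> i))"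
proof -
  have "inv\<^bsub>Ghat\<^esub> \<alpha> = inv\<^bsub>product_group I G\<^esub> \<alpha>"
    using group.m_inv_consistent[OF _ subgroup_carrier_Ghat assms] group_G Ghat_eq by simp
  then show ?thesis
    using assms group_G by (simp add: mem_carrier_iff)
qed

lemma PiE_carrier_Ghat:
  assumes "\<And>i. i \<in> I \<Longrightarrow> D i \<subseteq> carrier (G i)" "finite {i \<in> I. D i \<noteq> \<Gamma> i}"
  shows "PiE I D \<subseteq> carrier Ghat"
proof
  fix \<alpha> assume \<alpha>: "\<alpha> \<in> PiE I D"
  then have "{i \<in> I. \<alpha> i \<notin> \<Gamma> i} \<subseteq> {i \<in> I. D i \<noteq> \<Gamma> i}" by (auto simp: PiE_iff)
  then show "\<alpha> \<in> carrier Ghat"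
    using \<alpha> assms finite_subset[of "{i \<in> I. \<alpha> i \<notin> \<Gamma> i}"] by (auto simp: mem_carrier_iff PiE_iff dest: assms(1)[THEN subsetD])
qed

lemma \<Gamma>hat_carrier: "\<Gamma>hat \<subseteq> carrier Ghat"
  by (rule PiE_carrier_Ghat) (use \<Gamma>_carrier in auto)

lemma subgroup_\<Gamma>hat: "subgroup \<Gamma>hat Ghat"
proof -
  interpret P: group "product_group I G" using group_G by simp
  have "subgroup \<Gamma>hat (product_group I G)"
    using PiE_subgroup_product_group[of I G \<Gamma>] group_G subgroup_\<Gamma> by simp
  then show ?thesis
    using P.subgroup_incl[OF _ subgroup_carrier_Ghat \<Gamma>hat_carrier] Ghat_eq by simp
qed

lemma double_coset_Ghat:
  assumes "\<alpha> \<in> carrier Ghat"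
  shows "double_coset Ghat \<Gamma>hat \<alpha> = (\<Pi>\<^sub>E i\<in>I. double_coset (G i) (\<Gamma> i) (\<alpha> i))" (is "?L = ?R")
proof
  show "?L \<subseteq> ?R" by (fastforce simp: mem_double_coset_iff mult_Ghat)
next
  show "?R \<subseteq> ?L"
  proof
    fix x assume x: "x \<in> ?R"
    then have "\<forall>i\<in>I. \<exists>h k. h \<in> \<Gamma> i \<and> k \<in> \<Gamma> i \<and> x i = h \<otimes>\<^bsub>G i\<^esub> \<alpha> i \<otimes>\<^bsub>G i\<^esub> k"
      by (auto simp: mem_double_coset_iff PiE_iff) blast
    then obtain h k where hk: "\<And>i. i \<in> I \<Longrightarrow> h i \<in> \<Gamma> i \<and> k i \<in> \<Gamma> i \<and> x i = h i \<otimes>\<^bsub>G i\<^esub> \<alpha> i \<otimes>\<^bsub>G i\<^esub> k i"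
      by metis
    have "x = restrict h I \<otimes>\<^bsub>Ghat\<^esub> \<alpha> \<otimes>\<^bsub>Ghat\<^esub> restrict k I"
      using x hk by (auto simp: mult_Ghat PiE_iff extensional_def)
    then show "x \<in> ?L"
      unfolding mem_double_coset_iff using hk
      by (intro bexI[of _ "restrict h I"] bexI[of _ "restrict k I"]) auto
  qed
qed

lemma double_coset_Ghat_eq_iff:
  assumes "\<alpha> \<in> carrier Ghat" "\<beta> \<in> carrier Ghat"
  shows "double_coset Ghat \<Gamma>hat \<alpha> = double_coset Ghat \<Gamma>hat \<beta> \<longleftrightarrow>
    (\<forall>i\<in>I. double_coset (G i) (\<Gamma> i) (\<alpha> i) = double_coset (G i) (\<Gamma> i) (\<beta> i))"
proof -
  have "double_coset (G i) (\<Gamma> i) (\<alpha> i) \<noteq> {}" if "\<alpha> \<in> carrier Ghat" "i \<in> I" for i \<alpha>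
    using that group.double_coset_self[OF group_G subgroup_\<Gamma>] by (fastforce simp: mem_carrier_iff)
  then show ?thesis
    using assms by (simp add: double_coset_Ghat PiE_eq_iff)
qed

lemma mem_r_coset_Ghat_iff:
  assumes "\<alpha> \<in> carrier Ghat" "\<beta> \<in> carrier Ghat"
  shows "\<beta> \<in> \<Gamma>hat #>\<^bsub>Ghat\<^esub> \<alpha> \<longleftrightarrow> (\<forall>i\<in>I. \<beta> i \<in> \<Gamma> i #>\<^bsub>G i\<^esub> \<alpha> i)"
proof
  show "\<forall>i\<in>I. \<beta> i \<in> \<Gamma> i #>\<^bsub>G i\<^esub> \<alpha> i" if "\<beta> \<in> \<Gamma>hat #>\<^bsub>Ghat\<^esub> \<alpha>"
    using that by (auto simp: r_coset_def mult_Ghat)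
next
  assume "\<forall>i\<in>I. \<beta> i \<in> \<Gamma> i #>\<^bsub>G i\<^esub> \<alpha> i"
  then obtain h where h: "\<And>i. i \<in> I \<Longrightarrow> h i \<in> \<Gamma> i \<and> \<beta> i = h i \<otimes>\<^bsub>G i\<^esub> \<alpha> i"
    unfolding r_coset_def by simp metis
  then have "\<beta> = restrict h I \<otimes>\<^bsub>Ghat\<^esub> \<alpha>"
    using assms by (auto simp: mult_Ghat mem_carrier_iff PiE_iff extensional_def)
  then show "\<beta> \<in> \<Gamma>hat #>\<^bsub>Ghat\<^esub> \<alpha>"
    using h by (auto simp: r_coset_def intro!: bexI[of _ "restrict h I"])
qed

text \<open>At each index the local coset counted by the structure constant is unique
(lemma \<open>hecke_condition_trivial_factor\<close>), so globally there is at most one coset. Its existence at the double coset of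
\<open>\<alpha>\<beta>\<close> needs a representative in the restricted product: almost all components of \<open>c\<close> lie in \<open>\<Gamma>\<close>,
hence so do those of the representative \<open>b\<close>.\<close>

lemma hecke_prod_coprime:
  assumes \<alpha>: "\<alpha> \<in> \<Delta>hat" and \<beta>: "\<beta> \<in> \<Delta>hat" and \<alpha>\<beta>: "\<alpha> \<otimes>\<^bsub>Ghat\<^esub> \<beta> \<in> \<Delta>hat"
    and triv: "\<And>i. i \<in> I \<Longrightarrow> \<alpha> i \<in> \<Gamma> i \<or> \<beta> i \<in> \<Gamma> i"
  shows "hecke_prod Ghat \<Gamma>hat \<Delta>hat (double_coset Ghat \<Gamma>hat \<alpha>) (double_coset Ghat \<Gamma>hat \<beta>) =
    frag_of (double_coset Ghat \<Gamma>hat (\<alpha> \<otimes>\<^bsub>Ghat\<^esub> \<beta>))"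
proof -
  interpret Ghat: group Ghat by (rule group_Ghat)
  let ?dc = "double_coset Ghat \<Gamma>hat" and ?d = "\<lambda>i. double_coset (G i) (\<Gamma> i)"
  have carr: "\<alpha> \<in> carrier Ghat" "\<beta> \<in> carrier Ghat" using \<alpha> \<beta> by auto
  have comp: "x i \<in> carrier (G i)" if "x \<in> carrier Ghat" "i \<in> I" for x i
    using that by (auto simp: mem_carrier_iff)
  have coeff: "hecke_coeff Ghat \<Gamma>hat (?dc \<alpha>) (?dc \<beta>) Z = (if Z = ?dc (\<alpha> \<otimes>\<^bsub>Ghat\<^esub> \<beta>) then 1 else 0)"
    if Z: "Z \<in> double_cosets Ghat \<Gamma>hat \<Delta>hat" for Z
  proof -
    define c where "c = (SOME c. c \<in> Z)"
    obtain \<zeta> where \<zeta>: "\<zeta> \<in> carrier Ghat" "Z = ?dc \<zeta>" using Z by (auto simp: double_cosets_def)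
    then have "\<zeta> \<in> Z" using Ghat.double_coset_self[OF subgroup_\<Gamma>hat] by simp
    then have "c \<in> Z" unfolding c_def by (rule someI[where P = "\<lambda>c. c \<in> Z"])
    then have c: "c \<in> carrier Ghat" "Z = ?dc c"
      using \<zeta>(2) Ghat.double_coset_subset[OF subgroup_\<Gamma>hat \<zeta>(1)] Ghat.double_coset_eq[OF subgroup_\<Gamma>hat \<zeta>(1)] by auto
    have Z_iff: "Z = ?dc (\<alpha> \<otimes>\<^bsub>Ghat\<^esub> \<beta>) \<longleftrightarrow> c \<in> ?dc (\<alpha> \<otimes>\<^bsub>Ghat\<^esub> \<beta>)"
      using c(2) Ghat.double_coset_eq[OF subgroup_\<Gamma>hat Ghat.m_closed[OF carr], of c]
        Ghat.double_coset_self[OF subgroup_\<Gamma>hat c(1)] by auto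
    \<comment> \<open>the representative of the only coset that can be counted, taken from the local ones\<close>
    define b where "b = (\<lambda>i\<in>I. if \<beta> i \<in> \<Gamma> i then \<one>\<^bsub>G i\<^esub> else c i)"
    have b: "b \<in> carrier Ghat"
    proof -
      have "{i \<in> I. b i \<notin> \<Gamma> i} \<subseteq> {i \<in> I. c i \<notin> \<Gamma> i}"
        using subgroup.one_closed[OF subgroup_\<Gamma>] by (auto simp: b_def)
      then show ?thesis
        using c(1) finite_subset[of "{i \<in> I. b i \<notin> \<Gamma> i}"] unfolding mem_carrier_iff
        by (auto simp: b_def PiE_iff)
    qed
    have key: "x \<in> ?dc \<beta> \<and> c \<otimes>\<^bsub>Ghat\<^esub> inv\<^bsub>Ghat\<^esub> x \<in> ?dc \<alpha> \<longleftrightarrow> c \<in> ?dc (\<alpha> \<otimes>\<^bsub>Ghat\<^esub> \<beta>) \<and> x \<in> \<Gamma>hat #>\<^bsub>Ghat\<^esub> b"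
      if x: "x \<in> carrier Ghat" for x
    proof -
      have "x \<in> ?dc \<beta> \<and> c \<otimes>\<^bsub>Ghat\<^esub> inv\<^bsub>Ghat\<^esub> x \<in> ?dc \<alpha> \<longleftrightarrow>
        (\<forall>i\<in>I. x i \<in> ?d i (\<beta> i) \<and> c i \<otimes>\<^bsub>G i\<^esub> inv\<^bsub>G i\<^esub> (x i) \<in> ?d i (\<alpha> i))"
        using x carr c(1) by (auto simp: double_coset_Ghat mult_Ghat inv_Ghat mem_carrier_iff PiE_iff)
      also have "\<dots> \<longleftrightarrow> (\<forall>i\<in>I. c i \<in> ?d i (\<alpha> i \<otimes>\<^bsub>G i\<^esub> \<beta> i) \<and> x i \<in> \<Gamma> i #>\<^bsub>G i\<^esub> b i)"
        using group.hecke_condition_trivial_factor[OF group_G subgroup_\<Gamma> comp[OF carr(1)] comp[OF carr(2)] comp[OF c(1)] comp[OF x] triv]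
        by (intro ball_cong refl) (simp add: b_def)
      also have "\<dots> \<longleftrightarrow> c \<in> ?dc (\<alpha> \<otimes>\<^bsub>Ghat\<^esub> \<beta>) \<and> x \<in> \<Gamma>hat #>\<^bsub>Ghat\<^esub> b"
        using x b carr c(1) by (auto simp: double_coset_Ghat mem_r_coset_Ghat_iff mem_carrier_iff[of c] PiE_iff) (auto simp: mult_Ghat)
      finally show ?thesis .
    qed
    have "{\<Gamma>hat #>\<^bsub>Ghat\<^esub> x | x. x \<in> ?dc \<beta> \<and> c \<otimes>\<^bsub>Ghat\<^esub> inv\<^bsub>Ghat\<^esub> x \<in> ?dc \<alpha>} =
        {\<Gamma>hat #>\<^bsub>Ghat\<^esub> x | x. x \<in> carrier Ghat \<and> x \<in> ?dc \<beta> \<and> c \<otimes>\<^bsub>Ghat\<^esub> inv\<^bsub>Ghat\<^esub> x \<in> ?dc \<alpha>}"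
      using Ghat.double_coset_subset[OF subgroup_\<Gamma>hat carr(2)] by blast
    also have "\<dots> = {\<Gamma>hat #>\<^bsub>Ghat\<^esub> x | x. x \<in> carrier Ghat \<and> c \<in> ?dc (\<alpha> \<otimes>\<^bsub>Ghat\<^esub> \<beta>) \<and> x \<in> \<Gamma>hat #>\<^bsub>Ghat\<^esub> b}"
      using key by blast
    also have "\<dots> = (if c \<in> ?dc (\<alpha> \<otimes>\<^bsub>Ghat\<^esub> \<beta>) then {\<Gamma>hat #>\<^bsub>Ghat\<^esub> b} else {})"
      using b Ghat.repr_independence[OF _ _ subgroup_\<Gamma>hat] Ghat.rcos_self[OF _ subgroup_\<Gamma>hat] by auto
    finally show ?thesis
      unfolding hecke_coeff_def Let_def c_def[symmetric] by (simp add: Z_iff)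
  qed
  have "?dc (\<alpha> \<otimes>\<^bsub>Ghat\<^esub> \<beta>) \<in> double_cosets Ghat \<Gamma>hat \<Delta>hat" using \<alpha>\<beta> by (auto simp: double_cosets_def)
  then have "{Z \<in> double_cosets Ghat \<Gamma>hat \<Delta>hat. hecke_coeff Ghat \<Gamma>hat (?dc \<alpha>) (?dc \<beta>) Z \<noteq> 0} = {?dc (\<alpha> \<otimes>\<^bsub>Ghat\<^esub> \<beta>)}"
    using coeff by (auto split: if_splits)
  then show ?thesis
    using coeff \<open>?dc (\<alpha> \<otimes>\<^bsub>Ghat\<^esub> \<beta>) \<in> _\<close> by (simp add: hecke_prod_def)
qed


text \<open>The product of such a family consists of elements of the restricted product and is a union of double
cosets.\<close>

definition biinvariant :: "('i \<Rightarrow> 'g set) \<Rightarrow> bool" where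
  "biinvariant D \<longleftrightarrow> finite {i \<in> I. D i \<noteq> \<Gamma> i} \<and>
     (\<forall>i\<in>I. D i \<subseteq> \<Delta> i \<and> (\<forall>a\<in>D i. double_coset (G i) (\<Gamma> i) a \<subseteq> D i))"

abbreviation "SS D \<equiv> double_coset Ghat \<Gamma>hat ` PiE I D"

definition hecke_sum :: "('i \<Rightarrow> 'g set) \<Rightarrow> (('i \<Rightarrow> 'g) set \<Rightarrow>\<^sub>0 int)" where
  "hecke_sum D = (\<Sum>X \<in> SS D. frag_of X)"

lemma biinvariantD:
  assumes "biinvariant D"
  shows "finite {i \<in> I. D i \<noteq> \<Gamma> i}" "i \<in> I \<Longrightarrow> D i \<subseteq> \<Delta> i" "i \<in> I \<Longrightarrow> D i \<subseteq> carrier (G i)"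
    "i \<in> I \<Longrightarrow> a \<in> D i \<Longrightarrow> double_coset (G i) (\<Gamma> i) a \<subseteq> D i"
  using assms \<Delta>_carrier[of i] unfolding biinvariant_def by auto

lemma biinvariant_PiE:
  assumes "biinvariant D"
  shows "PiE I D \<subseteq> carrier Ghat" "PiE I D \<subseteq> \<Delta>hat"
proof -
  show "PiE I D \<subseteq> carrier Ghat" by (rule PiE_carrier_Ghat) (use biinvariantD[OF assms] in auto)
  then show "PiE I D \<subseteq> \<Delta>hat" using biinvariantD(2)[OF assms] by fastforce
qed

lemma hecke_sum_carrier:
  assumes "biinvariant D"
  shows "hecke_sum D \<in> carrier (hecke_ring Ghat \<Gamma>hat \<Delta>hat)"
proof -
  have "SS D \<subseteq> double_cosets Ghat \<Gamma>hat \<Delta>hat"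
    unfolding double_cosets_def by (rule image_mono[OF biinvariant_PiE(2)[OF assms]])
  then have "hecke_sum D \<in> carrier (free_Abelian_group (double_cosets Ghat \<Gamma>hat \<Delta>hat))"
    unfolding hecke_sum_def by (intro sum_closed_free_Abelian_group) auto
  then show ?thesis by (simp add: hecke_ring_def)
qed

lemma hecke_sum_one: "hecke_sum \<Gamma> = \<one>\<^bsub>hecke_ring Ghat \<Gamma>hat \<Delta>hat\<^esub>"
proof -
  interpret Ghat: group Ghat by (rule group_Ghat)
  have "double_coset Ghat \<Gamma>hat \<alpha> = \<Gamma>hat" if "\<alpha> \<in> \<Gamma>hat" for \<alpha>
    using Ghat.double_coset_of_mem[OF subgroup_\<Gamma>hat that] .
  moreover have "\<one>\<^bsub>Ghat\<^esub> \<in> \<Gamma>hat" by (rule subgroup.one_closed[OF subgroup_\<Gamma>hat])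
  ultimately have "SS \<Gamma> = {\<Gamma>hat}" "double_coset Ghat \<Gamma>hat \<one>\<^bsub>Ghat\<^esub> = \<Gamma>hat"
    by (simp_all add: image_constant[of "\<one>\<^bsub>Ghat\<^esub>"] cong: image_cong_simp)
  then show ?thesis by (simp add: hecke_sum_def hecke_ring_def)
qed

lemma set_mult_double_coset:
  assumes \<alpha>: "\<alpha> \<in> carrier Ghat" and \<beta>: "\<beta> \<in> carrier Ghat"
    and triv: "\<And>i. i \<in> I \<Longrightarrow> \<alpha> i \<in> \<Gamma> i \<or> \<beta> i \<in> \<Gamma> i"
  shows "double_coset Ghat \<Gamma>hat \<alpha> <#>\<^bsub>Ghat\<^esub> double_coset Ghat \<Gamma>hat \<beta> = double_coset Ghat \<Gamma>hat (\<alpha> \<otimes>\<^bsub>Ghat\<^esub> \<beta>)"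
proof
  interpret Ghat: group Ghat by (rule group_Ghat)
  show "double_coset Ghat \<Gamma>hat (\<alpha> \<otimes>\<^bsub>Ghat\<^esub> \<beta>) \<subseteq> double_coset Ghat \<Gamma>hat \<alpha> <#>\<^bsub>Ghat\<^esub> double_coset Ghat \<Gamma>hat \<beta>"
    by (rule Ghat.double_coset_mult_subset[OF subgroup_\<Gamma>hat \<alpha> \<beta>])
  have comp: "x i \<in> carrier (G i)" if "x \<in> carrier Ghat" "i \<in> I" for x i
    using that by (auto simp: mem_carrier_iff)
  have "x \<otimes>\<^bsub>Ghat\<^esub> y \<in> double_coset Ghat \<Gamma>hat (\<alpha> \<otimes>\<^bsub>Ghat\<^esub> \<beta>)"
    if x: "x \<in> double_coset Ghat \<Gamma>hat \<alpha>" and y: "y \<in> double_coset Ghat \<Gamma>hat \<beta>" for x y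
  proof -
    have "x i \<otimes>\<^bsub>G i\<^esub> y i \<in> double_coset (G i) (\<Gamma> i) (\<alpha> i \<otimes>\<^bsub>G i\<^esub> \<beta> i)" if "i \<in> I" for i
      using x y that \<alpha> \<beta>
      by (intro group.mult_mem_double_coset_trivial_factor[OF group_G subgroup_\<Gamma> comp comp triv])
        (auto simp: double_coset_Ghat)
    then show ?thesis
      unfolding double_coset_Ghat[OF Ghat.m_closed[OF \<alpha> \<beta>]] by (simp add: mult_Ghat)
  qed
  then show "double_coset Ghat \<Gamma>hat \<alpha> <#>\<^bsub>Ghat\<^esub> double_coset Ghat \<Gamma>hat \<beta> \<subseteq> double_coset Ghat \<Gamma>hat (\<alpha> \<otimes>\<^bsub>Ghat\<^esub> \<beta>)"
    by (auto simp: set_mult_def)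
qed

text \<open>In the following, \<open>D\<close> and \<open>E\<close> are non-trivial at disjoint sets of indices and \<open>F\<close> combines them.
The aim is that each double coset in the product of \<open>F\<close> is uniquely a product of a double coset of
\<open>D\<close> and one of \<open>E\<close>.\<close>

context
  fixes D E F :: "'i \<Rightarrow> 'g set"
  assumes D: "biinvariant D" and E: "biinvariant E"
    and disjoint: "\<And>i. i \<in> I \<Longrightarrow> D i = \<Gamma> i \<or> E i = \<Gamma> i"
    and F: "\<And>i. i \<in> I \<Longrightarrow> F i = (if D i = \<Gamma> i then E i else D i)"
begin

lemma mult_coprime_mem:
  assumes "\<alpha> \<in> PiE I D" "\<beta> \<in> PiE I E"
  shows "\<alpha> \<otimes>\<^bsub>Ghat\<^esub> \<beta> \<in> PiE I F"
proof -
  have "\<alpha> i \<otimes>\<^bsub>G i\<^esub> \<beta> i \<in> F i" if i: "i \<in> I" for i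
  proof -
    interpret Gi: group "G i" using group_G i .
    note H = subgroup_\<Gamma>[OF i]
    have c: "\<alpha> i \<in> D i" "\<beta> i \<in> E i" using assms i by auto
    then have c: "\<alpha> i \<in> D i" "\<beta> i \<in> E i" "\<alpha> i \<in> carrier (G i)" "\<beta> i \<in> carrier (G i)"
      using biinvariantD(3)[OF D i] biinvariantD(3)[OF E i] by auto
    have self: "\<alpha> i \<otimes>\<^bsub>G i\<^esub> \<beta> i \<in> double_coset (G i) (\<Gamma> i) (\<alpha> i \<otimes>\<^bsub>G i\<^esub> \<beta> i)"
      using Gi.double_coset_self[OF H] c by simp
    show ?thesis
    proof (cases "D i = \<Gamma> i")
      case True
      then show ?thesis
        using self c i biinvariantD(4)[OF E i c(2)] F[OF i] by (auto simp: Gi.double_coset_mult_left[OF H])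
    next
      case False
      then show ?thesis
        using self c i biinvariantD(4)[OF D i c(1)] F[OF i] disjoint[OF i] by (auto simp: Gi.double_coset_mult_right[OF H])
    qed
  qed
  then show ?thesis by (simp add: mult_Ghat)
qed

text \<open>An element of \<open>\<Prod> F i\<close> is split by distributing its components over two elements and filling up with
1.\<close>

lemma mult_coprime_ex:
  assumes \<phi>: "\<phi> \<in> PiE I F"
  obtains \<alpha> \<beta> where "\<alpha> \<in> PiE I D" "\<beta> \<in> PiE I E" "\<phi> = \<alpha> \<otimes>\<^bsub>Ghat\<^esub> \<beta>"
proof
  let ?\<alpha> = "\<lambda>i\<in>I. if D i = \<Gamma> i then \<one>\<^bsub>G i\<^esub> else \<phi> i"
  let ?\<beta> = "\<lambda>i\<in>I. if D i = \<Gamma> i then \<phi> i else \<one>\<^bsub>G i\<^esub>"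
  show "?\<alpha> \<in> PiE I D" "?\<beta> \<in> PiE I E"
    using \<phi> F disjoint subgroup.one_closed[OF subgroup_\<Gamma>] by (auto simp: PiE_iff split: if_splits) (metis)+
  have "\<phi> i = ?\<alpha> i \<otimes>\<^bsub>G i\<^esub> ?\<beta> i" if i: "i \<in> I" for i
  proof -
    interpret Gi: group "G i" using group_G i .
    have "\<phi> i \<in> carrier (G i)"
      using \<phi> F[OF i] i biinvariantD(3)[OF D i] biinvariantD(3)[OF E i]
      by (auto dest!: PiE_mem[OF _ i] split: if_splits)
    then show ?thesis using i by simp
  qed
  then show "\<phi> = ?\<alpha> \<otimes>\<^bsub>Ghat\<^esub> ?\<beta>"
    using \<phi> by (auto simp: mult_Ghat PiE_iff extensional_def)
qed

text \<open>Injectivity holds since the double cosets of \<open>\<alpha>\<close> and \<open>\<beta>\<close> can be read off that of \<open>\<alpha>\<beta>\<close>: at each index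
one of them is \<open>\<Gamma> i\<close> and the other is the double coset of \<open>\<alpha> i \<otimes> \<beta> i\<close>.\<close>

lemma bij_betw_set_mult: "bij_betw (\<lambda>(X, Y). X <#>\<^bsub>Ghat\<^esub> Y) (SS D \<times> SS E) (SS F)"
proof -
  interpret Ghat: group Ghat by (rule group_Ghat)
  have prod: "double_coset Ghat \<Gamma>hat \<alpha> <#>\<^bsub>Ghat\<^esub> double_coset Ghat \<Gamma>hat \<beta> = double_coset Ghat \<Gamma>hat (\<alpha> \<otimes>\<^bsub>Ghat\<^esub> \<beta>)"
    if \<alpha>: "\<alpha> \<in> PiE I D" and \<beta>: "\<beta> \<in> PiE I E" for \<alpha> \<beta>
  proof (rule set_mult_double_coset)
    show "\<alpha> i \<in> \<Gamma> i \<or> \<beta> i \<in> \<Gamma> i" if "i \<in> I" for i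
      using disjoint[OF that] PiE_mem[OF \<alpha> that] PiE_mem[OF \<beta> that] by auto
  qed (use \<alpha> \<beta> biinvariant_PiE[OF D] biinvariant_PiE[OF E] in auto)
  have inj: "double_coset Ghat \<Gamma>hat \<alpha> = double_coset Ghat \<Gamma>hat \<alpha>' \<and> double_coset Ghat \<Gamma>hat \<beta> = double_coset Ghat \<Gamma>hat \<beta>'"
    if \<alpha>: "\<alpha> \<in> PiE I D" "\<alpha>' \<in> PiE I D" and \<beta>: "\<beta> \<in> PiE I E" "\<beta>' \<in> PiE I E"
      and eq: "double_coset Ghat \<Gamma>hat (\<alpha> \<otimes>\<^bsub>Ghat\<^esub> \<beta>) = double_coset Ghat \<Gamma>hat (\<alpha>' \<otimes>\<^bsub>Ghat\<^esub> \<beta>')" for \<alpha> \<alpha>' \<beta> \<beta>'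
  proof -
    have carr: "\<alpha> \<in> carrier Ghat" "\<alpha>' \<in> carrier Ghat" "\<beta> \<in> carrier Ghat" "\<beta>' \<in> carrier Ghat"
      using \<alpha> \<beta> biinvariant_PiE[OF D] biinvariant_PiE[OF E] by auto
    have "double_coset (G i) (\<Gamma> i) (\<alpha> i) = double_coset (G i) (\<Gamma> i) (\<alpha>' i) \<and>
          double_coset (G i) (\<Gamma> i) (\<beta> i) = double_coset (G i) (\<Gamma> i) (\<beta>' i)" if i: "i \<in> I" for i
    proof -
      interpret Gi: group "G i" using group_G i .
      note H = subgroup_\<Gamma>[OF i]
      have c: "\<alpha> i \<in> carrier (G i)" "\<alpha>' i \<in> carrier (G i)" "\<beta> i \<in> carrier (G i)" "\<beta>' i \<in> carrier (G i)"
        using carr i by (auto simp: mem_carrier_iff)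
      have e: "double_coset (G i) (\<Gamma> i) (\<alpha> i \<otimes>\<^bsub>G i\<^esub> \<beta> i) = double_coset (G i) (\<Gamma> i) (\<alpha>' i \<otimes>\<^bsub>G i\<^esub> \<beta>' i)"
        using eq i carr unfolding double_coset_Ghat_eq_iff[OF Ghat.m_closed[OF carr(1,3)] Ghat.m_closed[OF carr(2,4)]]
        by (auto simp: mult_Ghat)
      have m: "\<alpha> i \<in> D i" "\<alpha>' i \<in> D i" "\<beta> i \<in> E i" "\<beta>' i \<in> E i" using \<alpha> \<beta> i by (auto dest: PiE_mem)
      from disjoint[OF i] show ?thesis
      proof
        assume "D i = \<Gamma> i"
        then show ?thesis
          using e m c by (simp add: Gi.double_coset_mult_left[OF H] Gi.double_coset_of_mem[OF H])
      next
        assume "E i = \<Gamma> i"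
        then show ?thesis
          using e m c by (simp add: Gi.double_coset_mult_right[OF H] Gi.double_coset_of_mem[OF H])
      qed
    qed
    then show ?thesis using carr by (simp add: double_coset_Ghat_eq_iff)
  qed
  show ?thesis
  proof (rule bij_betw_imageI)
    show "inj_on (\<lambda>(X, Y). X <#>\<^bsub>Ghat\<^esub> Y) (SS D \<times> SS E)"
    proof (intro inj_onI, clarsimp simp: prod)
      fix \<alpha> \<alpha>' \<beta> \<beta>'
      assume "\<alpha> \<in> PiE I D" "\<alpha>' \<in> PiE I D" "\<beta> \<in> PiE I E" "\<beta>' \<in> PiE I E"
        "double_coset Ghat \<Gamma>hat (\<alpha> \<otimes>\<^bsub>Ghat\<^esub> \<beta>) = double_coset Ghat \<Gamma>hat (\<alpha>' \<otimes>\<^bsub>Ghat\<^esub> \<beta>')"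
      then show "double_coset Ghat \<Gamma>hat \<alpha> = double_coset Ghat \<Gamma>hat \<alpha>' \<and> double_coset Ghat \<Gamma>hat \<beta> = double_coset Ghat \<Gamma>hat \<beta>'"
        by (rule inj)
    qed
    have "(\<lambda>(X, Y). X <#>\<^bsub>Ghat\<^esub> Y) ` (SS D \<times> SS E) =
        (\<lambda>(\<alpha>, \<beta>). double_coset Ghat \<Gamma>hat \<alpha> <#>\<^bsub>Ghat\<^esub> double_coset Ghat \<Gamma>hat \<beta>) ` (PiE I D \<times> PiE I E)"
      by (simp only: image_paired_Times[symmetric] image_image case_prod_unfold fst_conv snd_conv)
    also have "\<dots> = double_coset Ghat \<Gamma>hat ` ((\<lambda>(\<alpha>, \<beta>). \<alpha> \<otimes>\<^bsub>Ghat\<^esub> \<beta>) ` (PiE I D \<times> PiE I E))"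
      unfolding image_image by (rule image_cong) (auto simp: prod)
    also have "(\<lambda>(\<alpha>, \<beta>). \<alpha> \<otimes>\<^bsub>Ghat\<^esub> \<beta>) ` (PiE I D \<times> PiE I E) = PiE I F"
    proof
      show "(\<lambda>(\<alpha>, \<beta>). \<alpha> \<otimes>\<^bsub>Ghat\<^esub> \<beta>) ` (PiE I D \<times> PiE I E) \<subseteq> PiE I F"
        by (clarsimp simp: mult_coprime_mem)
      show "PiE I F \<subseteq> (\<lambda>(\<alpha>, \<beta>). \<alpha> \<otimes>\<^bsub>Ghat\<^esub> \<beta>) ` (PiE I D \<times> PiE I E)"
        by (rule subsetI, erule mult_coprime_ex) auto
    qed
    finally show "(\<lambda>(X, Y). X <#>\<^bsub>Ghat\<^esub> Y) ` (SS D \<times> SS E) = SS F" .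
  qed
qed

lemma hecke_prod_coprime_set_mult:
  assumes F\<Delta>: "PiE I F \<subseteq> \<Delta>hat" and XY: "X \<in> SS D" "Y \<in> SS E"
  shows "hecke_prod Ghat \<Gamma>hat \<Delta>hat X Y = frag_of (X <#>\<^bsub>Ghat\<^esub> Y)"
proof -
  obtain \<alpha> \<beta> where ab: "\<alpha> \<in> PiE I D" "X = double_coset Ghat \<Gamma>hat \<alpha>" "\<beta> \<in> PiE I E" "Y = double_coset Ghat \<Gamma>hat \<beta>"
    using XY by auto
  have triv: "\<alpha> i \<in> \<Gamma> i \<or> \<beta> i \<in> \<Gamma> i" if "i \<in> I" for i
    using ab disjoint[OF that] that by (auto dest: PiE_mem)
  have m: "\<alpha> \<in> \<Delta>hat" "\<beta> \<in> \<Delta>hat" "\<alpha> \<otimes>\<^bsub>Ghat\<^esub> \<beta> \<in> \<Delta>hat"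
    using subsetD[OF biinvariant_PiE(2)[OF D] ab(1)] subsetD[OF biinvariant_PiE(2)[OF E] ab(3)]
      subsetD[OF F\<Delta> mult_coprime_mem[OF ab(1,3)]] .
  show ?thesis
    unfolding ab using hecke_prod_coprime[OF m triv] set_mult_double_coset[OF _ _ triv] m by simp
qed

text \<open>The two sums are multiplied out and reindexed along the bijection above. If one of the sets of double
cosets is infinite, its sum is 0 by convention; the set for \<open>F\<close> is then infinite or empty, so that its
sum is 0 as well, and the equation persists.\<close>

lemma hecke_sum_mult:
  shows "hecke_sum F = hecke_sum D \<otimes>\<^bsub>hecke_ring Ghat \<Gamma>hat \<Delta>hat\<^esub> hecke_sum E"
proof -
  have F\<Delta>: "PiE I F \<subseteq> \<Delta>hat"
  proof -
    have "{i \<in> I. F i \<noteq> \<Gamma> i} \<subseteq> {i \<in> I. D i \<noteq> \<Gamma> i} \<union> {i \<in> I. E i \<noteq> \<Gamma> i}" by (auto simp: F)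
    then have "biinvariant F"
      using D E F unfolding biinvariant_def by (auto intro: finite_subset)
    then show ?thesis by (rule biinvariant_PiE)
  qed
  have reindex: "hecke_sum F = (\<Sum>(X, Y) \<in> SS D \<times> SS E. frag_of (X <#>\<^bsub>Ghat\<^esub> Y))"
    unfolding hecke_sum_def using sum.reindex_bij_betw[OF bij_betw_set_mult, of frag_of] by (simp add: case_prod_unfold)
  have mult: "hecke_sum D \<otimes>\<^bsub>hecke_ring Ghat \<Gamma>hat \<Delta>hat\<^esub> hecke_sum E =
      frag_extend (\<lambda>X. frag_extend (\<lambda>Y. hecke_prod Ghat \<Gamma>hat \<Delta>hat X Y) (hecke_sum E)) (hecke_sum D)"
    by (simp add: hecke_ring_def)
  show ?thesis
  proof (cases "finite (SS D) \<and> finite (SS E)")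
    case True
    have "hecke_sum D \<otimes>\<^bsub>hecke_ring Ghat \<Gamma>hat \<Delta>hat\<^esub> hecke_sum E = (\<Sum>X\<in>SS D. \<Sum>Y\<in>SS E. hecke_prod Ghat \<Gamma>hat \<Delta>hat X Y)"
      unfolding mult unfolding hecke_sum_def using True by (simp add: frag_extend_sum del: finite_PiE finite_imageI)
    also have "\<dots> = (\<Sum>X\<in>SS D. \<Sum>Y\<in>SS E. frag_of (X <#>\<^bsub>Ghat\<^esub> Y))"
      by (intro sum.cong refl hecke_prod_coprime_set_mult F\<Delta>)
    finally show ?thesis
      by (simp add: reindex sum.cartesian_product)
  next
    case False
    then have "hecke_sum D = 0 \<or> hecke_sum E = 0" by (auto simp: hecke_sum_def simp del: finite_imageI)
    moreover have "SS D \<times> SS E = {} \<or> infinite (SS D \<times> SS E)"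
      using False by (auto simp: finite_cartesian_product_iff simp del: finite_imageI)
    then have "hecke_sum F = 0" unfolding reindex by (auto simp del: finite_cartesian_product_iff)
    ultimately show ?thesis unfolding mult by (auto simp: frag_extend_def)
  qed
qed

end

text \<open>This identifies the embedding of a local Hecke ring on sums of double cosets: a double coset in the
product of \<open>D\<close> is determined by its component at \<open>p\<close>, all others being \<open>\<Gamma> i\<close>.\<close>

lemma hecke_sum_single:
  assumes D: "biinvariant D" and p: "p \<in> I" and off: "\<And>i. i \<in> I \<Longrightarrow> i \<noteq> p \<Longrightarrow> D i = \<Gamma> i"
  defines "\<iota> \<equiv> \<lambda>a. \<lambda>i\<in>I. if i = p then a else \<one>\<^bsub>G i\<^esub>"
  shows "frag_extend (\<lambda>X. frag_of ((\<Gamma>hat <#>\<^bsub>Ghat\<^esub> (\<iota> ` X)) <#>\<^bsub>Ghat\<^esub> \<Gamma>hat))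
      (\<Sum>X \<in> double_coset (G p) (\<Gamma> p) ` D p. frag_of X) = hecke_sum D"
proof -
  interpret Ghat: group Ghat by (rule group_Ghat)
  interpret Gp: group "G p" using group_G p .
  note Hp = subgroup_\<Gamma>[OF p]
  let ?dc = "double_coset Ghat \<Gamma>hat" and ?d = "\<lambda>i. double_coset (G i) (\<Gamma> i)"
  let ?f = "\<lambda>X. (\<Gamma>hat <#>\<^bsub>Ghat\<^esub> (\<iota> ` X)) <#>\<^bsub>Ghat\<^esub> \<Gamma>hat"
  have \<iota>: "\<iota> a \<in> PiE I D" if "a \<in> D p" for a
    using that off subgroup.one_closed[OF subgroup_\<Gamma>] by (auto simp: \<iota>_def)
  have \<iota>_carr: "\<iota> a \<in> carrier Ghat" if "a \<in> D p" for a
    using \<iota>[OF that] biinvariant_PiE[OF D] by auto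
  have img: "?f (?d p a) = ?dc (\<iota> a)" if a: "a \<in> D p" for a
  proof -
    have "\<iota> x \<in> ?dc (\<iota> a)" if x: "x \<in> ?d p a" for x
    proof -
      have "\<iota> x i \<in> ?d i (\<iota> a i)" if "i \<in> I" for i
        using x that group.double_coset_self[OF group_G subgroup_\<Gamma>] by (auto simp: \<iota>_def)
      then show ?thesis unfolding double_coset_Ghat[OF \<iota>_carr[OF a]] by (auto simp: \<iota>_def)
    qed
    then have "h \<otimes>\<^bsub>Ghat\<^esub> \<iota> x \<otimes>\<^bsub>Ghat\<^esub> k \<in> ?dc (\<iota> a)" if "x \<in> ?d p a" "h \<in> \<Gamma>hat" "k \<in> \<Gamma>hat" for h x k
      using that Ghat.double_coset_eq[OF subgroup_\<Gamma>hat \<iota>_carr[OF a]] by (metis mem_double_coset_iff)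
    then have "?f (?d p a) \<subseteq> ?dc (\<iota> a)"
      unfolding set_mult_def by blast
    moreover have "?dc (\<iota> a) \<subseteq> ?f (?d p a)"
    proof -
      have "a \<in> ?d p a" using Gp.double_coset_self[OF Hp] a biinvariantD(3)[OF D p] by auto
      then have "\<Gamma>hat <#>\<^bsub>Ghat\<^esub> {\<iota> a} \<subseteq> \<Gamma>hat <#>\<^bsub>Ghat\<^esub> (\<iota> ` ?d p a)"
        by (intro mono_set_mult) auto
      moreover have "?dc (\<iota> a) = (\<Gamma>hat <#>\<^bsub>Ghat\<^esub> {\<iota> a}) <#>\<^bsub>Ghat\<^esub> \<Gamma>hat"
        by (simp add: double_coset_def r_coset_eq_set_mult)
      ultimately show ?thesis by (simp add: mono_set_mult)
    qed
    ultimately show ?thesis by blast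
  qed
  have inj: "inj_on ?f (?d p ` D p)"
  proof (rule inj_onI, clarify)
    fix a b assume ab: "a \<in> D p" "b \<in> D p" and "?f (?d p a) = ?f (?d p b)"
    then have "?dc (\<iota> a) = ?dc (\<iota> b)" using img by simp
    then show "?d p a = ?d p b"
      using double_coset_Ghat_eq_iff[OF \<iota>_carr[OF ab(1)] \<iota>_carr[OF ab(2)]] p by (auto simp: \<iota>_def)
  qed
  have "?dc \<alpha> = ?dc (\<iota> (\<alpha> p))" if \<alpha>: "\<alpha> \<in> PiE I D" for \<alpha>
  proof -
    have ap: "\<alpha> p \<in> D p" and a: "\<alpha> \<in> carrier Ghat"
      using \<alpha> p biinvariant_PiE[OF D] by auto
    have "?d i (\<alpha> i) = ?d i (\<iota> (\<alpha> p) i)" if i: "i \<in> I" "i \<noteq> p" for i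
      using group.double_coset_of_mem[OF group_G[OF i(1)] subgroup_\<Gamma>[OF i(1)]] subgroup.one_closed[OF subgroup_\<Gamma>[OF i(1)]] off[OF i] i \<alpha>
      by (auto simp: \<iota>_def dest!: PiE_mem[OF _ i(1)])
    then show ?thesis
      unfolding double_coset_Ghat_eq_iff[OF a \<iota>_carr[OF ap]] by (auto simp: \<iota>_def)
  qed
  then have "SS D = (\<lambda>a. ?dc (\<iota> a)) ` D p"
    using \<iota> p by (force dest: PiE_mem)
  then have surj: "?f ` (?d p ` D p) = SS D"
    using img by (auto simp: image_image)
  have "frag_extend (\<lambda>X. frag_of (?f X)) (\<Sum>X \<in> ?d p ` D p. frag_of X) = (\<Sum>X \<in> ?d p ` D p. frag_of (?f X))"
    by (cases "finite (?d p ` D p)") (simp_all add: frag_extend_sum o_def del: finite_imageI)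
  also have "\<dots> = (\<Sum>Y \<in> ?f ` (?d p ` D p). frag_of Y)"
    by (subst sum.reindex[OF inj]) (simp add: o_def)
  finally show ?thesis unfolding surj hecke_sum_def .
qed

end

section \<open>Multiplicative sequences and Euler products\<close>

lemma coprime_prime_power_prod:
  fixes k :: "nat \<Rightarrow> nat"
  assumes "finite B" "B \<subseteq> primes" "prime p" "p \<notin> B"
  shows "coprime (p ^ k p) (\<Prod>q\<in>B. q ^ k q)"
proof (rule prod_coprime_right)
  fix q assume "q \<in> B"
  then have "coprime p q" using assms primes_coprime[of p q] by auto
  then show "coprime (p ^ k p) (q ^ k q)" by simp
qed

context
  fixes R :: "('r, 'm) ring_scheme" and f :: "nat \<Rightarrow> 'r" and k :: "nat \<Rightarrow> nat"
  assumes mult: "multiplicative_seq R f"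
begin

lemma multiplicative_seq_insert_prime:
  assumes "finite B" "B \<subseteq> primes" "prime p" "p \<notin> B"
  shows "f (\<Prod>q\<in>insert p B. q ^ k q) = f (p ^ k p) \<otimes>\<^bsub>R\<^esub> f (\<Prod>q\<in>B. q ^ k q)"
proof -
  have "(\<Prod>q\<in>B. q ^ k q) > 0" "p ^ k p > 0"
    using assms prime_gt_0_nat by (auto intro!: prod_pos)
  then show ?thesis
    using assms coprime_prime_power_prod[OF assms] mult by (simp add: multiplicative_seq_def)
qed

text \<open>\<^const>\<open>finprod\<close> is the unique result of a fold, so its value is meaningful only if all orders of
multiplication agree. They do: by multiplicativity the partial product over a set \<open>C\<close> of primes,
taken in any order, is the value of \<open>f\<close> at \<open>\<Prod>p\<in>C. p ^ k p\<close>. Both existence and uniqueness of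
the fold are proved in this form, by induction on the relation \<^const>\<open>foldSetD\<close>.\<close>

lemma finprod_multiplicative_seq:
  assumes closed: "\<And>n. n > 0 \<Longrightarrow> f n \<in> carrier R" and B: "finite B" "B \<subseteq> primes"
    and g: "\<And>p. p \<in> B \<Longrightarrow> g p = f (p ^ k p)"
  shows "finprod R g B = f (\<Prod>p\<in>B. p ^ k p)"
proof -
  let ?F = "foldSetD (carrier R) ((\<otimes>\<^bsub>R\<^esub>) \<circ> g) \<one>\<^bsub>R\<^esub>"
  have one: "f 1 = \<one>\<^bsub>R\<^esub>" using mult by (simp add: multiplicative_seq_def)
  have pos: "(\<Prod>p\<in>C. p ^ k p) > 0" if "C \<subseteq> B" for C
    using that B prime_gt_0_nat by (auto intro!: prod_pos)
  have ex: "(C, f (\<Prod>p\<in>C. p ^ k p)) \<in> ?F" if "finite C" "C \<subseteq> B" for C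
    using that
  proof (induction C)
    case empty
    then show ?case using one closed[of 1] by (auto intro: foldSetD.emptyI)
  next
    case (insert p C)
    have eq: "f (\<Prod>q\<in>insert p C. q ^ k q) = ((\<otimes>\<^bsub>R\<^esub>) \<circ> g) p (f (\<Prod>q\<in>C. q ^ k q))"
      using multiplicative_seq_insert_prime[of C p] insert B g[of p] by auto
    show ?case
      unfolding eq
    proof (rule foldSetD.insertI)
      show "((\<otimes>\<^bsub>R\<^esub>) \<circ> g) p (f (\<Prod>q\<in>C. q ^ k q)) \<in> carrier R"
        unfolding eq[symmetric] by (intro closed pos insert.prems)
    qed (use insert in auto)
  qed
  have uniq: "x = f (\<Prod>p\<in>C. p ^ k p)" if "(C, x) \<in> ?F" "C \<subseteq> B" for C x
    using that
  proof (induction rule: foldSetD.induct)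
    case emptyI
    then show ?case using one by simp
  next
    case (insertI p C y)
    then have "finite C" "prime p" using B finite_subset by auto
    then show ?case
      using multiplicative_seq_insert_prime[of C p] insertI B g[of p] by auto
  qed
  have "(THE x. (B, x) \<in> ?F) = f (\<Prod>p\<in>B. p ^ k p)"
    by (rule the_equality, rule ex[OF B(1) order_refl], erule uniq[OF _ order_refl])
  then show ?thesis using B(1) by (simp add: finprod_def foldD_def)
qed

text \<open>A factor \<open>f (p ^ k p) = \<one>\<close> equals \<open>f 1\<close>, so multiplication by it is again an instance of
multiplicativity: \<open>f 1 \<otimes> f m = f (1 * m)\<close>.\<close>

lemma multiplicative_seq_drop_trivial:
  assumes "finite C" "finite B" "B \<union> C \<subseteq> primes" "B \<inter> C = {}" "\<And>p. p \<in> C \<Longrightarrow> f (p ^ k p) = \<one>\<^bsub>R\<^esub>"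
  shows "f (\<Prod>p\<in>B \<union> C. p ^ k p) = f (\<Prod>p\<in>B. p ^ k p)"
  using assms
proof (induction C)
  case (insert p C)
  let ?m = "\<Prod>q\<in>B \<union> C. q ^ k q"
  have "?m > 0" using insert.prems prime_gt_0_nat by (auto intro!: prod_pos)
  have "f (\<Prod>q\<in>B \<union> insert p C. q ^ k q) = f (p ^ k p) \<otimes>\<^bsub>R\<^esub> f ?m"
    using multiplicative_seq_insert_prime[of "B \<union> C" p] insert by auto
  also have "\<dots> = f 1 \<otimes>\<^bsub>R\<^esub> f ?m" using insert.prems mult by (simp add: multiplicative_seq_def)
  also have "\<dots> = f (1 * ?m)" using mult \<open>?m > 0\<close> unfolding multiplicative_seq_def by (metis coprime_1_left zero_less_one)
  finally show ?case using insert by simp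
qed simp

text \<open>In \<^const>\<open>prime_product\<close> the factors equal to 1 are discarded. These include all primes that do not
divide \<open>n\<close>, and possibly some that do; the latter are put back by the preceding lemma.\<close>

lemma prime_product_multiplicative_seq:
  assumes closed: "\<And>n. n > 0 \<Longrightarrow> f n \<in> carrier R"
    and F: "\<And>p k. prime p \<Longrightarrow> F p (p ^ k) = f (p ^ k)"
    and k: "\<And>p. k p = multiplicity p n" and n: "n > 0"
  shows "prime_product R F n = f n"
proof -
  define B where "B = {p \<in> primes. F p (p ^ k p) \<noteq> \<one>\<^bsub>R\<^esub>}"
  have one: "f 1 = \<one>\<^bsub>R\<^esub>" using mult by (simp add: multiplicative_seq_def)
  have "B \<subseteq> prime_factors n"
  proof
    fix p assume p: "p \<in> B"
    have "k p \<noteq> 0"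
    proof
      assume "k p = 0"
      then have "F p (p ^ k p) = \<one>\<^bsub>R\<^esub>" using F[of p 0] p one by (simp add: B_def)
      then show False using p by (simp add: B_def)
    qed
    then show "p \<in> prime_factors n"
      using p n not_dvd_imp_multiplicity_0[of p n] by (auto simp: B_def k prime_factors_dvd)
  qed
  then have pf: "prime_factors n = B \<union> (prime_factors n - B)" and fin: "finite B"
    using finite_subset by auto
  have "prime_product R F n = finprod R (\<lambda>p. F p (p ^ k p)) B"
    using n by (simp add: prime_product_def dirichlet_series_def B_def k)
  also have "\<dots> = f (\<Prod>p\<in>B. p ^ k p)"
    by (rule finprod_multiplicative_seq) (use closed fin F in \<open>auto simp: B_def\<close>)
  also have "\<dots> = f (\<Prod>p\<in>B \<union> (prime_factors n - B). p ^ k p)"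
    by (rule multiplicative_seq_drop_trivial[symmetric]) (use fin F in \<open>auto simp: B_def\<close>)
  also have "(\<Prod>p\<in>B \<union> (prime_factors n - B). p ^ k p) = n"
    using prime_factorization_nat[OF n] pf by (simp add: k)
  finally show ?thesis .
qed

end

section \<open>Indices of subgroups\<close>

lemma (in group) card_rcosets_image:
  assumes h: "h \<in> hom G G" and bij: "bij_betw h (carrier G) (carrier G)" and H: "H \<subseteq> carrier G"
  shows "card (rcosets (h ` H)) = card (rcosets H)"
proof -
  have coset: "h ` (H #> x) = h ` H #> h x" if "x \<in> carrier G" for x
    using that subsetD[OF H] hom_mult[OF h] by (simp add: r_coset_def image_UN)
  have "rcosets (h ` H) = (\<lambda>y. h ` H #> y) ` carrier G" by (auto simp: RCOSETS_def)
  also have "carrier G = h ` carrier G" using bij by (simp add: bij_betw_def)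
  also have "(\<lambda>y. h ` H #> y) ` h ` carrier G = (\<lambda>x. h ` (H #> x)) ` carrier G"
    unfolding image_image by (rule image_cong) (use coset in auto)
  also have "\<dots> = image h ` (rcosets H)" by (auto simp: RCOSETS_def)
  finally have "rcosets (h ` H) = image h ` (rcosets H)" .
  moreover have "inj_on (image h) (rcosets H)"
    using bij r_coset_subset_G[OF H]
    by (intro inj_on_subset[OF inj_on_image_Pow]) (auto simp: bij_betw_def RCOSETS_def)
  ultimately show ?thesis by (simp add: card_image)
qed

lemma (in group) card_rcosets_eq_1_iff:
  assumes H: "subgroup H G"
  shows "card (rcosets H) = 1 \<longleftrightarrow> H = carrier G"
proof
  assume "card (rcosets H) = 1"
  then obtain K where K: "rcosets H = {K}" by (auto simp: card_1_singleton_iff)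
  have "H \<in> rcosets H" using subgroup.subgroup_in_rcosets[OF H is_group] .
  then have "H #> x = H" if "x \<in> carrier G" for x
    using K rcosetsI[OF subgroup.subset[OF H] that] by auto
  then show "H = carrier G"
    using rcos_self[OF _ H] subgroup.subset[OF H] by auto
next
  assume "H = carrier G"
  then have "rcosets H = {carrier G}"
    using coset_join2[OF _ subgroup_self] by (auto simp: RCOSETS_def)
  then show "card (rcosets H) = 1" by simp
qed

lemma prime_power_of_unique_prime_factor:
  fixes n p :: nat
  assumes "n > 0" "\<And>q. prime q \<Longrightarrow> q dvd n \<Longrightarrow> q = p" "prime p"
  shows "\<exists>k. n = p ^ k"
proof -
  obtain x where x: "n = p ^ multiplicity p n * x" "\<not> p dvd x"
    using multiplicity_decompose'[of n p] assms by (metis not_prime_unit gr_implies_not0)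
  have "x = 1"
    using x assms(2) prime_factor_nat[of x] by (metis dvd_mult)
  then show ?thesis using x by auto
qed

text \<open>Let \<open>q \<noteq> p\<close> be a prime. The \<open>q\<close>-th power map is surjective on the group, hence on its finite
quotient by \<open>H\<close>, hence injective there. If \<open>q\<close> divided the order of the quotient, then by Sylow's
theorem there would be a subgroup of order \<open>q\<close>, whose elements all have \<open>q\<close>-th power 1.\<close>

lemma (in comm_group) index_prime_power_of_divisible:
  assumes p: "prime p" and H: "subgroup H G" and fin: "card (rcosets H) \<noteq> 0"
    and div: "\<And>q x. prime q \<Longrightarrow> q \<noteq> p \<Longrightarrow> x \<in> carrier G \<Longrightarrow> \<exists>y\<in>carrier G. x = y [^] (q::nat)"
  shows "\<exists>k. card (rcosets H) = p ^ k"
proof (rule prime_power_of_unique_prime_factor)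
  interpret H: normal H G by (rule subgroup_imp_normal[OF H])
  interpret Q: group "G Mod H" by (rule H.factorgroup_is_group)
  have order: "order (G Mod H) = card (rcosets H)" by (simp add: order_def FactGroup_def)
  have finQ: "finite (carrier (G Mod H))" using fin by (auto simp: FactGroup_def intro: card_ge_0_finite)
  show "card (rcosets H) > 0" using fin by simp
  fix q assume q: "prime q" "q dvd card (rcosets H)"
  show "q = p"
  proof (rule ccontr)
    assume "q \<noteq> p"
    \<comment> \<open>the \<open>q\<close>-th power map on the quotient\<close>
    define f where "f = (\<lambda>X. X [^]\<^bsub>G Mod H\<^esub> q)"
    have "carrier (G Mod H) \<subseteq> f ` carrier (G Mod H)"
    proof
      fix X assume "X \<in> carrier (G Mod H)"
      then obtain x where x: "x \<in> carrier G" "X = H #> x" by (auto simp: carrier_FactGroup)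
      obtain y where y: "y \<in> carrier G" "x = y [^] q" using div[OF q(1) \<open>q \<noteq> p\<close> x(1)] by blast
      then have "X = f (H #> y)" using x by (simp add: f_def H.FactGroup_pow)
      then show "X \<in> f ` carrier (G Mod H)" using y by (auto simp: carrier_FactGroup)
    qed
    then have inj: "inj_on f (carrier (G Mod H))" by (rule finite_surj_inj[OF finQ])
    obtain m where "card (rcosets H) = q ^ 1 * m" using q by auto
    then obtain K where K: "subgroup K (G Mod H)" "card K = q ^ 1"
      using sylow_thm[OF q(1) Q.is_group _ finQ, of 1 m] order by auto
    have "\<exists>X\<in>K. X \<noteq> \<one>\<^bsub>G Mod H\<^esub>"
    proof (rule ccontr)
      assume "\<not> ?thesis"
      then have "K \<subseteq> {\<one>\<^bsub>G Mod H\<^esub>}" by auto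
      then have "card K \<le> 1" using card_mono[of "{\<one>\<^bsub>G Mod H\<^esub>}" K] by simp
      then show False using K(2) prime_gt_1_nat[OF q(1)] by simp
    qed
    then obtain X where X: "X \<in> K" "X \<noteq> \<one>\<^bsub>G Mod H\<^esub>" by blast
    have "X [^]\<^bsub>(G Mod H)\<lparr>carrier := K\<rparr>\<^esub> order ((G Mod H)\<lparr>carrier := K\<rparr>) = \<one>\<^bsub>G Mod H\<^esub>"
      using group.pow_order_eq_1[OF Q.subgroup_imp_group[OF K(1)], of X] X by simp
    then have "f X = \<one>\<^bsub>G Mod H\<^esub>"
      using K(2) by (simp add: f_def order_def Q.nat_pow_consistent[of X q K])
    moreover have "f \<one>\<^bsub>G Mod H\<^esub> = \<one>\<^bsub>G Mod H\<^esub>" unfolding f_def by (rule Q.nat_pow_one)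
    ultimately show False
      using inj_onD[OF inj, of X "\<one>\<^bsub>G Mod H\<^esub>"] X subgroup.mem_carrier[OF K(1)] Q.one_closed by auto
  qed
qed (rule p)

lemma card_PiE_singletons:
  assumes "S \<subseteq> I" "\<And>i. i \<in> I - S \<Longrightarrow> \<exists>a. F i = {a}"
  shows "card (PiE I F) = card (PiE S F)"
proof -
  obtain a where a: "\<And>i. i \<in> I - S \<Longrightarrow> F i = {a i}" using assms(2) by metis
  have "bij_betw (\<lambda>f. restrict f S) (PiE I F) (PiE S F)"
  proof (rule bij_betwI[of _ _ _ "\<lambda>f. \<lambda>i\<in>I. if i \<in> S then f i else a i"])
    show "(\<lambda>f. restrict f S) \<in> PiE I F \<rightarrow> PiE S F" using assms(1) by auto
    show "(\<lambda>f. \<lambda>i\<in>I. if i \<in> S then f i else a i) \<in> PiE S F \<rightarrow> PiE I F" using a by auto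
    show "(\<lambda>i\<in>I. if i \<in> S then restrict f S i else a i) = f" if "f \<in> PiE I F" for f
    proof
      fix i show "(\<lambda>i\<in>I. if i \<in> S then restrict f S i else a i) i = f i"
        using that a[of i] PiE_mem[OF that, of i] PiE_arb[OF that, of i] by auto
    qed
    show "restrict (\<lambda>i\<in>I. if i \<in> S then f i else a i) S = f" if "f \<in> PiE S F" for f
    proof
      fix i show "restrict (\<lambda>i\<in>I. if i \<in> S then f i else a i) S i = f i"
        using that assms(1) PiE_arb[OF that, of i] by auto
    qed
  qed
  then show ?thesis by (rule bij_betw_same_card)
qed

text \<open>A coset of \<open>\<Prod> H i\<close> in the product of the groups is the product of its component cosets, and these
are arbitrary. At the indices outside \<open>S\<close> there is only one coset.\<close>

lemma card_rcosets_product_group: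
  assumes grp: "\<And>i. i \<in> I \<Longrightarrow> group (G i)" and sub: "\<And>i. i \<in> I \<Longrightarrow> subgroup (H i) (G i)"
    and S: "finite S" "S \<subseteq> I" "\<And>i. i \<in> I - S \<Longrightarrow> H i = carrier (G i)"
  shows "card (rcosets\<^bsub>product_group I G\<^esub> (PiE I H)) = (\<Prod>i\<in>S. card (rcosets\<^bsub>G i\<^esub> (H i)))"
proof -
  have coset: "PiE I H #>\<^bsub>product_group I G\<^esub> x = (\<Pi>\<^sub>E i\<in>I. H i #>\<^bsub>G i\<^esub> x i)"
    if x: "x \<in> (\<Pi>\<^sub>E i\<in>I. carrier (G i))" for x
  proof
    show "PiE I H #>\<^bsub>product_group I G\<^esub> x \<subseteq> (\<Pi>\<^sub>E i\<in>I. H i #>\<^bsub>G i\<^esub> x i)"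
      by (auto simp: r_coset_def)
    show "(\<Pi>\<^sub>E i\<in>I. H i #>\<^bsub>G i\<^esub> x i) \<subseteq> PiE I H #>\<^bsub>product_group I G\<^esub> x"
    proof
      fix y assume y: "y \<in> (\<Pi>\<^sub>E i\<in>I. H i #>\<^bsub>G i\<^esub> x i)"
      then have "\<forall>i\<in>I. \<exists>h. h \<in> H i \<and> y i = h \<otimes>\<^bsub>G i\<^esub> x i" by (auto simp: PiE_iff r_coset_def)
      then obtain h where h: "\<And>i. i \<in> I \<Longrightarrow> h i \<in> H i \<and> y i = h i \<otimes>\<^bsub>G i\<^esub> x i" by metis
      then have "y = restrict h I \<otimes>\<^bsub>product_group I G\<^esub> x"
        using y by (auto simp: PiE_iff extensional_def)
      then show "y \<in> PiE I H #>\<^bsub>product_group I G\<^esub> x"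
        using h unfolding r_coset_def by (intro UN_I[of "restrict h I"]) auto
    qed
  qed
  let ?C = "\<lambda>i. rcosets\<^bsub>G i\<^esub> (H i)"
  have "rcosets\<^bsub>product_group I G\<^esub> (PiE I H) = PiE I ` PiE I ?C"
  proof
    show "rcosets\<^bsub>product_group I G\<^esub> (PiE I H) \<subseteq> PiE I ` PiE I ?C"
    proof
      fix K assume "K \<in> rcosets\<^bsub>product_group I G\<^esub> (PiE I H)"
      then obtain x where x: "x \<in> (\<Pi>\<^sub>E i\<in>I. carrier (G i))" "K = (\<Pi>\<^sub>E i\<in>I. H i #>\<^bsub>G i\<^esub> x i)"
        using coset by (auto simp: RCOSETS_def)
      then have "K = PiE I (\<lambda>i\<in>I. H i #>\<^bsub>G i\<^esub> x i)" by (simp cong: PiE_cong)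
      then show "K \<in> PiE I ` PiE I ?C"
        using x by (intro image_eqI[of _ _ "\<lambda>i\<in>I. H i #>\<^bsub>G i\<^esub> x i"]) (auto simp: RCOSETS_def)
    qed
    show "PiE I ` PiE I ?C \<subseteq> rcosets\<^bsub>product_group I G\<^esub> (PiE I H)"
    proof clarify
      fix K assume K: "K \<in> PiE I ?C"
      then have "\<forall>i\<in>I. \<exists>x. x \<in> carrier (G i) \<and> K i = H i #>\<^bsub>G i\<^esub> x" by (auto simp: PiE_iff RCOSETS_def)
      then obtain x where x: "\<And>i. i \<in> I \<Longrightarrow> x i \<in> carrier (G i) \<and> K i = H i #>\<^bsub>G i\<^esub> x i" by metis
      then have "PiE I K = PiE I H #>\<^bsub>product_group I G\<^esub> (restrict x I)"
        by (subst coset) (auto cong: PiE_cong)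
      then show "PiE I K \<in> rcosets\<^bsub>product_group I G\<^esub> (PiE I H)"
        using x by (auto simp: RCOSETS_def intro!: bexI[of _ "restrict x I"])
    qed
  qed
  moreover have "inj_on (PiE I) (PiE I ?C)"
  proof (rule inj_onI)
    fix K K' assume K: "K \<in> PiE I ?C" "K' \<in> PiE I ?C" and eq: "PiE I K = PiE I K'"
    have "K i \<noteq> {}" "K' i \<noteq> {}" if "i \<in> I" for i
      using K that subgroup.rcosets_non_empty[OF sub[OF that]] by (auto dest: PiE_mem)
    then have "\<forall>i\<in>I. K i = K' i" using eq by (simp add: PiE_eq_iff)
    then show "K = K'" using K by (intro PiE_ext) auto
  qed
  ultimately have "card (rcosets\<^bsub>product_group I G\<^esub> (PiE I H)) = card (PiE I ?C)"
    by (simp add: card_image)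
  also have "\<dots> = card (PiE S ?C)"
  proof (rule card_PiE_singletons[OF S(2)])
    fix i assume i: "i \<in> I - S"
    then have "carrier (G i) \<noteq> {}"
      using monoid.one_closed[OF group.is_monoid[OF grp]] by blast
    then have "?C i = {carrier (G i)}"
      using i S(3) group.coset_join2[OF grp _ group.subgroup_self[OF grp]]
      by (auto simp: RCOSETS_def)
    then show "\<exists>a. ?C i = {a}" by blast
  qed
  also have "\<dots> = (\<Prod>i\<in>S. card (?C i))" by (rule card_PiE[OF S(1)])
  finally show ?thesis .
qed

section \<open>Automorphisms of an algebra and the lattices they preserve\<close>

lemma alg_EndD:
  assumes "f \<in> alg_End A M"
  shows "f \<in> carrier M \<rightarrow>\<^sub>E carrier M" "x \<in> carrier M \<Longrightarrow> f x \<in> carrier M"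
    "x \<in> carrier M \<Longrightarrow> y \<in> carrier M \<Longrightarrow> f (x \<oplus>\<^bsub>M\<^esub> y) = f x \<oplus>\<^bsub>M\<^esub> f y"
    "x \<in> carrier M \<Longrightarrow> y \<in> carrier M \<Longrightarrow> f (x \<otimes>\<^bsub>M\<^esub> y) = f x \<otimes>\<^bsub>M\<^esub> f y"
    "c \<in> carrier A \<Longrightarrow> x \<in> carrier M \<Longrightarrow> f (c \<odot>\<^bsub>M\<^esub> x) = c \<odot>\<^bsub>M\<^esub> f x"
  using assms by (auto simp: alg_End_def)

text \<open>Closure of the operations is what makes the inverse of a bijective endomorphism an endomorphism: a
product or multiple formed in the image can be pulled back only if it lies in the carrier.\<close>

locale scalar_algebra = biadditive_algebra M for A :: "('b, 'n) ring_scheme" and M :: "('b, 'v, 'k) module_scheme" (structure) +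
  assumes smult_closed: "c \<in> carrier A \<Longrightarrow> x \<in> carrier M \<Longrightarrow> c \<odot> x \<in> carrier M"
begin

abbreviation "GA \<equiv> alg_Aut_group A M"

lemma GA_simps [simp]:
  "carrier GA = alg_Aut A M" "\<alpha> \<otimes>\<^bsub>GA\<^esub> \<beta> = compose (carrier M) \<beta> \<alpha>" "\<one>\<^bsub>GA\<^esub> = (\<lambda>x\<in>carrier M. x)"
  by (simp_all add: alg_Aut_group_def)

lemma alg_AutD:
  assumes "f \<in> alg_Aut A M"
  shows "f \<in> alg_End A M" "bij_betw f (carrier M) (carrier M)"
  using assms by (auto simp: alg_Aut_def)

lemma group_GA: "group GA"
proof (rule groupI)
  fix \<alpha> \<beta> assume \<alpha>: "\<alpha> \<in> carrier GA" and \<beta>: "\<beta> \<in> carrier GA"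
  then have e: "\<alpha> \<in> alg_End A M" "\<beta> \<in> alg_End A M" "bij_betw \<alpha> (carrier M) (carrier M)" "bij_betw \<beta> (carrier M) (carrier M)"
    by (auto dest: alg_AutD)
  have "compose (carrier M) \<beta> \<alpha> \<in> alg_End A M"
    using alg_EndD(2-)[OF e(1)] alg_EndD(2-)[OF e(2)]
    unfolding alg_End_def[of A M] by (auto simp: compose_def mult_closed smult_closed)
  moreover have "bij_betw (compose (carrier M) \<beta> \<alpha>) (carrier M) (carrier M)"
    using bij_betw_compose[OF e(3,4)] .
  ultimately show "\<alpha> \<otimes>\<^bsub>GA\<^esub> \<beta> \<in> carrier GA" by (simp add: alg_Aut_def)
next
  have "bij_betw (\<lambda>x\<in>carrier M. x) (carrier M) (carrier M)"
    by (auto intro!: bij_betwI[of _ _ _ "\<lambda>x. x"])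
  then show "\<one>\<^bsub>GA\<^esub> \<in> carrier GA"
    by (auto simp: alg_Aut_def alg_End_def mult_closed smult_closed)
next
  fix \<alpha> \<beta> \<gamma> assume "\<alpha> \<in> carrier GA" "\<beta> \<in> carrier GA" "\<gamma> \<in> carrier GA"
  then have "\<alpha> \<in> carrier M \<rightarrow> carrier M" by (auto dest!: alg_AutD(1) dest: alg_EndD(2))
  then show "\<alpha> \<otimes>\<^bsub>GA\<^esub> \<beta> \<otimes>\<^bsub>GA\<^esub> \<gamma> = \<alpha> \<otimes>\<^bsub>GA\<^esub> (\<beta> \<otimes>\<^bsub>GA\<^esub> \<gamma>)"
    by (auto simp: compose_def Pi_iff)
next
  fix \<alpha> assume "\<alpha> \<in> carrier GA"
  then have e: "\<alpha> \<in> alg_End A M" "bij_betw \<alpha> (carrier M) (carrier M)" by (auto dest: alg_AutD)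
  have x: "\<alpha> \<in> extensional (carrier M)" using alg_EndD(1)[OF e(1)] by (simp add: PiE_def)
  show "\<one>\<^bsub>GA\<^esub> \<otimes>\<^bsub>GA\<^esub> \<alpha> = \<alpha>"
    using x by (auto simp: compose_def extensional_def)
  define \<beta> where "\<beta> = restrict (inv_into (carrier M) \<alpha>) (carrier M)"
  have \<beta>: "\<beta> x \<in> carrier M" "\<alpha> (\<beta> x) = x" "\<beta> (\<alpha> x) = x" if "x \<in> carrier M" for x
    using that e alg_EndD(2)[OF e(1)]
    by (auto simp: \<beta>_def bij_betw_inv_into_right bij_betw_inv_into_left bij_betw_def inv_into_into)
  have bij: "bij_betw \<beta> (carrier M) (carrier M)"
    using \<beta> alg_EndD(2)[OF e(1)] by (intro bij_betwI[of _ _ _ \<alpha>]) auto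
  have eqI: "\<beta> x = y" if "x = \<alpha> y" "y \<in> carrier M" for x y using \<beta> that by simp
  have "\<beta> \<in> alg_End A M"
    unfolding alg_End_def
  proof (intro CollectI conjI ballI)
    show "\<beta> \<in> carrier M \<rightarrow>\<^sub>E carrier M" using \<beta>(1) by (auto simp: \<beta>_def)
    fix x y assume xy: "x \<in> carrier M" "y \<in> carrier M"
    show "\<beta> (x \<oplus> y) = \<beta> x \<oplus> \<beta> y"
      by (rule eqI) (use xy \<beta> alg_EndD(3)[OF e(1)] in auto)
    show "\<beta> (x \<otimes> y) = \<beta> x \<otimes> \<beta> y"
      by (rule eqI) (use xy \<beta> alg_EndD(4)[OF e(1)] mult_closed in auto)
  next
    fix c x assume cx: "c \<in> carrier A" "x \<in> carrier M"
    show "\<beta> (c \<odot> x) = c \<odot> \<beta> x"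
      by (rule eqI) (use cx \<beta> alg_EndD(5)[OF e(1)] smult_closed in auto)
  qed
  then have "\<beta> \<in> carrier GA" using bij by (simp add: alg_Aut_def)
  moreover have "\<beta> \<otimes>\<^bsub>GA\<^esub> \<alpha> = \<one>\<^bsub>GA\<^esub>" using \<beta> by (auto simp: compose_def)
  ultimately show "\<exists>\<beta>\<in>carrier GA. \<beta> \<otimes>\<^bsub>GA\<^esub> \<alpha> = \<one>\<^bsub>GA\<^esub>" by blast
qed

end

text \<open>The model is \<open>M = L \<otimes> \<rat>\<^sub>p\<close> over \<open>A = \<rat>\<^sub>p\<close>, with \<open>A' = \<int>\<^sub>p\<close> and the lattice \<open>N = L \<otimes> \<int>\<^sub>p\<close>.\<close>

locale algebra_with_lattice = scalar_algebra A M for A :: "('b, 'n) ring_scheme" and M :: "('b, 'v, 'k) module_scheme" (structure) +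
  fixes A' :: "'b set" and N :: "'v set"
  assumes A'_subset: "A' \<subseteq> carrier A"
    and subgroup_N: "subgroup N (add_monoid M)"
    and N_mult_closed: "x \<in> N \<Longrightarrow> y \<in> N \<Longrightarrow> x \<otimes> y \<in> N"
    and N_smult_closed: "c \<in> A' \<Longrightarrow> x \<in> N \<Longrightarrow> c \<odot> x \<in> N"
begin

abbreviation "MN \<equiv> M\<lparr>carrier := N\<rparr>"

definition "\<Delta>N = {\<alpha> \<in> carrier GA. restrict \<alpha> N \<in> alg_End (A\<lparr>carrier := A'\<rparr>) MN}"
definition "\<Gamma>N = {\<alpha> \<in> carrier GA. restrict \<alpha> N \<in> alg_Aut (A\<lparr>carrier := A'\<rparr>) MN}"
definition "indexN \<alpha> = card (a_rcosets\<^bsub>MN\<^esub> (\<alpha> ` N))"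

lemma N_subset: "N \<subseteq> carrier M"
  using subgroup.subset[OF subgroup_N] by simp

lemma N_add_closed: "x \<in> N \<Longrightarrow> y \<in> N \<Longrightarrow> x \<oplus> y \<in> N"
  using subgroup.m_closed[OF subgroup_N] by simp

text \<open>The restriction inherits all homomorphism properties from \<open>\<alpha>\<close>, provided that the operations do not
lead out of \<open>N\<close>. So \<open>\<Delta>N\<close> and \<open>\<Gamma>N\<close> are described by the image of \<open>N\<close> alone.\<close>

lemma restrict_in_alg_End_iff:
  assumes "\<alpha> \<in> alg_End A M"
  shows "restrict \<alpha> N \<in> alg_End (A\<lparr>carrier := A'\<rparr>) MN \<longleftrightarrow> \<alpha> ` N \<subseteq> N"
  using alg_EndD(3-)[OF assms] N_add_closed N_mult_closed N_smult_closed N_subset A'_subset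
  unfolding alg_End_def by (auto simp: subset_iff)

lemma mem_\<Delta>N_iff: "\<alpha> \<in> \<Delta>N \<longleftrightarrow> \<alpha> \<in> carrier GA \<and> \<alpha> ` N \<subseteq> N"
  using restrict_in_alg_End_iff by (auto simp: \<Delta>N_def alg_Aut_def)

lemma mem_\<Gamma>N_iff: "\<alpha> \<in> \<Gamma>N \<longleftrightarrow> \<alpha> \<in> carrier GA \<and> \<alpha> ` N = N"
proof -
  have "inj_on \<alpha> N" if "\<alpha> \<in> carrier GA" for \<alpha>
    using that N_subset by (auto dest!: alg_AutD(2) simp: bij_betw_def intro: inj_on_subset)
  then show ?thesis
    using restrict_in_alg_End_iff unfolding \<Gamma>N_def alg_Aut_def[of _ MN]
    by (auto simp: bij_betw_def dest: alg_AutD(1))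
qed

lemma image_GA_mult: "(\<alpha> \<otimes>\<^bsub>GA\<^esub> \<beta>) ` N = \<beta> ` \<alpha> ` N"
  using N_subset by (auto simp: compose_def image_image intro!: image_cong)

lemma subgroup_\<Gamma>N: "subgroup \<Gamma>N GA"
proof (rule group.subgroupI[OF group_GA])
  interpret GA: group GA by (rule group_GA)
  have one: "\<one>\<^bsub>GA\<^esub> ` N = N" using N_subset by auto
  then show "\<Gamma>N \<noteq> {}" using GA.one_closed mem_\<Gamma>N_iff by blast
  show "\<Gamma>N \<subseteq> carrier GA" using mem_\<Gamma>N_iff by blast
  show "\<alpha> \<otimes>\<^bsub>GA\<^esub> \<beta> \<in> \<Gamma>N" if "\<alpha> \<in> \<Gamma>N" "\<beta> \<in> \<Gamma>N" for \<alpha> \<beta>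
    using that GA.m_closed[of \<alpha> \<beta>] image_GA_mult[of \<alpha> \<beta>] unfolding mem_\<Gamma>N_iff by metis
  show "inv\<^bsub>GA\<^esub> \<alpha> \<in> \<Gamma>N" if "\<alpha> \<in> \<Gamma>N" for \<alpha>
  proof -
    have \<alpha>: "\<alpha> \<in> carrier GA" "\<alpha> ` N = N" using that by (auto simp: mem_\<Gamma>N_iff)
    have "(inv\<^bsub>GA\<^esub> \<alpha>) ` \<alpha> ` N = N"
      using image_GA_mult[of \<alpha> "inv\<^bsub>GA\<^esub> \<alpha>"] GA.r_inv[OF \<alpha>(1)] one by metis
    then show ?thesis using \<alpha> GA.inv_closed mem_\<Gamma>N_iff by metis
  qed
qed

lemma \<Gamma>N_subset_\<Delta>N: "\<Gamma>N \<subseteq> \<Delta>N"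
  by (auto simp: mem_\<Gamma>N_iff mem_\<Delta>N_iff)

lemma \<Delta>N_mult_closed: "\<alpha> \<in> \<Delta>N \<Longrightarrow> \<beta> \<in> \<Delta>N \<Longrightarrow> \<alpha> \<otimes>\<^bsub>GA\<^esub> \<beta> \<in> \<Delta>N"
  using group.is_monoid[OF group_GA, THEN monoid.m_closed, of \<alpha> \<beta>] image_mono[of "\<alpha> ` N" N \<beta>]
  unfolding mem_\<Delta>N_iff image_GA_mult by (meson order_trans)

lemma add_group_MN: "comm_group (add_monoid MN)"
proof -
  have "group ((add_monoid M)\<lparr>carrier := N\<rparr>)"
    by (rule group.subgroup_imp_group[OF a_group subgroup_N])
  then have "group (add_monoid MN)" by simp
  then show ?thesis
    by (rule group.group_comm_groupI) (use N_subset a_comm in auto)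
qed

lemma \<Delta>N_hom: "\<alpha> \<in> \<Delta>N \<Longrightarrow> \<alpha> \<in> hom (add_monoid MN) (add_monoid MN)"
  using N_subset by (auto simp: mem_\<Delta>N_iff hom_def subset_iff dest!: alg_AutD(1) intro: alg_EndD(3))

lemma subgroup_image:
  assumes "\<alpha> \<in> \<Delta>N"
  shows "subgroup (\<alpha> ` N) (add_monoid MN)"
proof -
  interpret N: comm_group "add_monoid MN" by (rule add_group_MN)
  interpret group_hom "add_monoid MN" "add_monoid MN" \<alpha>
    by unfold_locales (rule \<Delta>N_hom[OF assms])
  show ?thesis using img_is_subgroup by simp
qed

lemma indexN_eq: "indexN \<alpha> = card (rcosets\<^bsub>add_monoid MN\<^esub> (\<alpha> ` N))"
  by (simp add: indexN_def A_RCOSETS_def)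

lemma indexN_mult_left: "\<gamma> \<in> \<Gamma>N \<Longrightarrow> indexN (\<gamma> \<otimes>\<^bsub>GA\<^esub> \<alpha>) = indexN \<alpha>"
  unfolding indexN_def image_GA_mult by (simp add: mem_\<Gamma>N_iff)

text \<open>Since \<open>\<gamma>\<close> permutes \<open>N\<close>, it maps the cosets of \<open>\<alpha> ` N\<close> bijectively to those of \<open>\<gamma> ` \<alpha> ` N\<close>. For
a factor on the left the image of \<open>N\<close> does not change at all.\<close>

lemma indexN_mult_right:
  assumes "\<alpha> \<in> \<Delta>N" "\<gamma> \<in> \<Gamma>N"
  shows "indexN (\<alpha> \<otimes>\<^bsub>GA\<^esub> \<gamma>) = indexN \<alpha>"
  unfolding indexN_eq image_GA_mult
proof (rule group.card_rcosets_image)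
  show "group (add_monoid MN)" using add_group_MN by (simp add: comm_group_def)
  show "\<gamma> \<in> hom (add_monoid MN) (add_monoid MN)" using \<Delta>N_hom \<Gamma>N_subset_\<Delta>N assms by blast
  show "bij_betw \<gamma> (carrier (add_monoid MN)) (carrier (add_monoid MN))"
    using assms(2) N_subset by (auto simp: mem_\<Gamma>N_iff bij_betw_def dest!: alg_AutD(2) intro: inj_on_subset)
  show "\<alpha> ` N \<subseteq> carrier (add_monoid MN)" using assms by (simp add: mem_\<Delta>N_iff)
qed

lemma indexN_eq_1_iff: "\<alpha> \<in> \<Delta>N \<Longrightarrow> indexN \<alpha> = 1 \<longleftrightarrow> \<alpha> \<in> \<Gamma>N"
  using group.card_rcosets_eq_1_iff[OF comm_group.axioms(2)[OF add_group_MN] subgroup_image, of \<alpha>]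
  by (simp add: indexN_eq mem_\<Gamma>N_iff mem_\<Delta>N_iff)

end

section \<open>The p-adic numbers\<close>

text \<open>The absolute value can be computed from any representation as a quotient of integers, not only the
reduced one.\<close>

lemma padic_abs_quotient:
  fixes a b :: int
  assumes p: "prime p" and a: "a \<noteq> 0" and b: "b \<noteq> 0"
  shows "padic_abs p (of_int a / of_int b) =
    real p powi (int (multiplicity (int p) b) - int (multiplicity (int p) a))"
proof -
  define x where "x = (of_int a / of_int b :: rat)"
  obtain n d where nd: "quotient_of x = (n, d)" by (cases "quotient_of x")
  have d: "d > 0" using quotient_of_denom_pos[OF nd] .
  have x: "x = of_int n / of_int d" using quotient_of_div[OF nd] .
  have x0: "x \<noteq> 0" using a b by (simp add: x_def)
  then have n: "n \<noteq> 0" using x by auto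
  have "(of_int (a * d) :: rat) = of_int (n * b)"
    using x x_def b d by (simp add: field_simps)
  then have eq: "a * d = n * b" by (simp only: of_int_eq_iff)
  have "prime_elem (int p)" using p by simp
  then have "multiplicity (int p) a + multiplicity (int p) d = multiplicity (int p) n + multiplicity (int p) b"
    using eq prime_elem_multiplicity_mult_distrib[of "int p"] a b n d by (metis less_irrefl)
  then have "int (multiplicity (int p) d) - int (multiplicity (int p) n) =
      int (multiplicity (int p) b) - int (multiplicity (int p) a)" by linarith
  then show ?thesis using x0 nd by (simp add: padic_abs_def x_def[symmetric])
qed

lemma rat_common_denominator:
  obtains a b d :: int where "(x :: rat) = of_int a / of_int d" "(y :: rat) = of_int b / of_int d" "d \<noteq> 0"
proof -
  obtain a c where x: "quotient_of x = (a, c)" by (cases "quotient_of x")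
  obtain b e where y: "quotient_of y = (b, e)" by (cases "quotient_of y")
  have "c > 0" "e > 0" using quotient_of_denom_pos x y by auto
  then have "x = of_int (a * e) / of_int (c * e)" "y = of_int (b * c) / of_int (c * e)" "c * e \<noteq> 0"
    using quotient_of_div[OF x] quotient_of_div[OF y] by (simp_all add: field_simps)
  then show thesis by (rule that)
qed

context
  fixes p :: nat
  assumes p: "prime p"
begin

lemma padic_abs_0 [simp]: "padic_abs p 0 = 0"
  by (simp add: padic_abs_def)

lemma padic_abs_pos: "x \<noteq> 0 \<Longrightarrow> padic_abs p x > 0"
  using prime_gt_0_nat[OF p] by (simp add: padic_abs_def)

lemma padic_abs_nonneg [simp]: "padic_abs p x \<ge> 0"
  using padic_abs_pos[of x] by (cases "x = 0") auto

lemma padic_abs_mult: "padic_abs p (x * y) = padic_abs p x * padic_abs p y"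
proof (cases "x = 0 \<or> y = 0")
  case False
  obtain a b d where xy: "x = of_int a / of_int d" "y = of_int b / of_int d" "d \<noteq> (0::int)"
    by (rule rat_common_denominator)
  then have ab: "a \<noteq> 0" "b \<noteq> 0" using False by auto
  have "x * y = of_int (a * b) / of_int (d * d)" using xy by simp
  moreover have "prime_elem (int p)" using p by simp
  ultimately show ?thesis
    using padic_abs_quotient[OF p, of "a * b" "d * d"] padic_abs_quotient[OF p, of a d] padic_abs_quotient[OF p, of b d]
      xy ab prime_gt_0_nat[OF p]
    by (simp add: prime_elem_multiplicity_mult_distrib power_int_add[symmetric] algebra_simps)
qed auto

lemma padic_abs_minus [simp]: "padic_abs p (- x) = padic_abs p x"
proof -
  have "padic_abs p (-1) = 1" using padic_abs_quotient[OF p, of "-1" 1] multiplicity_unit_right[of "-1" "int p"] by simp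
  then show ?thesis using padic_abs_mult[of "-1" x] by simp
qed

text \<open>Over a common denominator this is the statement that a power of \<open>p\<close> dividing two integers divides
their sum.\<close>

lemma padic_abs_add: "padic_abs p (x + y) \<le> max (padic_abs p x) (padic_abs p y)"
proof (cases "x = 0 \<or> y = 0 \<or> x + y = 0")
  case True
  then show ?thesis by (auto simp: max_def)
next
  case False
  obtain a b d where xy: "x = of_int a / of_int d" "y = of_int b / of_int d" "d \<noteq> (0::int)"
    by (rule rat_common_denominator)
  let ?v = "multiplicity (int p)"
  have sum: "x + y = of_int (a + b) / of_int d" using xy by (simp add: field_simps)
  have ab: "a \<noteq> 0" "b \<noteq> 0" "a + b \<noteq> 0" using False xy sum by auto
  have "int p ^ min (?v a) (?v b) dvd a + b"
    by (intro dvd_add) (auto intro: multiplicity_dvd')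
  then have "min (?v a) (?v b) \<le> ?v (a + b)"
    using p ab by (intro multiplicity_geI) auto
  then have "int (?v d) - int (?v (a + b)) \<le> int (?v d) - int (?v a) \<or>
      int (?v d) - int (?v (a + b)) \<le> int (?v d) - int (?v b)" by linarith
  moreover have "real p \<ge> 1" using prime_gt_0_nat[OF p] by simp
  ultimately have "padic_abs p (x + y) \<le> padic_abs p x \<or> padic_abs p (x + y) \<le> padic_abs p y"
    unfolding sum padic_abs_quotient[OF p ab(3) xy(3)] unfolding xy padic_abs_quotient[OF p ab(1) xy(3)] padic_abs_quotient[OF p ab(2) xy(3)]
    by (metis power_int_increasing)
  then show ?thesis by (auto simp: max_def)
qed

lemma padic_abs_diff: "padic_abs p (x - y) \<le> max (padic_abs p x) (padic_abs p y)"
  using padic_abs_add[of x "-y"] by simp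

text \<open>A prime \<open>q \<noteq> p\<close> is a \<open>p\<close>-adic unit.\<close>

lemma padic_abs_divide_coprime:
  assumes q: "prime q" "q \<noteq> p"
  shows "padic_abs p (x / of_nat q) = padic_abs p x"
proof -
  have "multiplicity (int p) (int q) = 0"
    using p q primes_dvd_imp_eq by (intro not_dvd_imp_multiplicity_0) auto
  then have "padic_abs p (1 / of_nat q) = 1"
    using padic_abs_quotient[OF p, of 1 "int q"] q prime_gt_0_nat by force
  then show ?thesis using padic_abs_mult[of x "1 / of_nat q"] by simp
qed

lemma padic_abs_squeeze:
  assumes "\<And>n. padic_abs p (x n) \<le> b n" "b \<longlonglongrightarrow> 0"
  shows "(\<lambda>n. padic_abs p (x n)) \<longlonglongrightarrow> 0"
  by (rule tendsto_sandwich[where f = "\<lambda>n. 0" and h = b]) (use assms in auto)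

lemma padic_cauchyI:
  assumes "\<And>e. e > 0 \<Longrightarrow> \<exists>N. \<forall>m\<ge>N. \<forall>n\<ge>N. padic_abs p (x m - x n) < e"
  shows "padic_cauchy p x"
  using assms by (auto simp: padic_cauchy_def)

lemma padic_cauchy_bounded:
  assumes "padic_cauchy p x"
  obtains B where "B > 0" "\<And>n. padic_abs p (x n) \<le> B"
proof -
  obtain N where N: "\<And>m n. m \<ge> N \<Longrightarrow> n \<ge> N \<Longrightarrow> padic_abs p (x m - x n) < 1"
    using assms unfolding padic_cauchy_def by (meson zero_less_one)
  \<comment> \<open>later terms differ from \<open>x N\<close> by less than 1\<close>
  let ?B = "1 + (\<Sum>n\<le>N. padic_abs p (x n))"
  have le: "padic_abs p (x n) \<le> ?B" if "n \<le> N" for n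
    using member_le_sum[of n "{..N}" "\<lambda>n. padic_abs p (x n)"] that by simp
  have "padic_abs p (x n) \<le> ?B" for n
  proof (cases "n \<le> N")
    case False
    then have "padic_abs p (x n - x N) < 1" using N[of n N] by simp
    then show ?thesis using padic_abs_add[of "x n - x N" "x N"] le[of N] sum_nonneg[of "{..N}" "\<lambda>n. padic_abs p (x n)"] by auto
  qed (rule le)
  moreover have "?B > 0" using sum_nonneg[of "{..N}" "\<lambda>n. padic_abs p (x n)"] by auto
  ultimately show thesis using that by blast
qed

lemma padic_cauchy_add:
  assumes "padic_cauchy p x" "padic_cauchy p y"
  shows "padic_cauchy p (\<lambda>n. x n + y n)"
proof (rule padic_cauchyI)
  fix e :: real assume "e > 0"
  then obtain M N where MN: "\<And>m n. m \<ge> M \<Longrightarrow> n \<ge> M \<Longrightarrow> padic_abs p (x m - x n) < e"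
      "\<And>m n. m \<ge> N \<Longrightarrow> n \<ge> N \<Longrightarrow> padic_abs p (y m - y n) < e"
    using assms unfolding padic_cauchy_def by metis
  have "padic_abs p (x m + y m - (x n + y n)) < e" if "m \<ge> max M N" "n \<ge> max M N" for m n
    using MN[of m n] that padic_abs_add[of "x m - x n" "y m - y n"] by (simp add: algebra_simps)
  then show "\<exists>N. \<forall>m\<ge>N. \<forall>n\<ge>N. padic_abs p (x m + y m - (x n + y n)) < e" by blast
qed

text \<open>As usual, \<open>x\<^sub>m y\<^sub>m - x\<^sub>n y\<^sub>n = x\<^sub>m (y\<^sub>m - y\<^sub>n) + (x\<^sub>m - x\<^sub>n) y\<^sub>n\<close>, and Cauchy sequences are bounded.\<close>

lemma padic_cauchy_mult:
  assumes x: "padic_cauchy p x" and y: "padic_cauchy p y"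
  shows "padic_cauchy p (\<lambda>n. x n * y n)"
proof (rule padic_cauchyI)
  fix e :: real assume e: "e > 0"
  obtain B where B: "B > 0" "\<And>n. padic_abs p (x n) \<le> B" using padic_cauchy_bounded[OF x] by blast
  obtain C where C: "C > 0" "\<And>n. padic_abs p (y n) \<le> C" using padic_cauchy_bounded[OF y] by blast
  have "e / C > 0" "e / B > 0" using e B C by auto
  then obtain M N where MN: "\<And>m n. m \<ge> M \<Longrightarrow> n \<ge> M \<Longrightarrow> padic_abs p (x m - x n) < e / C"
      "\<And>m n. m \<ge> N \<Longrightarrow> n \<ge> N \<Longrightarrow> padic_abs p (y m - y n) < e / B"
    using x y unfolding padic_cauchy_def by metis
  have "padic_abs p (x m * y m - x n * y n) < e" if mn: "m \<ge> max M N" "n \<ge> max M N" for m n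
  proof -
    have "padic_abs p (x m * (y m - y n)) \<le> B * padic_abs p (y m - y n)"
      using B by (simp add: padic_abs_mult mult_right_mono)
    also have "\<dots> < e" using MN(2)[of m n] mn B by (simp add: field_simps)
    finally have 1: "padic_abs p (x m * (y m - y n)) < e" .
    have "padic_abs p ((x m - x n) * y n) \<le> padic_abs p (x m - x n) * C"
      using C by (simp add: padic_abs_mult mult_left_mono)
    also have "\<dots> < e" using MN(1)[of m n] mn C by (simp add: field_simps)
    finally have 2: "padic_abs p ((x m - x n) * y n) < e" .
    have "x m * y m - x n * y n = x m * (y m - y n) + (x m - x n) * y n" by (simp add: algebra_simps)
    then show ?thesis using 1 2 padic_abs_add[of "x m * (y m - y n)" "(x m - x n) * y n"] by simp
  qed
  then show "\<exists>N. \<forall>m\<ge>N. \<forall>n\<ge>N. padic_abs p (x m * y m - x n * y n) < e" by blast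
qed

lemma padic_cauchy_const: "padic_cauchy p (\<lambda>n. c)"
  by (simp add: padic_cauchy_def)

lemma padic_cauchy_minus: "padic_cauchy p x \<Longrightarrow> padic_cauchy p (\<lambda>n. - x n)"
  using padic_cauchy_mult[OF padic_cauchy_const[of "-1"]] by simp

lemma padic_cauchy_ring_cring: "cring (padic_cauchy_ring p)"
proof (rule cringI)
  show "abelian_group (padic_cauchy_ring p)"
  proof (rule abelian_groupI)
    fix x assume "x \<in> carrier (padic_cauchy_ring p)"
    then show "\<exists>y\<in>carrier (padic_cauchy_ring p). y \<oplus>\<^bsub>padic_cauchy_ring p\<^esub> x = \<zero>\<^bsub>padic_cauchy_ring p\<^esub>"
      by (intro bexI[of _ "\<lambda>n. - x n"]) (auto simp: padic_cauchy_ring_def padic_cauchy_minus)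
  qed (auto simp: padic_cauchy_ring_def padic_cauchy_add padic_cauchy_const algebra_simps)
  show "comm_monoid (padic_cauchy_ring p)"
    by (rule comm_monoidI) (auto simp: padic_cauchy_ring_def padic_cauchy_mult padic_cauchy_const algebra_simps)
qed (auto simp: padic_cauchy_ring_def algebra_simps)

lemma padic_null_ideal: "ideal {x. (\<lambda>n. padic_abs p (x n)) \<longlonglongrightarrow> 0} (padic_cauchy_ring p)"
  (is "ideal ?N ?R")
proof -
  interpret R: cring ?R by (rule padic_cauchy_ring_cring)
  have add: "(\<lambda>n. x n + y n) \<in> ?N" if "x \<in> ?N" "y \<in> ?N" for x y
  proof -
    have "(\<lambda>n. max (padic_abs p (x n)) (padic_abs p (y n))) \<longlonglongrightarrow> max 0 0"
      using that by (intro tendsto_max) auto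
    then have "(\<lambda>n. max (padic_abs p (x n)) (padic_abs p (y n))) \<longlonglongrightarrow> 0" by simp
    then have "(\<lambda>n. padic_abs p (x n + y n)) \<longlonglongrightarrow> 0"
      by (rule padic_abs_squeeze[OF padic_abs_add])
    then show ?thesis by simp
  qed
  have cauchy: "padic_cauchy p x" if x: "x \<in> ?N" for x
  proof (rule padic_cauchyI)
    fix e :: real assume "e > 0"
    then obtain N where N: "\<And>n. n \<ge> N \<Longrightarrow> padic_abs p (x n) < e"
      using x order_tendstoD(2)[of "\<lambda>n. padic_abs p (x n)" 0 sequentially e] by (auto simp: eventually_sequentially)
    have "padic_abs p (x m - x n) < e" if "m \<ge> N" "n \<ge> N" for m n
      using N[of m] N[of n] that padic_abs_diff[of "x m" "x n"] by auto
    then show "\<exists>N. \<forall>m\<ge>N. \<forall>n\<ge>N. padic_abs p (x m - x n) < e" by blast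
  qed
  have mult: "(\<lambda>n. x n * y n) \<in> ?N" if x: "padic_cauchy p x" and y: "y \<in> ?N" for x y
  proof -
    obtain B where B: "B > 0" "\<And>n. padic_abs p (x n) \<le> B" using padic_cauchy_bounded[OF x] by blast
    have le: "padic_abs p (x n * y n) \<le> B * padic_abs p (y n)" for n
      using B(2) by (simp add: padic_abs_mult mult_right_mono)
    have "(\<lambda>n. B * padic_abs p (y n)) \<longlonglongrightarrow> 0"
      using tendsto_mult_right_zero[of "\<lambda>n. padic_abs p (y n)" sequentially B] y by simp
    then have "(\<lambda>n. padic_abs p (x n * y n)) \<longlonglongrightarrow> 0"
      by (rule padic_abs_squeeze[OF le])
    then show ?thesis by simp
  qed
  have "subgroup ?N (add_monoid ?R)"
  proof (rule group.subgroupI)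
    show "group (add_monoid ?R)" by (rule R.a_group)
    show "?N \<noteq> {}" by (auto intro!: exI[of _ "\<lambda>n. 0"])
    show "?N \<subseteq> carrier (add_monoid ?R)" using cauchy by (auto simp: padic_cauchy_ring_def)
    show "x \<otimes>\<^bsub>add_monoid ?R\<^esub> y \<in> ?N" if "x \<in> ?N" "y \<in> ?N" for x y
      using add[OF that] by (simp add: padic_cauchy_ring_def)
    show "inv\<^bsub>add_monoid ?R\<^esub> x \<in> ?N" if "x \<in> ?N" for x
    proof -
      have "inv\<^bsub>add_monoid ?R\<^esub> x = (\<lambda>n. - x n)"
        by (rule group.inv_equality[OF R.a_group])
          (use that cauchy[OF that] in \<open>auto simp: padic_cauchy_ring_def padic_cauchy_minus\<close>)
      then show ?thesis using that by simp
    qed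
  qed
  moreover have "(\<lambda>n. y n * x n) \<in> ?N" if "padic_cauchy p x" "y \<in> ?N" for x y
    using mult[OF that] by (simp add: mult.commute)
  ultimately show ?thesis
    by (intro idealI R.ring_axioms) (use mult in \<open>auto simp: padic_cauchy_ring_def\<close>)
qed

lemma Qp_cring: "cring (Qp p)"
  unfolding Qp_def by (rule ideal.quotient_is_cring[OF padic_null_ideal padic_cauchy_ring_cring])

text \<open>The \<open>p\<close>-adic number represented by a Cauchy sequence.\<close>

definition padic_class :: "(nat \<Rightarrow> rat) \<Rightarrow> padic" where
  "padic_class x = {x. (\<lambda>n. padic_abs p (x n)) \<longlonglongrightarrow> 0} +>\<^bsub>padic_cauchy_ring p\<^esub> x"

lemma padic_class_hom: "padic_class \<in> ring_hom (padic_cauchy_ring p) (Qp p)"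
  unfolding Qp_def padic_class_def using ideal.rcos_ring_hom[OF padic_null_ideal] .

text \<open>A coset of the null sequences that contains a sequence of \<open>p\<close>-adic integers is the class of this
sequence.\<close>

lemma mem_Zp_iff:
  "X \<in> carrier (Zp p) \<longleftrightarrow> (\<exists>x. padic_cauchy p x \<and> (\<forall>n. padic_abs p (x n) \<le> 1) \<and> X = padic_class x)"
    (is "?L \<longleftrightarrow> ?R")
proof
  interpret I: ideal "{x. (\<lambda>n. padic_abs p (x n)) \<longlonglongrightarrow> 0}" "padic_cauchy_ring p" by (rule padic_null_ideal)
  have carrier: "carrier (Qp p) = padic_class ` {x. padic_cauchy p x}"
    by (auto simp: Qp_def FactRing_def A_RCOSETS_def RCOSETS_def padic_class_def a_r_coset_def padic_cauchy_ring_def)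
  show ?R if L: ?L
  proof -
    obtain x y where x: "padic_cauchy p y" "X = padic_class y" "x \<in> X" "\<And>n. padic_abs p (x n) \<le> 1"
      using L carrier by (auto simp: Zp_def)
    have "x \<in> carrier (padic_cauchy_ring p)"
      using x I.a_elemrcos_carrier[of y x] by (simp add: padic_class_def padic_cauchy_ring_def)
    moreover have "padic_class x = X"
      using x I.a_repr_independence[OF _ _ I.a_subgroup, of x y] by (simp add: padic_class_def padic_cauchy_ring_def)
    ultimately show ?R using x by (auto simp: padic_cauchy_ring_def)
  qed
  show ?L if R: ?R
  proof -
    obtain x where x: "padic_cauchy p x" "\<And>n. padic_abs p (x n) \<le> 1" "X = padic_class x" using R by blast
    then have "x \<in> X" using I.a_rcos_self[of x] by (simp add: padic_class_def padic_cauchy_ring_def)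
    then show ?L using x carrier by (auto simp: Zp_def)
  qed
qed

lemma Zp_subset_Qp: "carrier (Zp p) \<subseteq> carrier (Qp p)"
  by (auto simp: Zp_def)

lemma Zp_mult_closed:
  assumes "a \<in> carrier (Zp p)" "b \<in> carrier (Zp p)"
  shows "a \<otimes>\<^bsub>Qp p\<^esub> b \<in> carrier (Zp p)"
proof -
  obtain x y where x: "padic_cauchy p x" "\<And>n. padic_abs p (x n) \<le> 1" "a = padic_class x"
    and y: "padic_cauchy p y" "\<And>n. padic_abs p (y n) \<le> 1" "b = padic_class y"
    using assms unfolding mem_Zp_iff by blast
  have "a \<otimes>\<^bsub>Qp p\<^esub> b = padic_class (\<lambda>n. x n * y n)"
    using ring_hom_mult[OF padic_class_hom, of x y] x y by (simp add: padic_cauchy_ring_def)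
  moreover have "padic_abs p (x n * y n) \<le> 1" for n
    using x(2)[of n] y(2)[of n] by (simp add: padic_abs_mult mult_le_one)
  ultimately show ?thesis
    using padic_cauchy_mult[OF x(1) y(1)] unfolding mem_Zp_iff by blast
qed

text \<open>The terms of a representing sequence are divided by \<open>q\<close>, which changes no absolute value.\<close>

lemma Zp_divisible_coprime:
  assumes q: "prime q" "q \<noteq> p" and a: "a \<in> carrier (Zp p)"
  obtains b where "b \<in> carrier (Zp p)" "a = add_pow (Qp p) q b"
proof -
  interpret cring "Qp p" by (rule Qp_cring)
  obtain x where x: "padic_cauchy p x" "\<And>n. padic_abs p (x n) \<le> 1" "a = padic_class x"
    using a unfolding mem_Zp_iff by blast
  define y where "y n = x n / of_nat q" for n
  have cauchy: "padic_cauchy p (\<lambda>n. of_nat k * y n)" for k :: nat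
    using padic_cauchy_mult[OF padic_cauchy_const[of "of_nat k / of_nat q"] x(1)] by (simp add: y_def)
  have y: "padic_cauchy p y" using cauchy[of 1] by simp
  have mult: "padic_class (\<lambda>n. of_nat k * y n) = add_pow (Qp p) k (padic_class y)" for k :: nat
  proof (induction k)
    case 0
    have "padic_class (\<lambda>n. 0) = \<zero>\<^bsub>Qp p\<^esub>"
      using ring_hom_zero[OF padic_class_hom cring.axioms(1)[OF padic_cauchy_ring_cring] ring_axioms]
      by (simp add: padic_cauchy_ring_def)
    then show ?case by (simp add: add_pow_def)
  next
    case (Suc k)
    have "padic_class (\<lambda>n. of_nat k * y n + y n) = padic_class (\<lambda>n. of_nat k * y n) \<oplus>\<^bsub>Qp p\<^esub> padic_class y"
      using ring_hom_add[OF padic_class_hom, of "\<lambda>n. of_nat k * y n" y] cauchy y by (simp add: padic_cauchy_ring_def)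
    then show ?case using Suc by (simp add: algebra_simps add_pow_def)
  qed
  have "of_nat q * y n = x n" for n using q prime_gt_0_nat by (simp add: y_def)
  then have "a = add_pow (Qp p) q (padic_class y)" using mult[of q] x(3) by simp
  moreover have "padic_class y \<in> carrier (Zp p)"
    unfolding mem_Zp_iff using y x(2) padic_abs_divide_coprime[OF q] by (auto simp: y_def)
  ultimately show thesis using that by blast
qed

end

section \<open>Extension of scalars of an algebra\<close>

lemma frag_extend_plus: "frag_extend (\<lambda>x. u x + v x) f = frag_extend u f + frag_extend v f"
  by (simp add: frag_extend_def frag_cmul_distrib2 sum.distrib)

text \<open>\<open>tensor_mult\<close> and \<open>tensor_smult\<close> are the operations of \<^const>\<open>tensor_algebra\<close> on representatives in
the free abelian group on pairs.\<close>

definition tensor_mult ::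
    "('a, 'm) ring_scheme \<Rightarrow> ('b, 'n) ring_scheme \<Rightarrow> ('a \<times> 'b \<Rightarrow>\<^sub>0 int) \<Rightarrow> ('a \<times> 'b \<Rightarrow>\<^sub>0 int) \<Rightarrow> ('a \<times> 'b \<Rightarrow>\<^sub>0 int)" where
  "tensor_mult L A f g = frag_extend (\<lambda>(x, a). frag_extend (\<lambda>(y, b). frag_of (x \<otimes>\<^bsub>L\<^esub> y, a \<otimes>\<^bsub>A\<^esub> b)) g) f"

definition tensor_smult ::
    "('b, 'n) ring_scheme \<Rightarrow> 'b \<Rightarrow> ('a \<times> 'b \<Rightarrow>\<^sub>0 int) \<Rightarrow> ('a \<times> 'b \<Rightarrow>\<^sub>0 int)" where
  "tensor_smult A c f = frag_extend (\<lambda>(x, a). frag_of (x, c \<otimes>\<^bsub>A\<^esub> a)) f"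

lemma tensor_mult_add_left: "tensor_mult L A (f + f') g = tensor_mult L A f g + tensor_mult L A f' g"
  by (simp add: tensor_mult_def frag_extend_add)

lemma tensor_mult_add_right: "tensor_mult L A f (g + g') = tensor_mult L A f g + tensor_mult L A f g'"
  by (simp add: tensor_mult_def frag_extend_add case_prod_unfold frag_extend_plus)

lemma tensor_mult_zero [simp]: "tensor_mult L A 0 g = 0" "tensor_mult L A f 0 = 0"
  by (auto simp: tensor_mult_def intro: frag_extend_eq_0)

lemma tensor_mult_minus_left: "tensor_mult L A (- f) g = - tensor_mult L A f g"
  using tensor_mult_add_left[of L A "- f" f g] by (simp add: eq_neg_iff_add_eq_0)

lemma tensor_mult_minus_right: "tensor_mult L A f (- g) = - tensor_mult L A f g"
  using tensor_mult_add_right[of L A f "- g" g] by (simp add: eq_neg_iff_add_eq_0)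

lemma tensor_mult_diff_left: "tensor_mult L A (f - f') g = tensor_mult L A f g - tensor_mult L A f' g"
  using tensor_mult_add_left[of L A f "- f'" g] by (simp add: tensor_mult_minus_left)

lemma tensor_mult_diff_right: "tensor_mult L A f (g - g') = tensor_mult L A f g - tensor_mult L A f g'"
  using tensor_mult_add_right[of L A f g "- g'"] by (simp add: tensor_mult_minus_right)

lemma tensor_mult_frag_of [simp]:
  "tensor_mult L A (frag_of (x, a)) (frag_of (y, b)) = frag_of (x \<otimes>\<^bsub>L\<^esub> y, a \<otimes>\<^bsub>A\<^esub> b)"
  by (simp add: tensor_mult_def)

lemma tensor_smult_add: "tensor_smult A c (f + f') = tensor_smult A c f + tensor_smult A c f'"
  by (simp add: tensor_smult_def frag_extend_add)

lemma tensor_smult_diff: "tensor_smult A c (f - f') = tensor_smult A c f - tensor_smult A c f'"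
  by (simp add: tensor_smult_def frag_extend_diff)

lemma tensor_smult_frag_of [simp]: "tensor_smult A c (frag_of (x, a)) = frag_of (x, c \<otimes>\<^bsub>A\<^esub> a)"
  by (simp add: tensor_smult_def)

locale scalar_extension = L: biadditive_algebra L + A: ring A
  for L :: "('a, 'm) ring_scheme" and A :: "('b, 'n) ring_scheme"
begin

abbreviation "pairs \<equiv> carrier L \<times> carrier A"
abbreviation "\<tau> \<equiv> tensor_class L A"
abbreviation "M \<equiv> tensor_algebra L A"

definition relators :: "('a \<times> 'b \<Rightarrow>\<^sub>0 int) set" where
  "relators = {frag_of (x \<oplus>\<^bsub>L\<^esub> y, a) - frag_of (x, a) - frag_of (y, a) | x y a.
         x \<in> carrier L \<and> y \<in> carrier L \<and> a \<in> carrier A} \<union>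
      {frag_of (x, a \<oplus>\<^bsub>A\<^esub> b) - frag_of (x, a) - frag_of (x, b) | x a b.
         x \<in> carrier L \<and> a \<in> carrier A \<and> b \<in> carrier A}"

lemma tensor_rel_eq: "tensor_rel L A = generate (tensor_free L A) relators"
  by (simp add: tensor_rel_def relators_def)

lemma relators_keys: "r \<in> relators \<Longrightarrow> Poly_Mapping.keys r \<subseteq> pairs"
  by (auto simp: relators_def keys_frag_of split: if_splits dest!: subsetD[OF keys_diff])

sublocale free: comm_group "tensor_free L A"
  unfolding tensor_free_def by (rule abelian_free_Abelian_group)

lemma mem_tensor_free: "f \<in> carrier (tensor_free L A) \<longleftrightarrow> Poly_Mapping.keys f \<subseteq> pairs"
  by (simp add: tensor_free_def)

lemma tensor_free_simps [simp]:
  "f \<otimes>\<^bsub>tensor_free L A\<^esub> g = f + g" "\<one>\<^bsub>tensor_free L A\<^esub> = 0"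
  by (simp_all add: tensor_free_def)

lemma inv_tensor_free [simp]: "f \<in> carrier (tensor_free L A) \<Longrightarrow> inv\<^bsub>tensor_free L A\<^esub> f = - f"
  by (simp add: tensor_free_def)

lemma relators_carrier: "relators \<subseteq> carrier (tensor_free L A)"
  using relators_keys by (auto simp: mem_tensor_free)

lemma subgroup_rel: "subgroup (tensor_rel L A) (tensor_free L A)"
  unfolding tensor_rel_eq by (rule free.generate_is_subgroup[OF relators_carrier])

sublocale rel: normal "tensor_rel L A" "tensor_free L A"
  by (rule free.subgroup_imp_normal[OF subgroup_rel])

lemma relators_rel: "r \<in> relators \<Longrightarrow> r \<in> tensor_rel L A"
  unfolding tensor_rel_eq by (rule generate.incl)

lemma rel_add: "r \<in> tensor_rel L A \<Longrightarrow> s \<in> tensor_rel L A \<Longrightarrow> r + s \<in> tensor_rel L A"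
  using rel.m_closed by simp

lemma rel_minus: "r \<in> tensor_rel L A \<Longrightarrow> - r \<in> tensor_rel L A"
  using rel.m_inv_closed rel.subset by (metis inv_tensor_free subsetD)

lemma rel_diff: "r \<in> tensor_rel L A \<Longrightarrow> s \<in> tensor_rel L A \<Longrightarrow> r - s \<in> tensor_rel L A"
  using rel_add[of r "- s"] rel_minus by simp

lemma rel_zero: "0 \<in> tensor_rel L A"
  using rel.one_closed by simp

lemma free_induct [consumes 1, case_names zero diff gen]:
  assumes "f \<in> carrier (tensor_free L A)" "P 0"
    "\<And>f g. P f \<Longrightarrow> P g \<Longrightarrow> P (f - g)"
    "\<And>x a. x \<in> carrier L \<Longrightarrow> a \<in> carrier A \<Longrightarrow> P (frag_of (x, a))"
  shows "P f"
  using assms(1) unfolding mem_tensor_free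
  by (rule free_Abelian_group_induct) (use assms in auto)

lemma rel_induct [consumes 1, case_names zero add minus relator]:
  assumes "r \<in> tensor_rel L A" "P 0" "\<And>f g. P f \<Longrightarrow> P g \<Longrightarrow> P (f + g)"
    "\<And>f. P f \<Longrightarrow> P (- f)" "\<And>r. r \<in> relators \<Longrightarrow> P r"
  shows "P r"
  using assms(1) unfolding tensor_rel_eq
proof induction
  case (inv h)
  then have "inv\<^bsub>tensor_free L A\<^esub> h = - h" using relators_carrier by auto
  then show ?case using assms(4,5) inv by simp
qed (use assms in auto)

lemma tensor_mult_closed:
  assumes "f \<in> carrier (tensor_free L A)" "g \<in> carrier (tensor_free L A)"
  shows "tensor_mult L A f g \<in> carrier (tensor_free L A)"
  using assms(1)
proof (induction rule: free_induct)
  case zero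
  then show ?case by (simp add: mem_tensor_free)
next
  case (diff f f')
  then show ?case
    by (auto simp: tensor_mult_diff_left mem_tensor_free dest: subsetD[OF keys_diff])
next
  case (gen x a)
  show ?case
    using assms(2)
  proof (induction rule: free_induct)
    case (gen y b)
    then show ?case using \<open>x \<in> carrier L\<close> \<open>a \<in> carrier A\<close> by (simp add: mem_tensor_free L.mult_closed)
  qed (auto simp: tensor_mult_diff_right mem_tensor_free dest: subsetD[OF keys_diff])
qed

lemma tensor_smult_closed:
  assumes "f \<in> carrier (tensor_free L A)" "c \<in> carrier A"
  shows "tensor_smult A c f \<in> carrier (tensor_free L A)"
  using assms(1)
proof (induction rule: free_induct)
  case zero
  then show ?case by (simp add: tensor_smult_def mem_tensor_free)
qed (use assms(2) in \<open>auto simp: tensor_smult_diff mem_tensor_free dest: subsetD[OF keys_diff]\<close>)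

lemma relatorI:
  "x \<in> carrier L \<Longrightarrow> y \<in> carrier L \<Longrightarrow> a \<in> carrier A \<Longrightarrow>
    frag_of (x \<oplus>\<^bsub>L\<^esub> y, a) - frag_of (x, a) - frag_of (y, a) \<in> tensor_rel L A"
  "x \<in> carrier L \<Longrightarrow> a \<in> carrier A \<Longrightarrow> b \<in> carrier A \<Longrightarrow>
    frag_of (x, a \<oplus>\<^bsub>A\<^esub> b) - frag_of (x, a) - frag_of (x, b) \<in> tensor_rel L A"
  by (rule relators_rel, unfold relators_def, blast)+

text \<open>By bi-additivity it suffices to multiply a single relator by a single generator. The distributive
laws of \<open>L\<close> and \<open>A\<close> turn the result into another relator. Together with the same argument on the right
this makes the product of the tensor algebra well-defined.\<close>

lemma tensor_mult_rel_left:
  assumes r: "r \<in> tensor_rel L A" and g: "g \<in> carrier (tensor_free L A)"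
  shows "tensor_mult L A r g \<in> tensor_rel L A"
  using r
proof (induction rule: rel_induct)
  case (relator r)
  show ?case
    using g
  proof (induction rule: free_induct)
    case (gen z c)
    from relator show ?case
      unfolding relators_def using gen relatorI
      by (auto simp: tensor_mult_diff_left L.mult_l_distr A.l_distr L.mult_closed)
  qed (auto simp: tensor_mult_diff_right rel_zero rel_diff)
qed (auto simp: tensor_mult_add_left tensor_mult_minus_left rel_zero rel_add rel_minus)

lemma tensor_mult_rel_right:
  assumes r: "r \<in> tensor_rel L A" and f: "f \<in> carrier (tensor_free L A)"
  shows "tensor_mult L A f r \<in> tensor_rel L A"
  using r
proof (induction rule: rel_induct)
  case (relator r)
  show ?case
    using f
  proof (induction rule: free_induct)
    case (gen z c)
    from relator show ?case
      unfolding relators_def using gen relatorI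
      by (auto simp: tensor_mult_diff_right L.mult_r_distr A.r_distr L.mult_closed)
  qed (auto simp: tensor_mult_diff_left rel_zero rel_diff)
qed (auto simp: tensor_mult_add_right tensor_mult_minus_right rel_zero rel_add rel_minus)

lemma tensor_smult_rel:
  assumes r: "r \<in> tensor_rel L A" and c: "c \<in> carrier A"
  shows "tensor_smult A c r \<in> tensor_rel L A"
  using r
proof (induction rule: rel_induct)
  case (relator r)
  then show ?case
    unfolding relators_def using c relatorI
    by (auto simp: tensor_smult_diff A.r_distr)
next
  case (minus f)
  then show ?case using rel_minus by (simp add: tensor_smult_def frag_extend_minus)
qed (auto simp: tensor_smult_add rel_add, simp_all add: tensor_smult_def rel_zero)

lemma mem_tensor_class_iff: "f \<in> \<tau> g \<longleftrightarrow> f - g \<in> tensor_rel L A"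
proof
  show "f - g \<in> tensor_rel L A" if "f \<in> \<tau> g"
    using that by (auto simp: tensor_class_def r_coset_def)
  show "f \<in> \<tau> g" if "f - g \<in> tensor_rel L A"
    unfolding tensor_class_def r_coset_def using that by (intro UN_I[of "f - g"]) auto
qed

lemma tensor_class_eq_iff: "\<tau> f = \<tau> g \<longleftrightarrow> f - g \<in> tensor_rel L A"
proof
  show "f - g \<in> tensor_rel L A" if "\<tau> f = \<tau> g"
    using that mem_tensor_class_iff[of f f] mem_tensor_class_iff[of f g] rel_zero by simp
  show "\<tau> f = \<tau> g" if d: "f - g \<in> tensor_rel L A"
  proof -
    have "h - g = (h - f) + (f - g)" "h - f = (h - g) - (f - g)" for h by simp_all
    then have "h \<in> \<tau> f \<longleftrightarrow> h \<in> \<tau> g" for h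
      unfolding mem_tensor_class_iff using d rel_add rel_diff by metis
    then show ?thesis by blast
  qed
qed

lemma tensor_class_carrier:
  assumes "g \<in> carrier (tensor_free L A)" "f \<in> \<tau> g"
  shows "f \<in> carrier (tensor_free L A)"
  using assms rel.elemrcos_carrier[OF free.is_group] by (simp add: tensor_class_def)

lemma carrier_tensor_algebra: "carrier M = \<tau> ` carrier (tensor_free L A)"
  by (auto simp: tensor_algebra_def tensor_class_def carrier_FactGroup)

lemma add_tensor_class:
  assumes "f \<in> carrier (tensor_free L A)" "g \<in> carrier (tensor_free L A)"
  shows "\<tau> f \<oplus>\<^bsub>M\<^esub> \<tau> g = \<tau> (f + g)"
  using rel.rcos_sum[OF assms] by (simp add: tensor_algebra_def tensor_class_def)

text \<open>Other representatives change the product by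
\<open>f' g' - f g = (f' - f) g' + f (g' - g)\<close>, a relation.\<close>

lemma mult_tensor_class:
  assumes "f \<in> carrier (tensor_free L A)" "g \<in> carrier (tensor_free L A)"
  shows "\<tau> f \<otimes>\<^bsub>M\<^esub> \<tau> g = \<tau> (tensor_mult L A f g)"
proof -
  have eq: "\<tau> (tensor_mult L A f' g') = \<tau> (tensor_mult L A f g)" if "f' \<in> \<tau> f" "g' \<in> \<tau> g" for f' g'
  proof -
    have "tensor_mult L A f' g' - tensor_mult L A f g = tensor_mult L A (f' - f) g' + tensor_mult L A f (g' - g)"
      by (simp add: tensor_mult_diff_left tensor_mult_diff_right)
    also have "\<dots> \<in> tensor_rel L A"
      using that assms tensor_class_carrier[OF assms(2) that(2)]
      by (intro rel_add tensor_mult_rel_left tensor_mult_rel_right) (auto simp: mem_tensor_class_iff)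
    finally show ?thesis by (simp add: tensor_class_eq_iff)
  qed
  have "\<tau> f \<otimes>\<^bsub>M\<^esub> \<tau> g = (\<Union>f'\<in>\<tau> f. \<Union>g'\<in>\<tau> g. \<tau> (tensor_mult L A f' g'))"
    by (simp add: tensor_algebra_def tensor_mult_def)
  also have "\<dots> = (\<Union>f'\<in>\<tau> f. \<Union>g'\<in>\<tau> g. \<tau> (tensor_mult L A f g))"
    by (intro SUP_cong refl eq)
  also have "\<dots> = \<tau> (tensor_mult L A f g)"
  proof -
    have "f \<in> \<tau> f" "g \<in> \<tau> g" using rel_zero by (auto simp: mem_tensor_class_iff)
    then show ?thesis by blast
  qed
  finally show ?thesis .
qed

lemma smult_tensor_class:
  assumes "c \<in> carrier A" "f \<in> carrier (tensor_free L A)"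
  shows "c \<odot>\<^bsub>M\<^esub> \<tau> f = \<tau> (tensor_smult A c f)"
proof -
  have eq: "\<tau> (tensor_smult A c f') = \<tau> (tensor_smult A c f)" if "f' \<in> \<tau> f" for f'
    using that assms tensor_smult_rel by (simp add: mem_tensor_class_iff tensor_class_eq_iff tensor_smult_diff[symmetric])
  have "c \<odot>\<^bsub>M\<^esub> \<tau> f = (\<Union>f'\<in>\<tau> f. \<tau> (tensor_smult A c f'))"
    by (simp add: tensor_algebra_def tensor_smult_def)
  also have "\<dots> = (\<Union>f'\<in>\<tau> f. \<tau> (tensor_smult A c f))"
    by (intro SUP_cong refl eq)
  also have "\<dots> = \<tau> (tensor_smult A c f)"
  proof -
    have "f \<in> \<tau> f" using rel_zero by (auto simp: mem_tensor_class_iff)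
    then show ?thesis by blast
  qed
  finally show ?thesis .
qed

lemma zero_tensor_algebra: "\<zero>\<^bsub>M\<^esub> = \<tau> 0"
  using free.coset_mult_one[OF rel.subset] by (simp add: tensor_algebra_def tensor_class_def)

lemma abelian_group_tensor_algebra: "abelian_group M"
proof -
  have closed: "f + g \<in> carrier (tensor_free L A)" "- f \<in> carrier (tensor_free L A)" "0 \<in> carrier (tensor_free L A)"
    if "f \<in> carrier (tensor_free L A)" "g \<in> carrier (tensor_free L A)" for f g
    using free.m_closed[OF that] free.inv_closed[OF that(1)] free.one_closed that by simp_all
  show ?thesis
  proof (rule abelian_groupI)
    fix X assume "X \<in> carrier M"
    then obtain f where f: "X = \<tau> f" "f \<in> carrier (tensor_free L A)" by (auto simp: carrier_tensor_algebra)
    then show "\<exists>Y\<in>carrier M. Y \<oplus>\<^bsub>M\<^esub> X = \<zero>\<^bsub>M\<^esub>"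
      using closed[of f f] by (intro bexI[of _ "\<tau> (- f)"]) (auto simp: add_tensor_class zero_tensor_algebra carrier_tensor_algebra)
  qed (auto simp: carrier_tensor_algebra add_tensor_class zero_tensor_algebra closed algebra_simps intro!: imageI closed(3))
qed

lemma biadditive_tensor_algebra: "biadditive_algebra M"
proof -
  have "biadditive_algebra_axioms M"
  proof
    fix X Y assume "X \<in> carrier M" "Y \<in> carrier M"
    then show "X \<otimes>\<^bsub>M\<^esub> Y \<in> carrier M"
      by (auto simp: carrier_tensor_algebra mult_tensor_class tensor_mult_closed)
  next
    fix X Y Z assume "X \<in> carrier M" "Y \<in> carrier M" "Z \<in> carrier M"
    then obtain f g h where fgh: "X = \<tau> f" "Y = \<tau> g" "Z = \<tau> h"
      "f \<in> carrier (tensor_free L A)" "g \<in> carrier (tensor_free L A)" "h \<in> carrier (tensor_free L A)"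
      by (auto simp: carrier_tensor_algebra)
    moreover have "f + g \<in> carrier (tensor_free L A)" using free.m_closed fgh by fastforce
    ultimately show "(X \<oplus>\<^bsub>M\<^esub> Y) \<otimes>\<^bsub>M\<^esub> Z = X \<otimes>\<^bsub>M\<^esub> Z \<oplus>\<^bsub>M\<^esub> Y \<otimes>\<^bsub>M\<^esub> Z"
      "Z \<otimes>\<^bsub>M\<^esub> (X \<oplus>\<^bsub>M\<^esub> Y) = Z \<otimes>\<^bsub>M\<^esub> X \<oplus>\<^bsub>M\<^esub> Z \<otimes>\<^bsub>M\<^esub> Y"
      by (simp_all add: add_tensor_class mult_tensor_class tensor_mult_closed tensor_mult_add_left tensor_mult_add_right)
  qed
  then show ?thesis by (intro biadditive_algebra.intro abelian_group_tensor_algebra)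
qed

lemma smult_closed: "c \<in> carrier A \<Longrightarrow> X \<in> carrier M \<Longrightarrow> c \<odot>\<^bsub>M\<^esub> X \<in> carrier M"
  by (auto simp: carrier_tensor_algebra smult_tensor_class tensor_smult_closed)

lemma smult_add:
  assumes "c \<in> carrier A" "X \<in> carrier M" "Y \<in> carrier M"
  shows "c \<odot>\<^bsub>M\<^esub> (X \<oplus>\<^bsub>M\<^esub> Y) = c \<odot>\<^bsub>M\<^esub> X \<oplus>\<^bsub>M\<^esub> c \<odot>\<^bsub>M\<^esub> Y"
proof -
  obtain f g where fg: "X = \<tau> f" "Y = \<tau> g" "f \<in> carrier (tensor_free L A)" "g \<in> carrier (tensor_free L A)"
    using assms by (auto simp: carrier_tensor_algebra)
  moreover have "f + g \<in> carrier (tensor_free L A)" using free.m_closed fg by fastforce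
  ultimately show ?thesis
    using assms(1) by (simp add: add_tensor_class smult_tensor_class tensor_smult_closed tensor_smult_add)
qed

lemma pure_carrier: "x \<in> carrier L \<Longrightarrow> a \<in> carrier A \<Longrightarrow> \<tau> (frag_of (x, a)) \<in> carrier M"
  by (auto simp: carrier_tensor_algebra mem_tensor_free)

lemma pure_mult:
  "x \<in> carrier L \<Longrightarrow> y \<in> carrier L \<Longrightarrow> a \<in> carrier A \<Longrightarrow> b \<in> carrier A \<Longrightarrow>
    \<tau> (frag_of (x, a)) \<otimes>\<^bsub>M\<^esub> \<tau> (frag_of (y, b)) = \<tau> (frag_of (x \<otimes>\<^bsub>L\<^esub> y, a \<otimes>\<^bsub>A\<^esub> b))"
  by (subst mult_tensor_class) (auto simp: mem_tensor_free)

lemma pure_smult: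
  "x \<in> carrier L \<Longrightarrow> a \<in> carrier A \<Longrightarrow> c \<in> carrier A \<Longrightarrow>
    c \<odot>\<^bsub>M\<^esub> \<tau> (frag_of (x, a)) = \<tau> (frag_of (x, c \<otimes>\<^bsub>A\<^esub> a))"
  by (subst smult_tensor_class) (auto simp: mem_tensor_free)

text \<open>Through this homomorphism divisibility of a scalar \<open>a\<close> passes to the pure tensor of \<open>x\<close> and \<open>a\<close>.\<close>

lemma pure_hom:
  assumes x: "x \<in> carrier L"
  shows "(\<lambda>a. \<tau> (frag_of (x, a))) \<in> hom (add_monoid A) (add_monoid M)"
proof (rule homI)
  fix a b assume ab: "a \<in> carrier (add_monoid A)" "b \<in> carrier (add_monoid A)"
  then have "\<tau> (frag_of (x, a \<oplus>\<^bsub>A\<^esub> b)) = \<tau> (frag_of (x, a) + frag_of (x, b))"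
    using relatorI(2)[OF x, of a b] by (simp add: tensor_class_eq_iff diff_diff_add)
  also have "\<dots> = \<tau> (frag_of (x, a)) \<oplus>\<^bsub>M\<^esub> \<tau> (frag_of (x, b))"
    using ab x by (subst add_tensor_class) (auto simp: mem_tensor_free)
  finally show "\<tau> (frag_of (x, a \<otimes>\<^bsub>add_monoid A\<^esub> b)) = \<tau> (frag_of (x, a)) \<otimes>\<^bsub>add_monoid M\<^esub> \<tau> (frag_of (x, b))"
    by simp
qed (use x pure_carrier in auto)

end

lemma (in group_hom) image_generate_subset:
  assumes "S \<subseteq> carrier G" "T \<subseteq> carrier H" "h ` S \<subseteq> generate H T"
  shows "h ` generate G S \<subseteq> generate H T"
  using generate_img[OF assms(1)] H.generate_subgroup_incl[OF assms(3) H.generate_is_subgroup[OF assms(2)]] by simp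

section \<open>The lattice of p-adic integral elements\<close>

context
  fixes L :: "('a, 'm) ring_scheme" and p :: nat
  assumes L: "biadditive_algebra L" and p: "prime p"
begin

interpretation Q: cring "Qp p" by (rule Qp_cring[OF p])

interpretation T: scalar_extension L "Qp p"
  using L Q.ring_axioms by (simp add: scalar_extension_def)

interpretation M: biadditive_algebra "tensor_algebra L (Qp p)" by (rule T.biadditive_tensor_algebra)

definition pure_integral :: "'a ptensor set" where
  "pure_integral = {tensor_class L (Qp p) (frag_of (x, a)) | x a. x \<in> carrier L \<and> a \<in> carrier (Zp p)}"

lemma pure_integral_carrier: "pure_integral \<subseteq> carrier (L_Qp L p)"
  using T.pure_carrier Zp_subset_Qp[OF p] by (auto simp: pure_integral_def L_Qp_def)

lemma carrier_L_Zp: "carrier (L_Zp L p) = generate (add_monoid (L_Qp L p)) pure_integral"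
  by (simp add: L_Zp_def pure_integral_def)

lemma L_Zp_endo_closed:
  assumes "h \<in> hom (add_monoid (L_Qp L p)) (add_monoid (L_Qp L p))" "h ` pure_integral \<subseteq> carrier (L_Zp L p)" "x \<in> carrier (L_Zp L p)"
  shows "h x \<in> carrier (L_Zp L p)"
proof -
  interpret group_hom "add_monoid (L_Qp L p)" "add_monoid (L_Qp L p)" h
    using M.a_group assms(1) by (auto simp: L_Qp_def intro!: group_hom.intro group_hom_axioms.intro)
  show ?thesis
    using image_generate_subset[of pure_integral pure_integral] assms pure_integral_carrier
    unfolding carrier_L_Zp by auto
qed

lemma subgroup_L_Zp: "subgroup (carrier (L_Zp L p)) (add_monoid (L_Qp L p))"
  unfolding carrier_L_Zp using group.generate_is_subgroup[OF M.a_group, of pure_integral] pure_integral_carrier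
  by (simp add: L_Qp_def)

lemma L_Zp_subset: "carrier (L_Zp L p) \<subseteq> carrier (L_Qp L p)"
  using subgroup.subset[OF subgroup_L_Zp] by simp

text \<open>The product is additive in each variable, so closure is checked on generators and extended to the
lattice, first in the left factor and then in the right one. For pure tensors it says that \<open>L\<close> and \<open>\<int>\<^sub>p\<close> are closed under
multiplication.\<close>

lemma L_Zp_mult_closed:
  assumes "x \<in> carrier (L_Zp L p)" "y \<in> carrier (L_Zp L p)"
  shows "x \<otimes>\<^bsub>L_Qp L p\<^esub> y \<in> carrier (L_Zp L p)"
proof -
  have left: "(\<lambda>x. x \<otimes>\<^bsub>L_Qp L p\<^esub> y) \<in> hom (add_monoid (L_Qp L p)) (add_monoid (L_Qp L p))"
    and right: "(\<lambda>x. y \<otimes>\<^bsub>L_Qp L p\<^esub> x) \<in> hom (add_monoid (L_Qp L p)) (add_monoid (L_Qp L p))"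
    if "y \<in> carrier (L_Qp L p)" for y
    using that by (auto simp: hom_def L_Qp_def M.mult_closed M.mult_l_distr M.mult_r_distr)
  have pure: "x \<otimes>\<^bsub>L_Qp L p\<^esub> y \<in> pure_integral" if x: "x \<in> pure_integral" and y: "y \<in> pure_integral" for x y
  proof -
    obtain u a v b where uv: "u \<in> carrier L" "a \<in> carrier (Zp p)" "v \<in> carrier L" "b \<in> carrier (Zp p)"
      "x = tensor_class L (Qp p) (frag_of (u, a))" "y = tensor_class L (Qp p) (frag_of (v, b))"
      using x y unfolding pure_integral_def by blast
    then have "x \<otimes>\<^bsub>L_Qp L p\<^esub> y = tensor_class L (Qp p) (frag_of (u \<otimes>\<^bsub>L\<^esub> v, a \<otimes>\<^bsub>Qp p\<^esub> b))"
      using T.pure_mult[of u v a b] Zp_subset_Qp[OF p] by (auto simp: L_Qp_def)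
    then show ?thesis
      unfolding pure_integral_def using uv T.L.mult_closed[of u v] Zp_mult_closed[OF p, of a b] by blast
  qed
  have step: "x \<otimes>\<^bsub>L_Qp L p\<^esub> y \<in> carrier (L_Zp L p)" if "x \<in> carrier (L_Zp L p)" "y \<in> pure_integral" for x y
  proof (rule L_Zp_endo_closed[OF left])
    show "(\<lambda>x. x \<otimes>\<^bsub>L_Qp L p\<^esub> y) ` pure_integral \<subseteq> carrier (L_Zp L p)"
      using pure that by (auto simp: carrier_L_Zp intro: generate.incl)
  qed (use that pure_integral_carrier in auto)
  show ?thesis
    by (rule L_Zp_endo_closed[OF right]) (use step assms L_Zp_subset in auto)
qed

lemma L_Zp_smult_closed:
  assumes c: "c \<in> carrier (Zp p)" and x: "x \<in> carrier (L_Zp L p)"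
  shows "c \<odot>\<^bsub>L_Qp L p\<^esub> x \<in> carrier (L_Zp L p)"
proof (rule L_Zp_endo_closed[OF _ _ x])
  have c': "c \<in> carrier (Qp p)" using c Zp_subset_Qp[OF p] by blast
  show "(\<lambda>x. c \<odot>\<^bsub>L_Qp L p\<^esub> x) \<in> hom (add_monoid (L_Qp L p)) (add_monoid (L_Qp L p))"
    using T.smult_closed[OF c'] T.smult_add[OF c'] by (auto simp: hom_def L_Qp_def)
  have "c \<odot>\<^bsub>L_Qp L p\<^esub> y \<in> pure_integral" if y: "y \<in> pure_integral" for y
  proof -
    obtain u a where ua: "u \<in> carrier L" "a \<in> carrier (Zp p)" "y = tensor_class L (Qp p) (frag_of (u, a))"
      using y unfolding pure_integral_def by blast
    then have "c \<odot>\<^bsub>L_Qp L p\<^esub> y = tensor_class L (Qp p) (frag_of (u, c \<otimes>\<^bsub>Qp p\<^esub> a))"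
      using T.pure_smult[of u a c] c' Zp_subset_Qp[OF p] by (auto simp: L_Qp_def)
    then show ?thesis
      unfolding pure_integral_def using ua Zp_mult_closed[OF p c, of a] by blast
  qed
  then show "(\<lambda>x. c \<odot>\<^bsub>L_Qp L p\<^esub> x) ` pure_integral \<subseteq> carrier (L_Zp L p)"
    by (auto simp: carrier_L_Zp intro: generate.incl)
qed

text \<open>The elements with a \<open>q\<close>-th part form a subgroup, and it contains the generators \<open>x \<otimes> a\<close> since \<open>a\<close> is
divisible by \<open>q\<close> in \<open>\<int>\<^sub>p\<close>. The group is written multiplicatively here.\<close>

lemma L_Zp_divisible:
  assumes q: "prime q" "q \<noteq> p" and x: "x \<in> carrier (L_Zp L p)"
  shows "\<exists>y\<in>carrier (L_Zp L p). x = y [^]\<^bsub>add_monoid (L_Qp L p)\<^esub> q"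
proof -
  let ?A = "add_monoid (L_Qp L p)"
  interpret A: comm_group ?A using M.a_comm_group by (simp add: L_Qp_def)
  have sub: "y \<in> carrier ?A" if "y \<in> generate ?A pure_integral" for y
    using that L_Zp_subset by (auto simp: carrier_L_Zp)
  show ?thesis
    using x unfolding carrier_L_Zp
  proof induction
    case one
    then show ?case using generate.one[of ?A] A.nat_pow_one by metis
  next
    have gen: "\<exists>y\<in>generate ?A pure_integral. h = y [^]\<^bsub>?A\<^esub> q" if h: "h \<in> pure_integral" for h
    proof -
      obtain u a where ua: "u \<in> carrier L" "a \<in> carrier (Zp p)" "h = tensor_class L (Qp p) (frag_of (u, a))"
        using h unfolding pure_integral_def by blast
      obtain b where b: "b \<in> carrier (Zp p)" "a = add_pow (Qp p) q b"
        using Zp_divisible_coprime[OF p q ua(2)] by blast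
      let ?h = "\<lambda>a. tensor_class L (Qp p) (frag_of (u, a))"
      interpret group_hom "add_monoid (Qp p)" ?A ?h
        using T.pure_hom[OF ua(1)] Q.a_group A.is_group
        by (auto simp: L_Qp_def intro!: group_hom.intro group_hom_axioms.intro)
      have "h = ?h b [^]\<^bsub>?A\<^esub> q"
        using hom_nat_pow[of b q] b Zp_subset_Qp[OF p] ua by (auto simp: add_pow_def)
      moreover have "?h b \<in> generate ?A pure_integral"
        using b ua by (intro generate.incl) (auto simp: pure_integral_def)
      ultimately show ?thesis by blast
    qed
    case (incl h)
    then show ?case by (rule gen)
    case (inv h)
    then obtain y where y: "y \<in> generate ?A pure_integral" "h = y [^]\<^bsub>?A\<^esub> q" using gen by blast
    then have "inv\<^bsub>?A\<^esub> h = (inv\<^bsub>?A\<^esub> y) [^]\<^bsub>?A\<^esub> q" using sub A.nat_pow_inv by simp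
    then show ?case using y A.generate_m_inv_closed[of pure_integral y] pure_integral_carrier by auto
  next
    case (eng h1 h2)
    then obtain y z where "y \<in> generate ?A pure_integral" "h1 = y [^]\<^bsub>?A\<^esub> q" "z \<in> generate ?A pure_integral" "h2 = z [^]\<^bsub>?A\<^esub> q"
      by blast
    then show ?case using sub generate.eng A.pow_mult_distrib[OF A.m_comm] by (metis)
  qed
qed

end

lemma Zp_eq: "Zp p = (Qp p)\<lparr>carrier := carrier (Zp p)\<rparr>"
  by (simp add: Zp_def)

lemma L_Zp_eq: "L_Zp L p = (L_Qp L p)\<lparr>carrier := carrier (L_Zp L p)\<rparr>"
  by (simp add: L_Zp_def)

context
  fixes L :: "('a, 'm) ring_scheme"
  assumes L: "biadditive_algebra L"
begin

lemma local_lattice: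
  assumes p: "prime p"
  shows "algebra_with_lattice (Qp p) (L_Qp L p) (carrier (Zp p)) (carrier (L_Zp L p))"
proof -
  interpret Q: cring "Qp p" by (rule Qp_cring[OF p])
  interpret T: scalar_extension L "Qp p"
    using L Q.ring_axioms by (simp add: scalar_extension_def)
  have "biadditive_algebra (L_Qp L p)" unfolding L_Qp_def by (rule T.biadditive_tensor_algebra)
  then show ?thesis
    using subgroup_L_Zp[OF L p] L_Zp_mult_closed[OF L p] L_Zp_smult_closed[OF L p] T.smult_closed Zp_subset_Qp[OF p]
    by (auto simp: algebra_with_lattice_def algebra_with_lattice_axioms_def scalar_algebra_def scalar_algebra_axioms_def L_Qp_def)
qed

context
  fixes p :: nat
  assumes p: "prime p"
begin

interpretation N: algebra_with_lattice "Qp p" "L_Qp L p" "carrier (Zp p)" "carrier (L_Zp L p)"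
  by (rule local_lattice[OF p])

lemma loc_eq: "G_loc L p = N.GA" "Delta_loc L p = N.\<Delta>N" "Gamma_loc L p = N.\<Gamma>N" "index_loc L p = N.indexN"
  by (auto simp: G_loc_def Delta_loc_def Gamma_loc_def N.\<Delta>N_def N.\<Gamma>N_def index_loc_def[abs_def] N.indexN_def[abs_def]
      Zp_eq[symmetric] L_Zp_eq[symmetric])

lemma group_G_loc: "group (G_loc L p)"
  unfolding loc_eq by (rule N.group_GA)

lemma subgroup_Gamma_loc: "subgroup (Gamma_loc L p) (G_loc L p)"
  unfolding loc_eq by (rule N.subgroup_\<Gamma>N)

lemma Delta_loc_carrier: "Delta_loc L p \<subseteq> carrier (G_loc L p)"
  by (auto simp: Delta_loc_def)

lemma Gamma_loc_subset_Delta_loc: "Gamma_loc L p \<subseteq> Delta_loc L p"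
  unfolding loc_eq by (rule N.\<Gamma>N_subset_\<Delta>N)

lemma index_loc_double_coset:
  assumes \<alpha>: "\<alpha> \<in> Delta_loc L p" and \<beta>: "\<beta> \<in> double_coset (G_loc L p) (Gamma_loc L p) \<alpha>"
  shows "\<beta> \<in> Delta_loc L p" "index_loc L p \<beta> = index_loc L p \<alpha>"
proof -
  obtain \<gamma> \<delta> where gd: "\<gamma> \<in> N.\<Gamma>N" "\<delta> \<in> N.\<Gamma>N" "\<beta> = \<gamma> \<otimes>\<^bsub>N.GA\<^esub> \<alpha> \<otimes>\<^bsub>N.GA\<^esub> \<delta>"
    using \<beta> unfolding mem_double_coset_iff loc_eq by blast
  have 1: "\<gamma> \<otimes>\<^bsub>N.GA\<^esub> \<alpha> \<in> N.\<Delta>N"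
    using gd(1) \<alpha> N.\<Gamma>N_subset_\<Delta>N unfolding loc_eq by (intro N.\<Delta>N_mult_closed) auto
  show "\<beta> \<in> Delta_loc L p"
    unfolding loc_eq gd(3) by (rule N.\<Delta>N_mult_closed[OF 1 subsetD[OF N.\<Gamma>N_subset_\<Delta>N gd(2)]])
  show "index_loc L p \<beta> = index_loc L p \<alpha>"
    unfolding loc_eq gd(3) N.indexN_mult_right[OF 1 gd(2)] by (rule N.indexN_mult_left[OF gd(1)])
qed

lemma index_loc_eq_1_iff: "\<alpha> \<in> Delta_loc L p \<Longrightarrow> index_loc L p \<alpha> = 1 \<longleftrightarrow> \<alpha> \<in> Gamma_loc L p"
  unfolding loc_eq by (rule N.indexN_eq_1_iff)

lemma group_add_L_Zp: "comm_group (add_monoid (L_Zp L p))"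
  using N.add_group_MN by (simp add: L_Zp_eq[symmetric])

lemma subgroup_image_L_Zp:
  "\<alpha> \<in> Delta_loc L p \<Longrightarrow> subgroup (\<alpha> ` carrier (L_Zp L p)) (add_monoid (L_Zp L p))"
  unfolding loc_eq using N.subgroup_image by (simp add: L_Zp_eq[symmetric])

lemma index_loc_eq_card_rcosets:
  "index_loc L p \<alpha> = card (rcosets\<^bsub>add_monoid (L_Zp L p)\<^esub> (\<alpha> ` carrier (L_Zp L p)))"
  by (simp add: index_loc_def A_RCOSETS_def)

text \<open>\<open>L\<^sub>p\<close> is divisible by all primes other than \<open>p\<close>.\<close>

lemma index_loc_prime_power:
  assumes \<alpha>: "\<alpha> \<in> Delta_loc L p" and nz: "index_loc L p \<alpha> \<noteq> 0"
  shows "\<exists>k. index_loc L p \<alpha> = p ^ k"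
  unfolding index_loc_eq_card_rcosets
proof (rule comm_group.index_prime_power_of_divisible[OF group_add_L_Zp p subgroup_image_L_Zp[OF \<alpha>]])
  show "card (rcosets\<^bsub>add_monoid (L_Zp L p)\<^esub> (\<alpha> ` carrier (L_Zp L p))) \<noteq> 0"
    using nz by (simp add: index_loc_eq_card_rcosets)
next
  fix q x assume q: "prime q" "q \<noteq> p" and "x \<in> carrier (add_monoid (L_Zp L p))"
  then obtain y where y: "y \<in> carrier (L_Zp L p)" "x = y [^]\<^bsub>add_monoid (L_Qp L p)\<^esub> q"
    using L_Zp_divisible[OF L p q, of x] by auto
  have "add_monoid (L_Zp L p) = (add_monoid (L_Qp L p))\<lparr>carrier := carrier (L_Zp L p)\<rparr>"
    by (simp add: L_Zp_def)
  then have "x = y [^]\<^bsub>add_monoid (L_Zp L p)\<^esub> q"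
    using y(2) monoid.nat_pow_consistent[OF group.is_monoid[OF N.a_group], of y q] by simp
  then show "\<exists>y\<in>carrier (add_monoid (L_Zp L p)). x = y [^]\<^bsub>add_monoid (L_Zp L p)\<^esub> q"
    using y(1) by auto
qed

end

section \<open>The sums over elements of given index\<close>

interpretation hecke_family primes "G_loc L" "Gamma_loc L" "Delta_loc L"
  by (rule hecke_family.intro) (use group_G_loc subgroup_Gamma_loc Delta_loc_carrier in auto)

lemma hat_eq: "G_hat L = Ghat" "Gamma_hat L = \<Gamma>hat" "Delta_hat L = \<Delta>hat" "R_hat L = hecke_ring Ghat \<Gamma>hat \<Delta>hat"
  by (simp_all add: G_hat_def Gamma_hat_def Delta_hat_def R_hat_def restricted_product_def)

text \<open>The condition on \<open>n\<close> is split into its local conditions; at the primes not dividing \<open>n\<close> it describes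
\<^term>\<open>Gamma_loc L p\<close>.\<close>

definition Delta_of_index :: "nat \<Rightarrow> nat \<Rightarrow> ('a ptensor \<Rightarrow> 'a ptensor) set" where
  "Delta_of_index n p = {\<alpha> \<in> Delta_loc L p. index_loc L p \<alpha> = p ^ multiplicity p n}"

lemma Delta_of_index_eq_Gamma_iff:
  assumes "prime p" "n > 0"
  shows "Delta_of_index n p = Gamma_loc L p \<longleftrightarrow> \<not> p dvd n"
proof
  show "Delta_of_index n p = Gamma_loc L p" if "\<not> p dvd n"
    using that assms index_loc_eq_1_iff[OF assms(1)] Gamma_loc_subset_Delta_loc[OF assms(1)]
    by (auto simp: Delta_of_index_def not_dvd_imp_multiplicity_0)
next
  assume eq: "Delta_of_index n p = Gamma_loc L p"
  have "\<one>\<^bsub>G_loc L p\<^esub> \<in> Gamma_loc L p" using subgroup.one_closed[OF subgroup_Gamma_loc[OF assms(1)]] .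
  then have "index_loc L p \<one>\<^bsub>G_loc L p\<^esub> = 1" "\<one>\<^bsub>G_loc L p\<^esub> \<in> Delta_of_index n p"
    using eq index_loc_eq_1_iff[OF assms(1)] Gamma_loc_subset_Delta_loc[OF assms(1)] by auto
  then have "p ^ multiplicity p n = 1" by (simp add: Delta_of_index_def)
  then have "multiplicity p n = 0" using prime_gt_1_nat[OF assms(1)] by simp
  then show "\<not> p dvd n" using assms prime_gt_1_nat[OF assms(1)] multiplicity_eq_zero_iff[of n p] by auto
qed

lemma biinvariant_Delta_of_index:
  assumes "n > 0"
  shows "biinvariant (Delta_of_index n)"
proof -
  have "{p \<in> primes. Delta_of_index n p \<noteq> Gamma_loc L p} \<subseteq> {p. p dvd n}"
    using assms Delta_of_index_eq_Gamma_iff by auto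
  then show ?thesis
    unfolding biinvariant_def using assms index_loc_double_coset finite_subset[OF _ finite_divisors_nat]
    by (auto simp: Delta_of_index_def)
qed

lemma index_hat_eq_prod:
  assumes \<alpha>: "\<alpha> \<in> Delta_hat L" and S: "finite S" "S \<subseteq> primes" "\<And>p. p \<in> primes - S \<Longrightarrow> \<alpha> p \<in> Gamma_loc L p"
  shows "index_hat L \<alpha> = (\<Prod>p\<in>S. index_loc L p (\<alpha> p))"
proof -
  have mem: "\<alpha> p \<in> Delta_loc L p" if "prime p" for p using \<alpha> that by (auto simp: hat_eq)
  have image: "(\<lambda>x. \<lambda>p\<in>primes. \<alpha> p (x p)) ` carrier (L_hat L) = (\<Pi>\<^sub>E p\<in>primes. \<alpha> p ` carrier (L_Zp L p))"
  proof
    show "(\<lambda>x. \<lambda>p\<in>primes. \<alpha> p (x p)) ` carrier (L_hat L) \<subseteq> (\<Pi>\<^sub>E p\<in>primes. \<alpha> p ` carrier (L_Zp L p))"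
      by (auto simp: L_hat_def)
    show "(\<Pi>\<^sub>E p\<in>primes. \<alpha> p ` carrier (L_Zp L p)) \<subseteq> (\<lambda>x. \<lambda>p\<in>primes. \<alpha> p (x p)) ` carrier (L_hat L)"
    proof
      fix y assume y: "y \<in> (\<Pi>\<^sub>E p\<in>primes. \<alpha> p ` carrier (L_Zp L p))"
      then have "\<forall>p\<in>primes. \<exists>x. x \<in> carrier (L_Zp L p) \<and> y p = \<alpha> p x" by (auto simp: PiE_iff)
      then obtain x where x: "\<And>p. p \<in> primes \<Longrightarrow> x p \<in> carrier (L_Zp L p) \<and> y p = \<alpha> p (x p)" by metis
      then have "y = (\<lambda>p\<in>primes. \<alpha> p (restrict x primes p))"
        using y by (intro ext) (auto simp: PiE_iff extensional_def)
      then show "y \<in> (\<lambda>x. \<lambda>p\<in>primes. \<alpha> p (x p)) ` carrier (L_hat L)"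
        using x by (intro image_eqI[of _ _ "restrict x primes"]) (auto simp: L_hat_def)
    qed
  qed
  have "index_hat L \<alpha> = (\<Prod>p\<in>S. card (rcosets\<^bsub>add_monoid (L_Zp L p)\<^esub> (\<alpha> p ` carrier (L_Zp L p))))"
    unfolding index_hat_def image unfolding L_hat_def
  proof (rule card_rcosets_product_group)
    show "group (add_monoid (L_Zp L p))" if "p \<in> primes" for p
      using that group_add_L_Zp by (auto simp: comm_group_def)
    show "subgroup (\<alpha> p ` carrier (L_Zp L p)) (add_monoid (L_Zp L p))" if "p \<in> primes" for p
      using that subgroup_image_L_Zp mem by auto
    show "\<alpha> p ` carrier (L_Zp L p) = carrier (add_monoid (L_Zp L p))" if "p \<in> primes - S" for p
      using that S(3)[OF that] algebra_with_lattice.mem_\<Gamma>N_iff[OF local_lattice, of p "\<alpha> p"] loc_eq(3)[of p] by auto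
  qed (use S in auto)
  also have "\<dots> = (\<Prod>p\<in>S. index_loc L p (\<alpha> p))"
    using S by (intro prod.cong refl) (auto simp: index_loc_eq_card_rcosets)
  finally show ?thesis .
qed

text \<open>The index is a product of local indices. If it is \<open>n > 0\<close>, then all of these are finite, hence
powers of their respective primes, and uniqueness of the prime factorization determines them.\<close>

lemma index_hat_eq_iff:
  assumes \<alpha>: "\<alpha> \<in> Delta_hat L" and n: "n > 0"
  shows "index_hat L \<alpha> = n \<longleftrightarrow> (\<forall>p\<in>primes. index_loc L p (\<alpha> p) = p ^ multiplicity p n)"
proof -
  have mem: "\<alpha> p \<in> Delta_loc L p" if "prime p" for p using \<alpha> that by (auto simp: hat_eq)
  \<comment> \<open>a finite set outside of which both the local index and the power of \<open>p\<close> dividing \<open>n\<close> are 1\<close>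
  define S where "S = {p \<in> primes. \<alpha> p \<notin> Gamma_loc L p} \<union> prime_factors n"
  have S: "finite S" "S \<subseteq> primes" "prime_factors n \<subseteq> S"
    using \<alpha> by (auto simp: S_def hat_eq mem_carrier_iff)
  have off: "\<alpha> p \<in> Gamma_loc L p" if "p \<in> primes - S" for p using that by (auto simp: S_def)
  have prod: "index_hat L \<alpha> = (\<Prod>p\<in>S. index_loc L p (\<alpha> p))"
    by (rule index_hat_eq_prod[OF \<alpha> S(1,2) off])
  show ?thesis
  proof
    assume *: "index_hat L \<alpha> = n"
    then have "\<forall>p\<in>S. index_loc L p (\<alpha> p) \<noteq> 0" using n prod S(1) by auto
    then have "\<forall>p\<in>S. \<exists>k. index_loc L p (\<alpha> p) = p ^ k"
      using S(2) mem index_loc_prime_power by blast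
    then obtain k where k: "\<And>p. p \<in> S \<Longrightarrow> index_loc L p (\<alpha> p) = p ^ k p" by metis
    then have "n = (\<Prod>p\<in>S. p ^ k p)" using * prod by simp
    then have "multiplicity p n = (if p \<in> S then k p else 0)" if "prime p" for p
      using multiplicity_prod_prime_powers[OF S(1) _ that, of k] subsetD[OF S(2)] by auto
    then show "\<forall>p\<in>primes. index_loc L p (\<alpha> p) = p ^ multiplicity p n"
      using k off mem index_loc_eq_1_iff by auto
  next
    assume *: "\<forall>p\<in>primes. index_loc L p (\<alpha> p) = p ^ multiplicity p n"
    have "index_hat L \<alpha> = (\<Prod>p\<in>S. p ^ multiplicity p n)"
      unfolding prod using * S(2) by (intro prod.cong) auto
    also have "\<dots> = (\<Prod>p\<in>prime_factors n. p ^ multiplicity p n)"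
    proof (intro prod.mono_neutral_right ballI S)
      fix p assume "p \<in> S - prime_factors n"
      then have "\<not> p dvd n" using S(2) n by (auto simp: prime_factors_dvd)
      then show "p ^ multiplicity p n = 1" by (simp add: not_dvd_imp_multiplicity_0)
    qed
    also have "\<dots> = n" using prime_factorization_nat[OF n] by simp
    finally show "index_hat L \<alpha> = n" .
  qed
qed

lemma T_hat_eq_hecke_sum:
  assumes n: "n > 0"
  shows "T_hat L n = hecke_sum (Delta_of_index n)"
proof -
  have "{\<alpha> \<in> Delta_hat L. index_hat L \<alpha> = n} = PiE primes (Delta_of_index n)"
  proof
    show "{\<alpha> \<in> Delta_hat L. index_hat L \<alpha> = n} \<subseteq> PiE primes (Delta_of_index n)"
    proof clarify
      fix \<alpha> assume \<alpha>: "\<alpha> \<in> Delta_hat L" "n = index_hat L \<alpha>"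
      then have "\<forall>p\<in>primes. index_loc L p (\<alpha> p) = p ^ multiplicity p n"
        using index_hat_eq_iff[OF \<alpha>(1) n] by simp
      then show "\<alpha> \<in> PiE primes (Delta_of_index (index_hat L \<alpha>))"
        using \<alpha> by (auto simp: hat_eq PiE_iff Delta_of_index_def)
    qed
    show "PiE primes (Delta_of_index n) \<subseteq> {\<alpha> \<in> Delta_hat L. index_hat L \<alpha> = n}"
    proof
      fix \<alpha> assume \<alpha>: "\<alpha> \<in> PiE primes (Delta_of_index n)"
      then have \<alpha>': "\<alpha> \<in> Delta_hat L"
        using biinvariant_PiE(2)[OF biinvariant_Delta_of_index[OF n]] unfolding hat_eq by blast
      then show "\<alpha> \<in> {\<alpha> \<in> Delta_hat L. index_hat L \<alpha> = n}"
        using \<alpha> by (auto simp: index_hat_eq_iff[OF \<alpha>' n] PiE_iff Delta_of_index_def)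
    qed
  qed
  then show ?thesis
    unfolding T_hat_def hecke_sum_def hat_eq by simp
qed

lemma T_hat_carrier: "n > 0 \<Longrightarrow> T_hat L n \<in> carrier (R_hat L)"
  unfolding hat_eq using T_hat_eq_hecke_sum hecke_sum_carrier[OF biinvariant_Delta_of_index] by simp

lemma T_hat_multiplicative: "multiplicative_seq (R_hat L) (T_hat L)"
  unfolding multiplicative_seq_def
proof (intro conjI allI impI)
  have "PiE primes (Delta_of_index 1) = PiE primes (Gamma_loc L)"
    using Delta_of_index_eq_Gamma_iff[of _ 1] by (intro PiE_cong) auto
  then have "hecke_sum (Delta_of_index 1) = hecke_sum (Gamma_loc L)" by (simp add: hecke_sum_def)
  then show "T_hat L 1 = \<one>\<^bsub>R_hat L\<^esub>"
    unfolding hat_eq by (simp add: T_hat_eq_hecke_sum hecke_sum_one)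
next
  fix m n :: nat assume mn: "m > 0" "n > 0" "coprime m n"
  have cop: "\<not> (p dvd m \<and> p dvd n)" if "prime p" for p
    using mn(3) that by (meson coprime_common_divisor not_prime_unit)
  have "hecke_sum (Delta_of_index (m * n)) =
      hecke_sum (Delta_of_index m) \<otimes>\<^bsub>hecke_ring Ghat \<Gamma>hat \<Delta>hat\<^esub> hecke_sum (Delta_of_index n)"
  proof (rule hecke_sum_mult)
    fix p assume "p \<in> primes"
    then have p: "prime p" by simp
    show "Delta_of_index m p = Gamma_loc L p \<or> Delta_of_index n p = Gamma_loc L p"
      using cop[OF p] p mn by (auto simp: Delta_of_index_eq_Gamma_iff)
    have "multiplicity p (m * n) = multiplicity p m + multiplicity p n"
      using mn p by (intro prime_elem_multiplicity_mult_distrib) auto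
    then have "multiplicity p (m * n) = (if p dvd m then multiplicity p m else multiplicity p n)"
      using cop[OF p] by (auto simp: not_dvd_imp_multiplicity_0)
    then show "Delta_of_index (m * n) p =
        (if Delta_of_index m p = Gamma_loc L p then Delta_of_index n p else Delta_of_index m p)"
      using p mn by (auto simp: Delta_of_index_eq_Gamma_iff) (auto simp: Delta_of_index_def)
  qed (use mn biinvariant_Delta_of_index in auto)
  then show "T_hat L (m * n) = T_hat L m \<otimes>\<^bsub>R_hat L\<^esub> T_hat L n"
    unfolding hat_eq using mn by (simp add: T_hat_eq_hecke_sum)
qed

lemma embed_hat_P_loc:
  assumes p: "prime p"
  shows "embed_hat L p (P_loc L p k) = T_hat L (p ^ k)"
proof -
  have pos: "p ^ k > 0" using prime_gt_0_nat[OF p] by simp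
  have "{\<alpha> \<in> Delta_loc L p. index_loc L p \<alpha> = p ^ k} = Delta_of_index (p ^ k) p"
    using prime_gt_1_nat[OF p] multiplicity_same_power[of p k] by (auto simp: Delta_of_index_def)
  moreover have "Delta_of_index (p ^ k) q = Gamma_loc L q" if "q \<in> primes" "q \<noteq> p" for q
    using that p pos by (auto simp: Delta_of_index_eq_Gamma_iff dest: prime_dvd_power primes_dvd_imp_eq)
  ultimately show ?thesis
    using hecke_sum_single[OF biinvariant_Delta_of_index[OF pos], of p] p
    unfolding embed_hat_def P_loc_def T_loc_def incl_hat_def[abs_def] hat_eq T_hat_eq_hecke_sum[OF pos] by simp
qed

end

theorem theorem3p1:
  fixes L :: "('a, 'm) ring_scheme"
  assumes "biadditive_algebra L" and "free_of_finite_rank L"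
  shows "(\<forall>n>0. T_hat L n \<in> carrier (R_hat L)) \<and>
         multiplicative_seq (R_hat L) (T_hat L) \<and>
         D_hat L =
           prime_product (R_hat L)
             (\<lambda>p. subst_prime (R_hat L) p (\<lambda>k. embed_hat L p (P_loc L p k)))"
proof (intro conjI)
  note L = assms(1)
  show "\<forall>n>0. T_hat L n \<in> carrier (R_hat L)" using T_hat_carrier[OF L] by blast
  show "multiplicative_seq (R_hat L) (T_hat L)" by (rule T_hat_multiplicative[OF L])
  let ?F = "\<lambda>p. subst_prime (R_hat L) p (\<lambda>k. embed_hat L p (P_loc L p k))"
  have F: "?F p (p ^ k) = T_hat L (p ^ k)" if "prime p" for p k
    using that prime_gt_0_nat[OF that] prime_gt_1_nat[OF that]
    by (simp add: subst_prime_def dirichlet_series_def embed_hat_P_loc[OF L])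
  show "D_hat L = prime_product (R_hat L) ?F"
  proof
    fix n
    show "D_hat L n = prime_product (R_hat L) ?F n"
    proof (cases "n = 0")
      case True
      then show ?thesis by (simp add: D_hat_def prime_product_def dirichlet_series_def)
    next
      case False
      then have "prime_product (R_hat L) ?F n = T_hat L n"
        using T_hat_multiplicative[OF L] T_hat_carrier[OF L] F
        by (intro prime_product_multiplicative_seq[where k = "\<lambda>p. multiplicity p n"]) auto
      then show ?thesis using False by (simp add: D_hat_def dirichlet_series_def)
    qed
  qed
qed

end
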